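(* (Covering property.) Let $n$ be a positive integer, let $y,z\in\tilde I_n$ and $\pi\in\mathcal{A}(y)$, and let $i<j\not\equiv i\pmod n$ be integers such that $\pi\lessdot\pi t_{ij}$. Then $\pi t_{ij}\in\mathcal{A}(z)$ if and only if $z=\tau^n_{ij}(y)\ne y$.
   Context: **Affine permutations.** $\tilde S_n$ is the group (under composition) of bijections $\pi:\mathbb{Z}\to\mathbb{Z}$ with $\pi(i+n)=\pi(i)+n$ for all $i\in\mathbb{Z}$ and $\pi(1)+\dots+\pi(n)=1+\dots+n$. For $i\in\mathbb{Z}$, $s_i\in\tilde S_n$ interchanges $i$ and $i+1$ and fixes every integer not in $\{i,i+1\}+n\mathbb{Z}$; $s_1,\dots,s_n$ generate $\tilde S_n$, and $\ell(\pi)$ is the minimal length of a factorization of $\pi$ into these generators. For $i<j\not\equiv i\pmod n$, $t_{ij}\in\tilde S_n$ interchanges $i$ and $j$ and fixes every integer not in $\{i,j\}+n\mathbb{Z}$. Write $\tilde I_n=\{z\in\tilde S_n:z=z^{-1}\}$. Write $\pi\lessdot\sigma$ if $\ell(\sigma)=\ell(\pi)+1$ and $\sigma=\pi t_{ij}$ for some $i<j\not\equiv i\pmod n$. **Atoms.** $\circ$ is the unique associative product on $\tilde S_n$ with $s_i\circ s_i=s_i$ and $\pi'\circ\pi''=\pi'\pi''$ whenever $\ell(\pi'\pi'')=\ell(\pi')+\ell(\pi'')$. For $z\in\tilde I_n$, $\mathcal{A}(z)$ is the (finite, nonempty) set of minimal-length elements of $\{\pi\in\tilde S_n:\pi^{-1}\circ\pi=z\}$.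 **The operators $\tau^n_{ij}$.** Let $y\in\tilde I_n$ and $i<j\not\equiv i\pmod n$. Let $\overline y\in\tilde I_n$ fix every integer in $\{i,j,y(i),y(j)\}+n\mathbb{Z}$ and act as $k\mapsto y(k)$ on all other integers. Then $\tau^n_{ij}(y)\in\tilde I_n$ is defined to be: - $t_{ij}\,y\,t_{ij}$ if $y(i)<i<j<y(j)$, or $i<j<y(i)<y(j)$, or $y(i)<y(j)<i<j$; - $t_{i,y(j)}\,y\,t_{i,y(j)}$ if $i<y(j)<y(i)<j$ and $i\not\equiv y(j)\pmod n$; - $t_{ij}\,\overline y$ if $i<y(j)<y(i)<j$ and $i\equiv y(j)\pmod n$; - $t_{ij}\,\overline y$ if $i=y(i)<j=y(j)$, or $i=y(i)<y(j)<j$, or $i<y(i)<j=y(j)$, or $i<y(i)<y(j)<j$; - $t_{i,y(j)}\,\overline y$ if $i=y(i)<j<y(j)$ or $i<y(i)<j<y(j)$; - $t_{y(i),j}\,\overline y$ if $y(i)<i<j=y(j)$ or $y(i)<i<y(j)<j$; - $y$ in all other cases. *)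

theory Defs
  imports "HOL-Number_Theory.Cong" "HOL-Library.FuncSet"
begin

definition affine_perms :: "nat \<Rightarrow> (int \<Rightarrow> int) set" where
  "affine_perms n = {\<pi>. bij \<pi> \<and> (\<forall>i. \<pi> (i + int n) = \<pi> i + int n)
     \<and> (\<Sum>i = 1..int n. \<pi> i) = (\<Sum>i = 1..int n. i)}"

definition affine_involutions :: "nat \<Rightarrow> (int \<Rightarrow> int) set" where
  "affine_involutions n = {z \<in> affine_perms n. z = inv z}"

text \<open>
  The reflection \<open>t\<^sub>i\<^sub>j\<close> is only meaningful for \<open>i\<close>, \<open>j\<close> incongruent modulo \<open>n\<close>. The function is
  completed by the identity when \<open>i\<close> and \<open>j\<close> are congruent; in this way the simple
  reflections below lie in the (then trivial) group \<open>affine_perms 1\<close>.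
\<close>

definition refl_t :: "nat \<Rightarrow> int \<Rightarrow> int \<Rightarrow> int \<Rightarrow> int" where
  "refl_t n i j k =
     (if [i = j] (mod int n) then k
      else if [k = i] (mod int n) then k + (j - i)
      else if [k = j] (mod int n) then k - (j - i)
      else k)"

abbreviation simple_s :: "nat \<Rightarrow> int \<Rightarrow> int \<Rightarrow> int" where
  "simple_s n i \<equiv> refl_t n i (i + 1)"

definition word_prod :: "nat \<Rightarrow> int list \<Rightarrow> int \<Rightarrow> int" where
  "word_prod n w = foldr (\<lambda>i f. simple_s n i \<circ> f) w id"

definition len :: "nat \<Rightarrow> (int \<Rightarrow> int) \<Rightarrow> nat" where
  "len n \<pi> = (LEAST m. \<exists>w. set w \<subseteq> {1..int n} \<and> length w = m \<and> word_prod n w = \<pi>)"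

definition bruhat_covered :: "nat \<Rightarrow> (int \<Rightarrow> int) \<Rightarrow> (int \<Rightarrow> int) \<Rightarrow> bool" where
  "bruhat_covered n \<pi> \<sigma> \<longleftrightarrow> \<pi> \<in> affine_perms n \<and> \<sigma> \<in> affine_perms n
     \<and> len n \<sigma> = len n \<pi> + 1
     \<and> (\<exists>i j. i < j \<and> \<not> [i = j] (mod int n) \<and> \<sigma> = \<pi> \<circ> refl_t n i j)"

definition is_demazure_product ::
  "nat \<Rightarrow> ((int \<Rightarrow> int) \<Rightarrow> (int \<Rightarrow> int) \<Rightarrow> (int \<Rightarrow> int)) \<Rightarrow> bool" where
  "is_demazure_product n p \<longleftrightarrow>
     p \<in> affine_perms n \<rightarrow>\<^sub>E affine_perms n \<rightarrow>\<^sub>E affine_perms n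
     \<and> (\<forall>u\<in>affine_perms n. \<forall>v\<in>affine_perms n. \<forall>w\<in>affine_perms n. p (p u v) w = p u (p v w))
     \<and> (\<forall>i. p (simple_s n i) (simple_s n i) = simple_s n i)
     \<and> (\<forall>u\<in>affine_perms n. \<forall>v\<in>affine_perms n.
          len n (u \<circ> v) = len n u + len n v \<longrightarrow> p u v = u \<circ> v)"

text \<open>
  The functions in \<^const>\<open>is_demazure_product\<close> are extensional (value \<^const>\<open>undefined\<close> outside the
  group), so that uniqueness of the product on the group is uniqueness of the HOL function.
\<close>

definition demazure :: "nat \<Rightarrow> (int \<Rightarrow> int) \<Rightarrow> (int \<Rightarrow> int) \<Rightarrow> (int \<Rightarrow> int)" where
  "demazure n = (THE p. is_demazure_product n p)"

definition atoms :: "nat \<Rightarrow> (int \<Rightarrow> int) \<Rightarrow> (int \<Rightarrow> int) set" where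
  "atoms n z = {\<pi> \<in> affine_perms n. demazure n (inv \<pi>) \<pi> = z
     \<and> (\<forall>\<sigma>\<in>affine_perms n. demazure n (inv \<sigma>) \<sigma> = z \<longrightarrow> len n \<pi> \<le> len n \<sigma>)}"

definition fix_on :: "nat \<Rightarrow> int \<Rightarrow> int \<Rightarrow> (int \<Rightarrow> int) \<Rightarrow> int \<Rightarrow> int" where
  "fix_on n i j y k = (if \<exists>a\<in>{i, j, y i, y j}. [k = a] (mod int n) then k else y k)"

definition tau :: "nat \<Rightarrow> int \<Rightarrow> int \<Rightarrow> (int \<Rightarrow> int) \<Rightarrow> int \<Rightarrow> int" where
  "tau n i j y =
    (if (y i < i \<and> i < j \<and> j < y j) \<or> (i < j \<and> j < y i \<and> y i < y j)
        \<or> (y i < y j \<and> y j < i \<and> i < j)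
     then refl_t n i j \<circ> y \<circ> refl_t n i j
     else if i < y j \<and> y j < y i \<and> y i < j \<and> \<not> [i = y j] (mod int n)
     then refl_t n i (y j) \<circ> y \<circ> refl_t n i (y j)
     else if i < y j \<and> y j < y i \<and> y i < j \<and> [i = y j] (mod int n)
     then refl_t n i j \<circ> fix_on n i j y
     else if (i = y i \<and> y i < j \<and> j = y j) \<or> (i = y i \<and> y i < y j \<and> y j < j)
        \<or> (i < y i \<and> y i < j \<and> j = y j) \<or> (i < y i \<and> y i < y j \<and> y j < j)
     then refl_t n i j \<circ> fix_on n i j y
     else if (i = y i \<and> y i < j \<and> j < y j) \<or> (i < y i \<and> y i < j \<and> j < y j)
     then refl_t n i (y j) \<circ> fix_on n i j y
     else if (y i < i \<and> i < j \<and> j = y j) \<or> (y i < i \<and> i < y j \<and> y j < j)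
     then refl_t n (y i) j \<circ> fix_on n i j y
     else y)"

end

(*
  Atoms admit a local description: pi is an atom of z iff for all integers p, q
    (1) p < z p           implies  pi (z p) < pi p,
    (2) p < q < z p       implies  pi q < pi (z p) or pi p < pi q,
    (3) p < q, z p < z q  implies  pi p < pi q,
    (4) p < z q, z p < q  implies  pi p < pi q.
  This is invariant under passing from (pi, z) to (pi s_k, s_k o z o s_k), with o the Demazure
  product, at a common ascent k. Since 2 len z plus the number of residues moved by z grows by exactly
  4 at each such step, the pairs reached from the identity are the involutions with their atoms.

  Let {a <= b} and {c <= d} be the cycles of y through i and j. If a < c and b < d, then exchanging
  the values of pi at i and j and rearranging the two cycles as tau prescribes preserves (1)-(4).
  In all other cases tau fixes y. Then pi t_ij is an atom of nothing: in a reduced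
  word of pi t_ij with a deletable letter that leaves pi, the conditions a < c and b < d hold right
  after that letter, and they persist along the remaining letters, because a letter s_k
  destroying them would have to exchange adjacent endpoints a, c or b, d, where tau (y) has a descent.
*)

theory Submission
  imports Defs
begin

text \<open>An element is an atom of at most one involution, namely of \<open>hecke \<pi>\<close>.
  So the theorem amounts to two implications: the inequalities a < c and b < d yield an atom of
  \<open>tau n i j y\<close>, and an atom reached by the exchange forces these inequalities. The
  obstacle in the first implication is that t_ij changes infinitely many cycles at once. This is the
  reason for conditions (1)-(4), which make sense without periodicity: the exchange at one translate
  of (i, j) is a statement about arbitrary injections and involutions of the integers, and it can be
  repeated on its own output although the intermediate pairs are not affine. Cycles of i and j that
  are translates of each other need a separate treatment, because there a second exchange may act on
  a cycle that the first one has already changed. In the second implication nothing is known about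
  z. A reduced word supplies a chain of smaller pairs of involutions, and in each of them the first
  implication identifies the larger involution as \<open>tau\<close> of the smaller.\<close>

section \<open>Exchanging two values below one involution\<close>

text \<open>
  In \<open>pair_ok x y px py a b pa pb\<close> the positions \<open>x \<le> y\<close> and \<open>a \<le> b\<close> are the two elements of two cycles
  of an involution (equal for a fixed point), and \<open>px, py, pa, pb\<close> are the values of the permutation there.
\<close>

definition cycle_ok :: "int \<Rightarrow> int \<Rightarrow> int \<Rightarrow> int \<Rightarrow> bool" where
  "cycle_ok a b pa pb \<longleftrightarrow> a \<le> b \<and> (a < b \<longrightarrow> pb < pa) \<and> (a = b \<longrightarrow> pa = pb)"

definition pair_ok :: "int \<Rightarrow> int \<Rightarrow> int \<Rightarrow> int \<Rightarrow> int \<Rightarrow> int \<Rightarrow> int \<Rightarrow> int \<Rightarrow> bool" where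
  "pair_ok x y px py a b pa pb \<longleftrightarrow>
     (x < a \<and> y < b \<longrightarrow> px < pb) \<and> (a < x \<and> b < y \<longrightarrow> pa < py)
     \<and> (x < a \<and> a < y \<longrightarrow> pa < py \<or> px < pa) \<and> (x < b \<and> b < y \<longrightarrow> pb < py \<or> px < pb)
     \<and> (a < x \<and> x < b \<longrightarrow> px < pb \<or> pa < px) \<and> (a < y \<and> y < b \<longrightarrow> py < pb \<or> pa < py)"

text \<open>\<open>x\<close> and \<open>y\<close> are the ends of a third cycle. The last two
  hypotheses are the covering condition at these ends: at a position between \<open>i\<close> and
  \<open>j\<close> no value lies between the two exchanged values. With it only comparisons of
  finitely many positions and values remain.\<close>

lemma crossing_swap_outside:
  assumes ord: "a < c" "c < b" "b < d" and "x \<notin> {a, b, c, d}" "y \<notin> {a, b, c, d}"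
    and "px \<notin> {pa, pb, pc, pd}" "py \<notin> {pa, pb, pc, pd}"
    and "cycle_ok x y px py" "cycle_ok a b pa pb" "cycle_ok c d pc pd"
    and "pair_ok a b pa pb c d pc pd"
    and "pair_ok x y px py a b pa pb" "pair_ok x y px py c d pc pd"
    and i: "i = a \<and> pi = pa \<or> i = b \<and> pi = pb" and j: "j = c \<and> pj = pc \<or> j = d \<and> pj = pd"
    and "i < j"
    and s: "sa = (if a = i then pj else pa)" "sb = (if b = i then pj else pb)"
      "sc = (if c = j then pi else pc)" "sd = (if d = j then pi else pd)"
    and c1: "i < x \<and> x < j \<longrightarrow> px < pi \<or> pj < px" and c2: "i < y \<and> y < j \<longrightarrow> py < pi \<or> pj < py"
  shows "pair_ok x y px py a d sa sd" "pair_ok x y px py c b sc sb"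
proof -
  note f = assms(1-13) \<open>i < j\<close> s c1 c2
  show "pair_ok x y px py a d sa sd"
    using i j
    apply (elim disjE)
    using f unfolding cycle_ok_def pair_ok_def
    by - (smt (verit) insert_iff)+
  show "pair_ok x y px py c b sc sb"
    using i j
    apply (elim disjE)
    using f unfolding cycle_ok_def pair_ok_def
    by - (smt (verit) insert_iff)+
qed

lemma crossing_swap_inside:
  assumes ord: "a < c" "c < b" "b < d"
    and "cycle_ok a b pa pb" "cycle_ok c d pc pd"
    and "pair_ok a b pa pb c d pc pd"
    and i: "i = a \<and> pi = pa \<or> i = b \<and> pi = pb" and j: "j = c \<and> pj = pc \<or> j = d \<and> pj = pd"
    and "i < j"
    and s: "sa = (if a = i then pj else pa)" "sb = (if b = i then pj else pb)"
      "sc = (if c = j then pi else pc)" "sd = (if d = j then pi else pd)"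
  shows "cycle_ok a d sa sd" "cycle_ok c b sc sb" "pair_ok a d sa sd c b sc sb"
proof -
  note f = ord assms(4-6) \<open>i < j\<close> s
  show "cycle_ok a d sa sd"
    using i j
    apply (elim disjE)
    using f unfolding cycle_ok_def pair_ok_def
    by - (smt (verit))+
  show "cycle_ok c b sc sb"
    using i j
    apply (elim disjE)
    using f unfolding cycle_ok_def pair_ok_def
    by - (smt (verit))+
  show "pair_ok a d sa sd c b sc sb"
    using i j
    apply (elim disjE)
    using f unfolding cycle_ok_def pair_ok_def
    by - (smt (verit))+
qed

text \<open>The exchange at the inner ends \<open>b\<close> and \<open>c\<close> keeps the values of
  each cycle together: \<open>pa\<close>, \<open>pb\<close> now sit at \<open>a\<close>,
  \<open>c\<close>, and \<open>pc\<close>, \<open>pd\<close> at \<open>b\<close>, \<open>d\<close>.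
  In effect only the positions of the inner ends are traded.\<close>

lemma inner_ends_swap_outside:
  assumes ord: "a < b" "b < c" "c < d" and "x \<notin> {a, b, c, d}" "y \<notin> {a, b, c, d}"
    and "px \<notin> {pa, pb, pc, pd}" "py \<notin> {pa, pb, pc, pd}"
    and "cycle_ok x y px py" "cycle_ok a b pa pb" "cycle_ok c d pc pd"
    and "pair_ok a b pa pb c d pc pd"
    and "pair_ok x y px py a b pa pb" "pair_ok x y px py c d pc pd"
    and c1: "b < x \<and> x < c \<longrightarrow> px < pb \<or> pc < px" and c2: "b < y \<and> y < c \<longrightarrow> py < pb \<or> pc < py"
  shows "pair_ok x y px py a c pa pb" "pair_ok x y px py b d pc pd"
proof -
  show "pair_ok x y px py a c pa pb" "pair_ok x y px py b d pc pd"
    using assms(1-13) c1 c2 unfolding cycle_ok_def pair_ok_def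
    apply -
    apply (smt (verit) insert_iff)+
    done
qed

lemma inner_ends_swap_inside:
  assumes ord: "a < b" "b < c" "c < d"
    and "cycle_ok a b pa pb" "cycle_ok c d pc pd"
    and "pair_ok a b pa pb c d pc pd"
  shows "cycle_ok a c pa pb" "cycle_ok b d pc pd" "pair_ok a c pa pb b d pc pd"
  using ord assms(4-6) unfolding cycle_ok_def pair_ok_def
  apply -
  apply (smt (verit))+
  done

text \<open>Exchanging the inner ends of two proper 2-cycles would leave \<open>pa\<close> at
  \<open>a\<close> and \<open>pd\<close> at \<open>d\<close>. As \<open>pa < pd\<close>, the points
  \<open>a\<close> and \<open>d\<close> could not form a cycle; \<open>i = a \<or> j = d\<close>
  excludes this.\<close>

lemma disjoint_swap_outside:
  assumes ord: "a \<le> b" "b < c" "c \<le> d" and "x \<notin> {a, b, c, d}" "y \<notin> {a, b, c, d}"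
    and "px \<notin> {pa, pb, pc, pd}" "py \<notin> {pa, pb, pc, pd}"
    and "cycle_ok x y px py" "cycle_ok a b pa pb" "cycle_ok c d pc pd"
    and "pair_ok a b pa pb c d pc pd"
    and "pair_ok x y px py a b pa pb" "pair_ok x y px py c d pc pd"
    and i: "i = a \<and> pi = pa \<or> i = b \<and> pi = pb" and j: "j = c \<and> pj = pc \<or> j = d \<and> pj = pd"
    and ij: "i = a \<or> j = d"
    and s: "sa = (if a = i then pj else pa)" "sb = (if b = i then pj else pb)"
      "sc = (if c = j then pi else pc)" "sd = (if d = j then pi else pd)"
    and c1: "i < x \<and> x < j \<longrightarrow> px < pi \<or> pj < px" and c2: "i < y \<and> y < j \<longrightarrow> py < pi \<or> pj < py"
  shows "pair_ok x y px py a d sa sd" "a < b \<Longrightarrow> pair_ok x y px py b b sb sb"  "c < d \<Longrightarrow> pair_ok x y px py c c sc sc"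
proof -
  note f = assms(1-13) ij s c1 c2
  show "pair_ok x y px py a d sa sd"
    using i j
    apply (elim disjE)
    using f unfolding cycle_ok_def pair_ok_def
    by - (smt (verit) insert_iff)+
  show "a < b \<Longrightarrow> pair_ok x y px py b b sb sb"
    using i j
    apply (elim disjE)
    using f unfolding cycle_ok_def pair_ok_def
    by - (smt (verit) insert_iff)+
  show "c < d \<Longrightarrow> pair_ok x y px py c c sc sc"
    using i j
    apply (elim disjE)
    using f unfolding cycle_ok_def pair_ok_def
    by - (smt (verit) insert_iff)+
qed

lemma disjoint_swap_inside:
  assumes ord: "a \<le> b" "b < c" "c \<le> d"
    and "cycle_ok a b pa pb" "cycle_ok c d pc pd"
    and "pair_ok a b pa pb c d pc pd"
    and i: "i = a \<and> pi = pa \<or> i = b \<and> pi = pb" and j: "j = c \<and> pj = pc \<or> j = d \<and> pj = pd"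
    and ij: "i = a \<or> j = d"
    and s: "sa = (if a = i then pj else pa)" "sb = (if b = i then pj else pb)"
      "sc = (if c = j then pi else pc)" "sd = (if d = j then pi else pd)"
  shows "cycle_ok a d sa sd" "a < b \<Longrightarrow> pair_ok a d sa sd b b sb sb" "c < d \<Longrightarrow> pair_ok a d sa sd c c sc sc"
    "a < b \<Longrightarrow> c < d \<Longrightarrow> pair_ok b b sb sb c c sc sc"
proof -
  note f = ord assms(4-6) ij s
  show "cycle_ok a d sa sd"
    using i j
    apply (elim disjE)
    using f unfolding cycle_ok_def pair_ok_def
    by - (smt (verit))+
  show "a < b \<Longrightarrow> pair_ok a d sa sd b b sb sb"
    using i j
    apply (elim disjE)
    using f unfolding cycle_ok_def pair_ok_def
    by - (smt (verit))+
  show "c < d \<Longrightarrow> pair_ok a d sa sd c c sc sc"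
    using i j
    apply (elim disjE)
    using f unfolding cycle_ok_def pair_ok_def
    by - (smt (verit))+
  show "a < b \<Longrightarrow> c < d \<Longrightarrow> pair_ok b b sb sb c c sc sc"
    using i j
    apply (elim disjE)
    using f unfolding cycle_ok_def pair_ok_def
    by - (smt (verit))+
qed

section \<open>Local conditions (1)-(4) and a single exchange of values\<close>

definition shape_at :: "(int \<Rightarrow> int) \<Rightarrow> (int \<Rightarrow> int) \<Rightarrow> int \<Rightarrow> int \<Rightarrow> bool" where
  "shape_at \<pi> z p q \<longleftrightarrow>
     (p < z p \<longrightarrow> \<pi> (z p) < \<pi> p)
     \<and> (p < q \<and> q < z p \<longrightarrow> \<pi> q < \<pi> (z p) \<or> \<pi> p < \<pi> q)
     \<and> (p < q \<and> z p < z q \<longrightarrow> \<pi> p < \<pi> q)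
     \<and> (p < z q \<and> z p < q \<longrightarrow> \<pi> p < \<pi> q)"

definition shape :: "(int \<Rightarrow> int) \<Rightarrow> (int \<Rightarrow> int) \<Rightarrow> bool" where
  "shape \<pi> z \<longleftrightarrow> (\<forall>p q. shape_at \<pi> z p q)"

lemma shape_cycle_ok:
  assumes "shape \<pi> z" "x \<le> z x"
  shows "cycle_ok x (z x) (\<pi> x) (\<pi> (z x))"
  using assms unfolding shape_def shape_at_def cycle_ok_def by auto

lemma shape_pair_ok:
  assumes "shape \<pi> z" and zz: "\<And>v. z (z v) = v" and "x \<le> z x" "p \<le> z p"
  shows "pair_ok x (z x) (\<pi> x) (\<pi> (z x)) p (z p) (\<pi> p) (\<pi> (z p))"
proof -
  have A: "u < v \<Longrightarrow> z u < z v \<Longrightarrow> \<pi> u < \<pi> v" and B: "u < v \<Longrightarrow> v < z u \<Longrightarrow> \<pi> v < \<pi> (z u) \<or> \<pi> u < \<pi> v"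
    and C: "u < z v \<Longrightarrow> z u < v \<Longrightarrow> \<pi> u < \<pi> v" for u v
    using assms(1) unfolding shape_def shape_at_def by blast+
  show ?thesis unfolding pair_ok_def
    using A B C[of x "z p"] C[of p "z x"] zz by auto
qed

text \<open>Each cycle is represented by its lower end \<open>min p (z p)\<close>. This turns the
  check of all points \<open>p\<close>, \<open>q\<close> into a check of cycles with distinct lower
  ends.\<close>

lemma shape_atI:
  assumes zz: "\<And>v. z (z v) = v"
    and P: "\<And>x. x \<le> z x \<Longrightarrow> cycle_ok x (z x) (\<pi> x) (\<pi> (z x))"
    and Q: "\<And>x p. x \<le> z x \<Longrightarrow> p \<le> z p \<Longrightarrow> x \<noteq> p \<Longrightarrow>
        pair_ok x (z x) (\<pi> x) (\<pi> (z x)) p (z p) (\<pi> p) (\<pi> (z p))"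
  shows "shape \<pi> z"
  unfolding shape_def
proof (intro allI)
  fix p q
  have cyc: "min u (z u) \<le> z (min u (z u))" for u
    using zz[of u] by (auto simp: min_def)
  have mx: "z (min u (z u)) = max u (z u)" for u
    using zz[of u] by (auto simp: min_def max_def)
  have cp: "cycle_ok (min u (z u)) (max u (z u)) (\<pi> (min u (z u))) (\<pi> (max u (z u)))" for u
    using P[OF cyc[of u]] mx by metis
  have eqc: "p = q \<or> p = z q" if "min p (z p) = min q (z q)"
    using that zz by (metis min_def)
  have pr: "pair_ok (min p (z p)) (max p (z p)) (\<pi> (min p (z p))) (\<pi> (max p (z p)))
       (min q (z q)) (max q (z q)) (\<pi> (min q (z q))) (\<pi> (max q (z q)))" if "p \<noteq> q" "p \<noteq> z q"
    using Q[OF cyc[of p] cyc[of q]] mx eqc that by metis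
  have C1: "p < z p \<longrightarrow> \<pi> (z p) < \<pi> p" using cp[of p] unfolding cycle_ok_def by auto
  show "shape_at \<pi> z p q"
  proof (cases "p = q \<or> p = z q")
    case True
    \<comment> \<open>Within one cycle the hypotheses of each of the conditions (2)-(4) contradict
      each other.\<close>
    then show ?thesis using C1 zz[of q] unfolding shape_at_def by auto
  next
    case False
    then have p: "p \<noteq> q" "p \<noteq> z q" by auto
    then have "z p \<noteq> q" using zz by auto
    show ?thesis unfolding shape_at_def
      using C1 pr[OF p] cp[of p] cp[of q] p \<open>z p \<noteq> q\<close> unfolding cycle_ok_def pair_ok_def min_def max_def
      apply (intro conjI impI)
      by (smt (verit))+
  qed
qed

text \<open>An instance of the conditions sees only \<open>p\<close>, \<open>q\<close> and their
  images. It can therefore be taken over from any other pair that agrees there, in particular from a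
  non-periodic pair obtained by finitely many exchanges.\<close>

lemma shape_local:
  assumes "shape \<pi>' z'" "\<And>v. v \<in> {p, z p, q, z q} \<Longrightarrow> \<pi>' v = \<pi> v"
    "z' p = z p" "z' q = z q"
  shows "shape_at \<pi> z p q"
proof -
  have "shape_at \<pi>' z' p q" using assms(1) unfolding shape_def by blast
  then show ?thesis using assms(2-4) unfolding shape_at_def by auto
qed

text \<open>The order criterion for a Bruhat cover by the reflection at \<open>i\<close> and
  \<open>j\<close>, in a form that also makes sense for maps that are not periodic.\<close>

definition cover_at :: "(int \<Rightarrow> int) \<Rightarrow> int \<Rightarrow> int \<Rightarrow> bool" where
  "cover_at \<pi> i j \<longleftrightarrow> i < j \<and> \<pi> i < \<pi> j \<and> (\<forall>e. i < e \<and> e < j \<longrightarrow> \<pi> e < \<pi> i \<or> \<pi> j < \<pi> e)"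

definition cycle_less :: "(int \<Rightarrow> int) \<Rightarrow> int \<Rightarrow> int \<Rightarrow> bool" where
  "cycle_less y i j \<longleftrightarrow> min i (y i) < min j (y j) \<and> max i (y i) < max j (y j)"

text \<open>
  The three branches of \<open>swap_inv\<close> are: crossing cycles become nested; disjoint cycles whose inner ends
  are exchanged become crossing; other disjoint cycles leave one cycle joining the outer ends and
  two fixed points. The order of the updates takes care of fixed points \<open>a = b\<close> and \<open>c = d\<close>.
\<close>

definition swap_inv :: "int \<Rightarrow> int \<Rightarrow> int \<Rightarrow> int \<Rightarrow> int \<Rightarrow> int \<Rightarrow> (int \<Rightarrow> int) \<Rightarrow> int \<Rightarrow> int" where
  "swap_inv a b c d i j y =
    (if c < b then y(a := d, d := a, b := c, c := b)
     else if i = b \<and> a < b \<and> j = c \<and> c < d then y(a := c, c := a, b := d, d := b)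
     else y(b := b, c := c, a := d, d := a))"

text \<open>The involution property and injectivity of the new pair are recorded so that the lemma
  can be applied a second time to its own result.\<close>

lemma shape_swap:
  assumes sh: "shape \<pi> y" and yy: "\<And>v. y (y v) = v" and inj: "inj \<pi>" and cov: "cover_at \<pi> i j"
    and abcd: "a = min i (y i)" "b = max i (y i)" "c = min j (y j)" "d = max j (y j)"
    and lt: "a < c" "b < d"
  defines "z \<equiv> swap_inv a b c d i j y" and "\<sigma> \<equiv> \<pi>(i := \<pi> j, j := \<pi> i)"
  shows "shape \<sigma> z" "\<And>v. z (z v) = v" "inj \<sigma>"
proof -
  have ij: "i < j" and pij: "\<pi> i < \<pi> j" and cv: "\<And>e. i < e \<and> e < j \<Longrightarrow> \<pi> e < \<pi> i \<or> \<pi> j < \<pi> e"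
    using cov unfolding cover_at_def by auto
  show "inj \<sigma>" using inj unfolding \<sigma>_def inj_def by (smt (verit) fun_upd_apply)
  have y: "y a = b" "y b = a" "y c = d" "y d = c" using yy abcd by (auto simp: min_def max_def)
  have ab: "a \<le> b" and cd: "c \<le> d" using abcd by auto
  have ac: "a \<noteq> c" "b \<noteq> d" "a \<noteq> d" using lt ab cd by auto
  have bc: "b \<noteq> c" using ac y by metis
  have ia: "i = a \<and> \<pi> i = \<pi> a \<or> i = b \<and> \<pi> i = \<pi> b" and ja: "j = c \<and> \<pi> j = \<pi> c \<or> j = d \<and> \<pi> j = \<pi> d"
    using abcd by (auto simp: min_def max_def)
  let ?E = "{a,b,c,d}"
  have yE: "y x \<notin> ?E" if "x \<notin> ?E" for x using that y yy by (metis insert_iff empty_iff)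
  have zout: "z x = y x" if "x \<notin> ?E" for x using that unfolding z_def swap_inv_def by auto
  show zz: "z (z v) = v" for v
  proof (cases "v \<in> ?E")
    case True
    then show ?thesis using ac bc ab cd lt unfolding z_def swap_inv_def by (auto split: if_splits)
  next
    case False
    then show ?thesis using zout yE yy by auto
  qed
  have sE: "\<sigma> a = (if a = i then \<pi> j else \<pi> a)" "\<sigma> b = (if b = i then \<pi> j else \<pi> b)"
      "\<sigma> c = (if c = j then \<pi> i else \<pi> c)" "\<sigma> d = (if d = j then \<pi> i else \<pi> d)"
    using ia ja ac bc unfolding \<sigma>_def by auto
  have sout: "\<sigma> x = \<pi> x" if "x \<notin> ?E" for x using that ia ja unfolding \<sigma>_def by auto
  have pout: "\<pi> x \<notin> {\<pi> a, \<pi> b, \<pi> c, \<pi> d}" if "x \<notin> ?E" for x using that inj unfolding inj_def by blast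
  have cab: "cycle_ok a b (\<pi> a) (\<pi> b)" and ccd: "cycle_ok c d (\<pi> c) (\<pi> d)"
    using shape_cycle_ok[OF sh] y ab cd by metis+
  have pin: "pair_ok a b (\<pi> a) (\<pi> b) c d (\<pi> c) (\<pi> d)"
    using shape_pair_ok[OF sh yy] y ab cd by metis
  have pab: "pair_ok x (y x) (\<pi> x) (\<pi> (y x)) a b (\<pi> a) (\<pi> b)"
   and pcd: "pair_ok x (y x) (\<pi> x) (\<pi> (y x)) c d (\<pi> c) (\<pi> d)" if "x \<le> y x" for x
    using shape_pair_ok[OF sh yy] y ab cd that by metis+
  have sym: "pair_ok x1 x2 x3 x4 x5 x6 x7 x8 \<Longrightarrow> pair_ok x5 x6 x7 x8 x1 x2 x3 x4" for x1 x2 x3 x4 x5 x6 x7 x8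
    unfolding pair_ok_def by blast
  have cvx: "i < x \<and> x < j \<longrightarrow> \<pi> x < \<pi> i \<or> \<pi> j < \<pi> x" for x
    using cv by auto
  \<comment> \<open>Only conditions that involve a new cycle need work: cycles outside
    \<open>?E\<close> keep their positions and values.\<close>
  have key: "(\<forall>x \<in> ?E. x \<le> z x \<longrightarrow> cycle_ok x (z x) (\<sigma> x) (\<sigma> (z x)))
    \<and> (\<forall>x \<in> ?E. \<forall>p \<in> ?E. x \<le> z x \<and> p \<le> z p \<and> x \<noteq> p \<longrightarrow> pair_ok x (z x) (\<sigma> x) (\<sigma> (z x)) p (z p) (\<sigma> p) (\<sigma> (z p)))
    \<and> (\<forall>p \<in> ?E. \<forall>x. x \<notin> ?E \<and> x \<le> y x \<and> p \<le> z p \<longrightarrow> pair_ok x (y x) (\<pi> x) (\<pi> (y x)) p (z p) (\<sigma> p) (\<sigma> (z p)))"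
  proof -
    consider (cr) "c < b" | (dd) "\<not> c < b" "i = b \<and> a < b \<and> j = c \<and> c < d" | (d1) "\<not> c < b" "\<not> (i = b \<and> a < b \<and> j = c \<and> c < d)"
      by blast
    then show ?thesis
    proof cases
      case cr
      have z: "z a = d" "z d = a" "z b = c" "z c = b" using cr ac bc lt unfolding z_def swap_inv_def by auto
      note I = crossing_swap_inside[OF lt(1) cr lt(2) cab ccd pin ia ja ij sE]
      have O: "pair_ok x (y x) (\<pi> x) (\<pi> (y x)) a d (\<sigma> a) (\<sigma> d)" "pair_ok x (y x) (\<pi> x) (\<pi> (y x)) c b (\<sigma> c) (\<sigma> b)"
         if "x \<notin> ?E" "x \<le> y x" for x
        using crossing_swap_outside[OF lt(1) cr lt(2) that(1) yE[OF that(1)] pout[OF that(1)] pout[OF yE[OF that(1)]] shape_cycle_ok[OF sh that(2)]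
           cab ccd pin pab[OF that(2)] pcd[OF that(2)] ia ja ij sE cvx cvx] by blast+
      show ?thesis using I O z lt cr ab cd sym[OF I(3)] by auto
    next
      case dd
      have le: "b < c" using dd bc by auto
      have z: "z a = c" "z c = a" "z b = d" "z d = b" using dd ac bc lt unfolding z_def swap_inv_def by auto
      have s: "\<sigma> a = \<pi> a" "\<sigma> b = \<pi> c" "\<sigma> c = \<pi> b" "\<sigma> d = \<pi> d" using dd sE by auto
      have ab': "a < b" "c < d" using dd by auto
      note I = inner_ends_swap_inside[OF ab'(1) le ab'(2) cab ccd pin]
      have cvx': "b < x \<and> x < c \<longrightarrow> \<pi> x < \<pi> b \<or> \<pi> c < \<pi> x" for x
        using cvx dd by auto
      have O: "pair_ok x (y x) (\<pi> x) (\<pi> (y x)) a c (\<pi> a) (\<pi> b)" "pair_ok x (y x) (\<pi> x) (\<pi> (y x)) b d (\<pi> c) (\<pi> d)"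
         if "x \<notin> ?E" "x \<le> y x" for x
        using inner_ends_swap_outside[OF ab'(1) le ab'(2) that(1) yE[OF that(1)] pout[OF that(1)] pout[OF yE[OF that(1)]] shape_cycle_ok[OF sh that(2)]
           cab ccd pin pab[OF that(2)] pcd[OF that(2)] cvx' cvx'] by blast+
      show ?thesis using I O z s lt le ab' sym[OF I(3)] by auto
    next
      case d1
      have le: "b < c" using d1 bc by auto
      have z: "z a = d" "z d = a" "a < b \<Longrightarrow> z b = b" "c < d \<Longrightarrow> z c = c" using d1 ac bc lt unfolding z_def swap_inv_def by auto
      have c: "i = a \<or> j = d" using d1 ia ja ab cd by auto
      note I = disjoint_swap_inside[OF ab le cd cab ccd pin ia ja c sE]
      have O: "pair_ok x (y x) (\<pi> x) (\<pi> (y x)) a d (\<sigma> a) (\<sigma> d)"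
          "a < b \<Longrightarrow> pair_ok x (y x) (\<pi> x) (\<pi> (y x)) b b (\<sigma> b) (\<sigma> b)"
          "c < d \<Longrightarrow> pair_ok x (y x) (\<pi> x) (\<pi> (y x)) c c (\<sigma> c) (\<sigma> c)"
         if "x \<notin> ?E" "x \<le> y x" for x
        using disjoint_swap_outside[OF ab le cd that(1) yE[OF that(1)] pout[OF that(1)] pout[OF yE[OF that(1)]] shape_cycle_ok[OF sh that(2)]
           cab ccd pin pab[OF that(2)] pcd[OF that(2)] ia ja c sE cvx cvx] by blast+
      have f: "cycle_ok x x v v" for x v unfolding cycle_ok_def by auto
      show ?thesis
        apply (cases "a < b"; cases "c < d")
        using I O z lt le ab cd f
          sym[OF I(2)] sym[OF I(3)] sym[OF I(4)] by auto
    qed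
  qed
  note kA = key[THEN conjunct1, rule_format] and kB = key[THEN conjunct2, THEN conjunct1, rule_format]
    and kC = key[THEN conjunct2, THEN conjunct2, rule_format]
  show "shape \<sigma> z"
  proof (rule shape_atI[OF zz])
    fix x assume x: "x \<le> z x"
    show "cycle_ok x (z x) (\<sigma> x) (\<sigma> (z x))"
    proof (cases "x \<in> ?E")
      case True then show ?thesis using x by (rule kA)
    next
      case False
      then show ?thesis using shape_cycle_ok[OF sh, of x] x zout[OF False] sout[OF False] sout[OF yE[OF False]] by simp
    qed
  next
    fix x p assume x: "x \<le> z x" and p: "p \<le> z p" and xp: "x \<noteq> p"
    show "pair_ok x (z x) (\<sigma> x) (\<sigma> (z x)) p (z p) (\<sigma> p) (\<sigma> (z p))"
    proof (cases "x \<in> ?E")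
      case xE: True
      show ?thesis
      proof (cases "p \<in> ?E")
        case True show ?thesis using x p xp by (intro kB[OF xE True] conjI)
      next
        case False
        then have "pair_ok p (y p) (\<pi> p) (\<pi> (y p)) x (z x) (\<sigma> x) (\<sigma> (z x))" using kC[OF xE, of p] False x p zout[OF False] by simp
        then show ?thesis
          using sym[of p "y p" "\<pi> p" "\<pi> (y p)" x "z x" "\<sigma> x" "\<sigma> (z x)"]
            zout[OF False] sout[OF False] sout[OF yE[OF False]] by simp
      qed
    next
      case F: False
      show ?thesis
      proof (cases "p \<in> ?E")
        case True
        then have "pair_ok x (y x) (\<pi> x) (\<pi> (y x)) p (z p) (\<sigma> p) (\<sigma> (z p))" using kC[OF True, of x] F x p zout[OF F] by simp
        then show ?thesis using zout[OF F] sout[OF F] sout[OF yE[OF F]] by simp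
      next
        case False
        then show ?thesis using shape_pair_ok[OF sh yy, of x p] x p zout[OF False] sout[OF False] sout[OF yE[OF False]]
          zout[OF F] sout[OF F] sout[OF yE[OF F]] by simp
      qed
    qed
  qed
qed

section \<open>The affine symmetric group and its length function\<close>

lemma refl_t_nocong: "[i = j] (mod int n) \<Longrightarrow> refl_t n i j = id"
  unfolding refl_t_def by auto

lemma refl_t_left:
  assumes "\<not> [i = j] (mod int n)" "int n dvd m"
  shows "refl_t n i j (i + m) = j + m"
  using assms unfolding refl_t_def by (auto simp: cong_iff_dvd_diff)

lemma refl_t_right:
  assumes "\<not> [i = j] (mod int n)" "int n dvd m"
  shows "refl_t n i j (j + m) = i + m"
proof -
  have "\<not> int n dvd (j + m - i)" using assms
    by (metis (no_types, lifting) add_diff_eq cong_iff_dvd_diff cong_sym diff_add_eq dvd_add_left_iff)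
  then show ?thesis using assms unfolding refl_t_def by (auto simp: cong_iff_dvd_diff)
qed

lemma refl_t_other:
  assumes "\<not> int n dvd x - i" "\<not> int n dvd x - j"
  shows "refl_t n i j x = x"
  using assms unfolding refl_t_def by (auto simp: cong_iff_dvd_diff)

lemma refl_t_cases:
  assumes "\<not> [i = j] (mod int n)"
  obtains (left) m where "int n dvd m" "x = i + m" "refl_t n i j x = j + m"
  | (right) m where "int n dvd m" "x = j + m" "refl_t n i j x = i + m"
  | (other) "\<not> int n dvd x - i" "\<not> int n dvd x - j" "refl_t n i j x = x"
proof -
  consider "int n dvd x - i" | "int n dvd x - j" | "\<not> int n dvd x - i" "\<not> int n dvd x - j" by blast
  then show ?thesis
  proof cases
    case 1 then show ?thesis using left[of "x - i"] refl_t_left[OF assms 1] by simp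
  next
    case 2 then show ?thesis using right[of "x - j"] refl_t_right[OF assms 2] by simp
  next
    case 3 then show ?thesis using other refl_t_other[OF 3] by simp
  qed
qed

lemma refl_t_invol [simp]: "refl_t n i j (refl_t n i j x) = x"
proof (cases "[i = j] (mod int n)")
  case False
  show ?thesis
    by (cases x rule: refl_t_cases[OF False]) (use refl_t_left[OF False] refl_t_right[OF False] in auto)
qed (simp add: refl_t_nocong)

lemma refl_t_comp_invol [simp]: "refl_t n i j \<circ> refl_t n i j = id"
  by auto

lemma comp_refl_t_comp_refl_t [simp]: "f \<circ> refl_t n i j \<circ> refl_t n i j = f"
  by (simp add: comp_assoc)

lemma bij_refl_t [simp]: "bij (refl_t n i j)"
  by (rule o_bij[of "refl_t n i j"]) auto

lemma inv_refl_t [simp]: "inv (refl_t n i j) = refl_t n i j"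
  by (rule inv_equality) auto

lemma refl_t_periodic:
  assumes "int n dvd m" shows "refl_t n i j (x + m) = refl_t n i j x + m"
proof -
  have "int n dvd x + m - a \<longleftrightarrow> int n dvd x - a" for a
    using dvd_add_left_iff[OF assms, of "x - a"] by (simp add: algebra_simps)
  then show ?thesis unfolding refl_t_def cong_iff_dvd_diff by simp
qed

lemma refl_t_shift:
  assumes "int n dvd m" shows "refl_t n (i + m) (j + m) = refl_t n i j"
proof -
  have 1: "[x = y + m] (mod int n) \<longleftrightarrow> [x = y] (mod int n)" for x y
    using assms by (simp add: cong_iff_dvd_diff diff_diff_eq[symmetric] dvd_diff_left_iff)
  have 2: "[i + m = j + m] (mod int n) \<longleftrightarrow> [i = j] (mod int n)"
    by (simp add: cong_iff_dvd_diff)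
  show ?thesis unfolding refl_t_def fun_eq_iff using 1 2 by simp
qed

lemma affine_bij: "w \<in> affine_perms n \<Longrightarrow> bij w"
  and affine_inj: "w \<in> affine_perms n \<Longrightarrow> inj w"
  unfolding affine_perms_def by (auto simp: bij_def)

lemma periodic_dvd:
  fixes w :: "int \<Rightarrow> int"
  assumes "\<And>i. w (i + int n) = w i + int n" "int n dvd m"
  shows "w (x + m) = w x + m"
proof -
  obtain k where k: "m = int n * k" using assms(2) by blast
  have P: "w (x + int n * int q) = w x + int n * int q" for q x
  proof (induction q)
    case (Suc q)
    have "w (x + int n * int (Suc q)) = w (x + int n * int q + int n)" by (simp add: algebra_simps)
    also have "\<dots> = w (x + int n * int q) + int n" by (rule assms(1))
    also have "\<dots> = w x + int n * int (Suc q)" unfolding Suc by (simp add: algebra_simps)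
    finally show ?case .
  qed simp
  show ?thesis
  proof (cases "k \<ge> 0")
    case True
    then show ?thesis using P[of x "nat k"] k by simp
  next
    case False
    then have "w (x + m + int n * int (nat (- k))) = w (x + m) + int n * int (nat (- k))"
      using P by blast
    then show ?thesis using False k by (simp add: algebra_simps)
  qed
qed

lemma affine_periodic:
  assumes "w \<in> affine_perms n" "int n dvd m"
  shows "w (x + m) = w x + m"
  using assms periodic_dvd[of w n m x] unfolding affine_perms_def by auto

lemma affine_diff_dvd:
  assumes w: "w \<in> affine_perms n" and d: "int n dvd x - y"
  shows "w x - w y = x - y"
  using affine_periodic[OF w d, of y] by simp

text \<open>For \<open>n = 1\<close> every simple reflection is the identity and the comparison of
  lengths with ascents breaks down. Among positive \<open>n\<close>, incongruent \<open>i\<close>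
  and \<open>j\<close> exist only for \<open>n > 1\<close>.\<close>

locale affine =
  fixes n :: nat
  assumes n_gt: "1 < n"
begin

abbreviation s :: "int \<Rightarrow> int \<Rightarrow> int" where "s \<equiv> simple_s n"
abbreviation G :: "(int \<Rightarrow> int) set" where "G \<equiv> affine_perms n"

lemma not_cong_Suc: "\<not> [k = k + 1] (mod int n)"
  using n_gt by (auto simp: cong_iff_dvd_diff zdvd1_eq)

lemma not_dvd_one: "\<not> int n dvd 1" "\<not> int n dvd - 1"
  using n_gt by auto

definition red :: "int \<Rightarrow> int" where "red x = (x - 1) mod int n + 1"

lemma red_in: "red x \<in> {1..int n}"
  using n_gt unfolding red_def by (auto simp: add_pos_nonneg zless_imp_add1_zle)

lemma red_dvd: "int n dvd x - red x"
proof -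
  have "x - red x = (x - 1) - (x - 1) mod int n" unfolding red_def by simp
  then show ?thesis by (metis dvd_minus_mod)
qed

lemma dvd_small:
  assumes "x \<in> {1..int n}" "y \<in> {1..int n}" "int n dvd x - y"
  shows "x = y"
proof (rule ccontr)
  assume "x \<noteq> y"
  then have "x - y \<noteq> 0" by simp
  then have "int n \<le> \<bar>x - y\<bar>" using assms(3) dvd_imp_le_int[of "x - y" "int n"] by simp
  then show False using assms(1,2) by auto
qed

text \<open>A periodic injection permutes the residue classes, so \<open>red \<circ> w\<close>
  permutes the window 1..n, and a function that is constant on classes may be summed in the new
  order.\<close>

lemma periodic_sum:
  fixes f :: "int \<Rightarrow> 'a :: comm_monoid_add"
  assumes f: "\<And>x m. int n dvd m \<Longrightarrow> f (x + m) = f x"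
    and w: "inj w" "\<And>x m. int n dvd m \<Longrightarrow> w (x + m) = w x + m"
  shows "(\<Sum>x = 1..int n. f (w x)) = (\<Sum>x = 1..int n. f x)"
proof -
  have fr: "f (red x) = f x" for x using f[OF red_dvd[of x], of "red x"] by simp
  have inj: "inj_on (red \<circ> w) {1..int n}"
  proof (rule inj_onI)
    fix x y assume xy: "x \<in> {1..int n}" "y \<in> {1..int n}" and e: "(red \<circ> w) x = (red \<circ> w) y"
    have "int n dvd w x - w y" using dvd_diff[OF red_dvd[of "w x"] red_dvd[of "w y"]] e by simp
    then have "w (y + (w x - w y)) = w x" using w(2) by simp
    then have "y + (w x - w y) = x" using w(1) by (simp add: inj_eq)
    then have "int n dvd x - y" using \<open>int n dvd w x - w y\<close> by (metis add_diff_cancel_left')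
    then show "x = y" using dvd_small xy by blast
  qed
  have "(red \<circ> w) ` {1..int n} \<subseteq> {1..int n}" using red_in by auto
  then have "bij_betw (red \<circ> w) {1..int n} {1..int n}"
    using inj endo_inj_surj[of "{1..int n}" "red \<circ> w"] unfolding bij_betw_def by simp
  then have "(\<Sum>x = 1..int n. f ((red \<circ> w) x)) = (\<Sum>x = 1..int n. f x)"
    by (rule sum.reindex_bij_betw)
  then show ?thesis using fr by simp
qed

lemma sum_single_class: "(\<Sum>x = 1..int n. if int n dvd x - k then 1 else 0 :: nat) = 1"
proof -
  have "(\<Sum>x = 1..int n. if int n dvd x - k then 1 else 0 :: nat) = (\<Sum>x \<in> {1..int n}. if x = red k then 1 else 0)"
  proof (rule sum.cong)
    fix x assume x: "x \<in> {1..int n}"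
    have "int n dvd x - k \<longleftrightarrow> x = red k"
    proof
      assume "int n dvd x - k"
      then have "int n dvd x - red k" using dvd_add[OF _ red_dvd[of k]] by (metis diff_add_cancel add_diff_eq)
      then show "x = red k" using dvd_small red_in x by blast
    next
      assume "x = red k" then show "int n dvd x - k" using red_dvd[of k] by (simp add: dvd_diff_commute)
    qed
    then show "(if int n dvd x - k then 1 else 0 :: nat) = (if x = red k then 1 else 0)" by simp
  qed simp
  also have "\<dots> = 1" using red_in[of k] by (subst sum.delta) auto
  finally show ?thesis .
qed

text \<open>The displacement \<open>w x - x\<close> is constant on residue classes, while
  \<open>w x\<close> is not. Stated through displacements, the normalization of the sum becomes
  accessible to \<open>periodic_sum\<close>.\<close>

lemma affine_iff:
  "w \<in> G \<longleftrightarrow> bij w \<and> (\<forall>x m. int n dvd m \<longrightarrow> w (x + m) = w x + m) \<and> (\<Sum>x = 1..int n. w x - x) = 0"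
  unfolding affine_perms_def using periodic_dvd[of w n] by (auto simp: sum_subtractf)

lemma affine_id [simp]: "id \<in> G"
  unfolding affine_iff by auto

lemma affine_comp:
  assumes "u \<in> G" "v \<in> G" shows "u \<circ> v \<in> G"
proof -
  have u: "bij u" "\<And>x m. int n dvd m \<Longrightarrow> u (x + m) = u x + m" "(\<Sum>x = 1..int n. u x - x) = 0"
    and v: "bij v" "\<And>x m. int n dvd m \<Longrightarrow> v (x + m) = v x + m" "(\<Sum>x = 1..int n. v x - x) = 0"
    using assms unfolding affine_iff by auto
  have "(\<Sum>x = 1..int n. (u \<circ> v) x - x) = (\<Sum>x = 1..int n. (u (v x) - v x) + (v x - x))" by simp
  also have "\<dots> = (\<Sum>x = 1..int n. u (v x) - v x) + (\<Sum>x = 1..int n. v x - x)" by (rule sum.distrib)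
  also have "(\<Sum>x = 1..int n. u (v x) - v x) = (\<Sum>x = 1..int n. u x - x)"
    by (rule periodic_sum[where f = "\<lambda>x. u x - x"]) (use u v in \<open>auto simp: bij_def\<close>)
  finally have "(\<Sum>x = 1..int n. (u \<circ> v) x - x) = 0" using u v by simp
  then show ?thesis unfolding affine_iff using u v by (auto simp: bij_comp)
qed

lemma affine_inv:
  assumes "u \<in> G" shows "inv u \<in> G"
proof -
  have u: "bij u" "\<And>x m. int n dvd m \<Longrightarrow> u (x + m) = u x + m" "(\<Sum>x = 1..int n. u x - x) = 0"
    using assms unfolding affine_iff by auto
  have p: "inv u (x + m) = inv u x + m" if "int n dvd m" for x m
    by (rule inv_f_eq) (use u that in \<open>auto simp: bij_def surj_f_inv_f\<close>)
  have "(\<Sum>x = 1..int n. inv u (u x) - u x) = (\<Sum>x = 1..int n. inv u x - x)"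
    by (rule periodic_sum[where f = "\<lambda>x. inv u x - x"]) (use u p in \<open>auto simp: bij_def\<close>)
  moreover have "(\<Sum>x = 1..int n. inv u (u x) - u x) = - (\<Sum>x = 1..int n. u x - x)"
    using u(1) by (simp add: bij_def sum_subtractf)
  ultimately have "(\<Sum>x = 1..int n. inv u x - x) = 0" using u by simp
  then show ?thesis unfolding affine_iff using p u(1) by (auto simp: bij_imp_bij_inv)
qed

lemma refl_t_affine [simp]: "refl_t n i j \<in> G"
proof (cases "[i = j] (mod int n)")
  case True
  then show ?thesis by (simp add: refl_t_nocong)
next
  case False
  have i: "\<not> int n dvd i - j" using False by (simp add: cong_iff_dvd_diff)
  have "refl_t n i j x - x = (j - i) * int (if int n dvd x - i then 1 else 0) + (i - j) * int (if int n dvd x - j then 1 else 0)" for x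
  proof -
    have "\<not> (int n dvd x - i \<and> int n dvd x - j)"
      using i dvd_diff[of "int n" "x - j" "x - i"] by auto
    then show ?thesis using i unfolding refl_t_def by (auto simp: cong_iff_dvd_diff)
  qed
  then have "(\<Sum>x = 1..int n. refl_t n i j x - x) = (j - i) * int (\<Sum>x = 1..int n. (if int n dvd x - i then 1 else 0))
       + (i - j) * int (\<Sum>x = 1..int n. (if int n dvd x - j then 1 else 0))"
    by (simp only: sum.distrib sum_distrib_left of_nat_sum)
  also have "\<dots> = 0" by (simp only: sum_single_class) simp
  finally show ?thesis unfolding affine_iff by (auto simp: refl_t_periodic)
qed

lemma affine_bounded:
  assumes "w \<in> G" obtains K where "\<And>x. \<bar>w x - x\<bar> \<le> K"
proof -
  have "\<bar>w x - x\<bar> \<le> Max ((\<lambda>x. \<bar>w x - x\<bar>) ` {1..int n})" for x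
  proof -
    have "w x - x = w (red x) - red x" using affine_diff_dvd[OF assms red_dvd[of x]] by simp
    then show ?thesis using red_in[of x] by simp
  qed
  then show ?thesis using that by blast
qed

section \<open>Length as the number of affine inversions\<close>

definition right_inv :: "(int \<Rightarrow> int) \<Rightarrow> int \<Rightarrow> nat" where
  "right_inv w x = card {y. x < y \<and> w y < w x}"

text \<open>Inversions up to simultaneous translation of both positions by \<open>n\<close>; the
  representative has its left position in the window 1..n.\<close>

definition inversions :: "(int \<Rightarrow> int) \<Rightarrow> nat" where
  "inversions w = (\<Sum>x = 1..int n. right_inv w x)"

lemma right_inv_finite:
  assumes "w \<in> G" shows "finite {y. x < y \<and> w y < v}"
proof -
  obtain K where K: "\<And>x. \<bar>w x - x\<bar> \<le> K" using affine_bounded[OF assms] by blast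
  have "{y. x < y \<and> w y < v} \<subseteq> {x..v + K}"
  proof
    fix y assume "y \<in> {y. x < y \<and> w y < v}"
    then show "y \<in> {x..v + K}" using K[of y] by auto
  qed
  then show ?thesis using finite_subset by blast
qed

lemma right_inv_periodic:
  assumes w: "w \<in> G" and m: "int n dvd m"
  shows "right_inv w (x + m) = right_inv w x"
proof -
  have "(\<lambda>y. y + m) ` {y. x < y \<and> w y < w x} = {y. x + m < y \<and> w y < w (x + m)}"
  proof (intro equalityI subsetI)
    fix y assume "y \<in> {y. x + m < y \<and> w y < w (x + m)}"
    then have "y - m \<in> {y. x < y \<and> w y < w x}" using affine_periodic[OF w m, of x] affine_periodic[OF w m, of "y - m"] by auto
    then show "y \<in> (\<lambda>y. y + m) ` {y. x < y \<and> w y < w x}" by force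
  qed (use affine_periodic[OF w m] in auto)
  moreover have "card ((\<lambda>y. y + m) ` {y. x < y \<and> w y < w x}) = card {y. x < y \<and> w y < w x}"
    by (rule card_image) (auto simp: inj_on_def)
  ultimately show ?thesis unfolding right_inv_def by simp
qed

lemma s_cases:
  obtains (left) m where "int n dvd m" "x = k + m" "s k x = k + 1 + m"
  | (right) m where "int n dvd m" "x = k + 1 + m" "s k x = k + m"
  | (other) "\<not> int n dvd x - k" "\<not> int n dvd x - (k + 1)" "s k x = x"
  using refl_t_cases[OF not_cong_Suc[of k], where x = x] by metis

lemma s_left: "int n dvd m \<Longrightarrow> s k (k + m) = k + 1 + m"
  and s_right: "int n dvd m \<Longrightarrow> s k (k + 1 + m) = k + m"
  using refl_t_left[OF not_cong_Suc] refl_t_right[OF not_cong_Suc] by auto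

lemma s_k [simp]: "s k k = k + 1" "s k (k + 1) = k"
  using s_left[of 0 k] s_right[of 0 k] by auto

lemma s_shift: "int n dvd m \<Longrightarrow> s (k + m) = s k"
  using refl_t_shift[of n m k "k + 1"] by (simp add: add.commute add.left_commute)

text \<open>A simple reflection moves each point by at most one. It can thus reverse only two
  neighbours, and then they are the ones that it exchanges.\<close>

lemma s_less:
  assumes "x < y"
  shows "s k x < s k y \<or> (y = x + 1 \<and> int n dvd x - k \<and> s k x = y \<and> s k y = x)"
proof -
  have "s k x \<le> x + 1" "s k y \<ge> y - 1"
    by (cases rule: s_cases[of x k]; simp) (cases rule: s_cases[of y k]; simp)
  show ?thesis
  proof (cases rule: s_cases[of x k])
    case (left m)
    show ?thesis
    proof (cases "y = x + 1")
      case True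
      then show ?thesis using left s_right[OF left(1), of k] by (simp add: algebra_simps)
    next
      case False
      have "s k y \<noteq> s k x" using assms refl_t_invol[of n k "k + 1"] by (metis order_less_irrefl)
      then show ?thesis using assms False left \<open>s k y \<ge> y - 1\<close> by simp
    qed
  next
    case (right m)
    then show ?thesis using assms \<open>s k y \<ge> y - 1\<close> by linarith
  next
    case other
    show ?thesis
    proof (cases rule: s_cases[of y k])
      case (left m)
      then show ?thesis using assms other by auto
    next
      case (right m)
      then have "x \<noteq> y - 1" using other by auto
      then show ?thesis using assms right other by auto
    next
      case o: other
      then show ?thesis using assms other by auto
    qed
  qed
qed

text \<open>The right ends are reindexed by \<open>s k\<close>. The only pairs whose positions are
  reversed are \<open>x\<close>, \<open>x + 1\<close> with \<open>x\<close> congruent to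
  \<open>k\<close>, and such a pair is the one new inversion.\<close>

lemma right_inv_s:
  assumes w: "w \<in> G" and asc: "w k < w (k + 1)"
  shows "right_inv (w \<circ> s k) x = right_inv w (s k x) + (if int n dvd x - k then 1 else 0)"
proof -
  have asc': "w (k + m) < w (k + 1 + m)" if "int n dvd m" for m
    using asc affine_periodic[OF w that] by simp
  have img: "card {y. P (s k y)} = card {y. P y}" for P
  proof -
    have "s k ` {y. P (s k y)} = {y. P y}"
      by (auto simp: image_iff) (metis refl_t_invol)
    moreover have "card (s k ` {y. P (s k y)}) = card {y. P (s k y)}"
      by (rule card_image) (metis bij_refl_t bij_def inj_on_subset subset_UNIV)
    ultimately show ?thesis by simp
  qed
  show ?thesis
  proof (cases rule: s_cases[of x k])
    case (left m)
    have d: "int n dvd x - k" using left by simp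
    have sx: "s k x = x + 1" "s k (x + 1) = x" using left s_right[OF left(1), of k] by (auto simp: algebra_simps)
    have nd: "\<not> int n dvd x + 1 - k"
      using left(1,2) not_dvd_one(1) dvd_add_right_iff[of "int n" m 1] by simp
    have wx: "w x < w (x + 1)" using asc'[OF left(1)] left by (simp add: algebra_simps)
    have mem: "x < y \<and> w (s k y) < w (x + 1) \<longleftrightarrow> y = x + 1 \<or> (x + 1 < s k y \<and> w (s k y) < w (x + 1))" for y
    proof (cases "y = x + 1")
      case True
      then show ?thesis using sx wx by simp
    next
      case False
      have "x + 1 < s k y" if "x < y"
      proof -
        have "x < s k y" using s_less[of "x + 1" y k] that False sx nd by auto
        moreover have "s k y \<noteq> x + 1" using that sx refl_t_invol by (metis order_less_irrefl)
        ultimately show ?thesis by simp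
      qed
      moreover have "x < y" if "x + 1 < s k y"
        using s_less[OF that, of k] sx nd by auto
      ultimately show ?thesis using False by blast
    qed
    have e: "{y. x < y \<and> (w \<circ> s k) y < (w \<circ> s k) x} = insert (x + 1) {y. x + 1 < s k y \<and> w (s k y) < w (x + 1)}"
      using mem sx by auto
    have "finite {y. x + 1 < y \<and> w y < w (x + 1)}" by (rule right_inv_finite[OF w])
    then have "finite (s k ` {y. x + 1 < y \<and> w y < w (x + 1)})" by simp
    then have fin: "finite {y. x + 1 < s k y \<and> w (s k y) < w (x + 1)}"
      by (rule finite_subset[rotated]) (auto simp: image_iff, metis refl_t_invol)
    have r1: "right_inv (w \<circ> s k) x = Suc (card {y. x + 1 < s k y \<and> w (s k y) < w (x + 1)})"
      unfolding right_inv_def e by (subst card_insert_disjoint) (use fin sx in auto)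
    have r2: "card {y. x + 1 < s k y \<and> w (s k y) < w (x + 1)} = right_inv w (x + 1)"
      unfolding right_inv_def by (rule img)
    show ?thesis unfolding r1 r2 sx(1) using d by simp
  next
    case (right m)
    have d: "\<not> int n dvd x - k"
    proof
      assume "int n dvd x - k"
      then have "int n dvd (x - k) - m" using right(1) by (rule dvd_diff)
      then show False using right(2) not_dvd_one by simp
    qed
    have sx: "s k x = x - 1" "s k (x - 1) = x" using right s_left[OF right(1), of k] by (auto simp: algebra_simps)
    have wx: "w (x - 1) < w x" using asc'[OF right(1)] right by (simp add: algebra_simps)
    have "{y. x < y \<and> (w \<circ> s k) y < (w \<circ> s k) x} = {y. x - 1 < s k y \<and> w (s k y) < w (x - 1)}"
    proof (intro set_eqI iffI)
      fix y assume "y \<in> {y. x < y \<and> (w \<circ> s k) y < (w \<circ> s k) x}"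
      then show "y \<in> {y. x - 1 < s k y \<and> w (s k y) < w (x - 1)}"
        using s_less[of x y k] d sx by auto
    next
      fix y assume "y \<in> {y. x - 1 < s k y \<and> w (s k y) < w (x - 1)}"
      then have y: "x - 1 < s k y" "w (s k y) < w (x - 1)" by auto
      then have "s k y \<noteq> x" using wx by auto
      then have "x < s k y" using y by auto
      then have "x - 1 < y" "y \<noteq> x" using s_less[of x "s k y" k] d sx by auto
      then show "y \<in> {y. x < y \<and> (w \<circ> s k) y < (w \<circ> s k) x}" using y sx by auto
    qed
    then have "right_inv (w \<circ> s k) x = right_inv w (x - 1)"
      unfolding right_inv_def using img[of "\<lambda>y. x - 1 < y \<and> w y < w (x - 1)"] by simp
    then show ?thesis using d sx by simp
  next
    case other
    have "x < y \<longleftrightarrow> x < s k y" for y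
      using s_less[of x y k] s_less[of x "s k y" k] other by auto
    then have "{y. x < y \<and> (w \<circ> s k) y < (w \<circ> s k) x} = {y. x < s k y \<and> w (s k y) < w x}"
      using other by auto
    then show ?thesis unfolding right_inv_def using img[of "\<lambda>y. x < y \<and> w y < w x"] other by simp
  qed
qed

lemma inversions_asc:
  assumes w: "w \<in> G" and asc: "w k < w (k + 1)"
  shows "inversions (w \<circ> s k) = inversions w + 1"
proof -
  have "inversions (w \<circ> s k) = (\<Sum>x = 1..int n. right_inv w (s k x)) + (\<Sum>x = 1..int n. if int n dvd x - k then 1 else 0)"
    unfolding inversions_def right_inv_s[OF assms] by (rule sum.distrib)
  also have "(\<Sum>x = 1..int n. right_inv w (s k x)) = inversions w"
    unfolding inversions_def
    by (rule periodic_sum) (auto simp: right_inv_periodic[OF w] refl_t_periodic bij_is_inj)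
  finally show ?thesis by (simp only: sum_single_class)
qed

lemma inversions_desc:
  assumes w: "w \<in> G" and desc: "w (k + 1) < w k"
  shows "inversions w = inversions (w \<circ> s k) + 1"
  using inversions_asc[of "w \<circ> s k" k] affine_comp[OF w refl_t_affine] desc by simp

lemma asc_or_desc: "w \<in> G \<Longrightarrow> w k < w (k + 1) \<or> w (k + 1) < w k"
  using affine_inj[of w n] by (metis inj_eq linorder_neqE_linordered_idom less_add_one order_less_irrefl)

end

lemma refl_t_conj:
  assumes w: "w \<in> affine_perms n"
  shows "w \<circ> refl_t n i j = refl_t n (w i) (w j) \<circ> w"
proof (cases "[i = j] (mod int n)")
  case True
  then have "w i - w j = i - j" using affine_diff_dvd[OF w] by (simp add: cong_iff_dvd_diff)
  then have "[w i = w j] (mod int n)" using True by (simp add: cong_iff_dvd_diff)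
  then show ?thesis using True by (simp add: refl_t_nocong)
next
  case False
  have d: "int n dvd w x - w y \<longleftrightarrow> int n dvd x - y" for x y
  proof
    assume a: "int n dvd w x - w y"
    have "w (y + (w x - w y)) = w x" using affine_periodic[OF w a, of y] by simp
    then have "y + (w x - w y) = x" using affine_inj[OF w] by (simp add: inj_eq)
    then show "int n dvd x - y" using a by (metis add_diff_cancel_left')
  qed (use affine_diff_dvd[OF w] in auto)
  have F: "\<not> [w i = w j] (mod int n)" using False d by (simp add: cong_iff_dvd_diff)
  show ?thesis
  proof
    fix x
    show "(w \<circ> refl_t n i j) x = (refl_t n (w i) (w j) \<circ> w) x"
    proof (cases x rule: refl_t_cases[OF False])
      case (1 m)
      then show ?thesis using affine_periodic[OF w 1(1)] refl_t_left[OF F 1(1)] by simp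
    next
      case (2 m)
      then show ?thesis using affine_periodic[OF w 2(1)] refl_t_right[OF F 2(1)] by simp
    next
      case 3
      then show ?thesis using refl_t_other[of n "w x" "w i" "w j"] d by simp
    qed
  qed
qed

context affine
begin

lemma comp_s_affine [simp]: "w \<in> G \<Longrightarrow> w \<circ> s k \<in> G" "w \<in> G \<Longrightarrow> s k \<circ> w \<in> G"
  by (simp_all add: affine_comp)

text \<open>Without descents the displacement \<open>w x - x\<close> is weakly increasing. Being
  periodic as well, it is constant, and the normalization of the sum makes the constant
  zero.\<close>

lemma no_descent_id:
  assumes w: "w \<in> G" and asc: "\<And>k. w k < w (k + 1)"
  shows "w = id"
proof -
  have mono: "w x - x \<le> w (x + int q) - (x + int q)" for x q
  proof (induction q)
    case (Suc q)
    then show ?case using asc[of "x + int q"] by (simp add: algebra_simps)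
  qed simp
  have const: "w x - x = w y - y" if "x \<le> y" for x y
  proof -
    obtain q where q: "y = x + int q" using \<open>x \<le> y\<close> zle_iff_zadd by blast
    have "int q \<le> int n * int q" using n_gt mult_right_mono[of 1 "int n" "int q"] by simp
    then obtain p where p: "x + int n * int q = y + int p" using q zle_iff_zadd by (metis add_left_mono)
    have "w (x + int n * int q) - (x + int n * int q) = w x - x" using affine_periodic[OF w, of "int n * int q" x] by simp
    then show ?thesis using mono[of x q] mono[of y p] q p by simp
  qed
  have "w x - x = w 0 - 0" for x using const[of x 0] const[of 0 x] by linarith
  moreover have "(\<Sum>x = 1..int n. w x - x) = 0" using w unfolding affine_iff by simp
  ultimately have "int n * w 0 = 0" by simp
  then have "w 0 = 0" using n_gt by simp
  then show ?thesis using \<open>\<And>x. w x - x = w 0 - 0\<close> by auto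
qed

lemma word_prod_Nil [simp]: "word_prod n [] = id"
  and word_prod_Cons [simp]: "word_prod n (k # l) = s k \<circ> word_prod n l"
  unfolding word_prod_def by simp_all

lemma word_prod_append [simp]: "word_prod n (l @ l') = word_prod n l \<circ> word_prod n l'"
  by (induction l) (simp_all add: comp_assoc)

lemma word_prod_affine [simp]: "word_prod n l \<in> G"
proof (induction l)
  case Nil
  show "word_prod n [] \<in> G" by simp
next
  case (Cons k l)
  then show "word_prod n (k # l) \<in> G" using comp_s_affine(2) by simp
qed

lemma word_prod_rev: "word_prod n (rev l) = inv (word_prod n l)"
proof (induction l)
  case (Cons k l)
  have "bij (word_prod n l)" using affine_bij[OF word_prod_affine] .
  then show "word_prod n (rev (k # l)) = inv (word_prod n (k # l))" using Cons by (simp add: o_inv_distrib)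
next
  case Nil
  show "word_prod n (rev []) = inv (word_prod n [])" by simp
qed

lemma inversions_id [simp]: "inversions id = 0"
proof -
  have "{y. x < y \<and> y < x} = {}" for x :: int by auto
  then show ?thesis unfolding inversions_def right_inv_def by simp
qed

lemma inversions_word: "inversions (word_prod n l) \<le> length l"
proof (induction l rule: rev_induct)
  case (snoc k l)
  show "inversions (word_prod n (l @ [k])) \<le> length (l @ [k])"
    using snoc asc_or_desc[of "word_prod n l" k] inversions_asc[of "word_prod n l" k] inversions_desc[of "word_prod n l" k]
    by auto
next
  case Nil
  show "inversions (word_prod n []) \<le> length []" by simp
qed

lemma inversions_reduced_word:
  assumes "w \<in> G"
  shows "\<exists>l. set l \<subseteq> {1..int n} \<and> length l = inversions w \<and> word_prod n l = w"
  using assms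
proof (induction "inversions w" arbitrary: w)
  case 0
  then have "w k < w (k + 1)" for k using asc_or_desc[OF 0(2), of k] inversions_desc[OF 0(2), of k] by auto
  then have "w = id" using no_descent_id 0 by blast
  then show "\<exists>l. set l \<subseteq> {1..int n} \<and> length l = inversions w \<and> word_prod n l = w"
    by (intro exI[of _ "[]"]) simp
next
  case (Suc q)
  then have "w \<noteq> id" by auto
  then obtain k where k: "\<not> w k < w (k + 1)" using no_descent_id Suc by blast
  \<comment> \<open>\<open>len\<close> counts words with letters in 1..n only, so periodicity is
    used to move the descent into that window.\<close>
  have "w (red k + 1) < w (red k)"
    using asc_or_desc[OF Suc(3), of k] k affine_periodic[OF Suc(3) red_dvd[of k], of "red k"] affine_periodic[OF Suc(3) red_dvd[of k], of "red k + 1"]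
    by (simp add: algebra_simps)
  then have e: "inversions w = inversions (w \<circ> s (red k)) + 1" by (rule inversions_desc[OF Suc(3)])
  then obtain l where "set l \<subseteq> {1..int n}" "length l = inversions (w \<circ> s (red k))" "word_prod n l = w \<circ> s (red k)"
    using Suc by fastforce
  then show "\<exists>l. set l \<subseteq> {1..int n} \<and> length l = inversions w \<and> word_prod n l = w"
    using red_in[of k] e by (intro exI[of _ "l @ [red k]"]) auto
qed

lemma len_eq_inversions:
  assumes "w \<in> G" shows "len n w = inversions w"
  unfolding len_def
proof (rule Least_equality)
  show "\<exists>l. set l \<subseteq> {1..int n} \<and> length l = inversions w \<and> word_prod n l = w"
    by (rule inversions_reduced_word[OF assms])
qed (use inversions_word in auto)

lemma len_asc: "w \<in> G \<Longrightarrow> w k < w (k + 1) \<Longrightarrow> len n (w \<circ> s k) = len n w + 1"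
  and len_desc: "w \<in> G \<Longrightarrow> w (k + 1) < w k \<Longrightarrow> len n w = len n (w \<circ> s k) + 1"
  using inversions_asc inversions_desc by (simp_all add: len_eq_inversions)

lemma len_comp_s_le: "w \<in> G \<Longrightarrow> len n (w \<circ> s k) \<le> len n w + 1"
  using asc_or_desc[of w k] len_asc[of w k] len_desc[of w k] by auto

lemma asc_iff_len:
  assumes w: "w \<in> G"
  shows "w k < w (k + 1) \<longleftrightarrow> len n (w \<circ> s k) = len n w + 1"
  using asc_or_desc[OF w, of k]
proof
  assume "w k < w (k + 1)"
  then show ?thesis using len_asc[OF w] by blast
next
  assume a: "w (k + 1) < w k"
  then have "len n w = len n (w \<circ> s k) + 1" by (rule len_desc[OF w])
  then have "len n (w \<circ> s k) \<noteq> len n w + 1" by linarith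
  then show ?thesis using a by auto
qed

lemma len_id [simp]: "len n id = 0"
  by (simp add: len_eq_inversions)

lemma len_word: "len n (word_prod n l) \<le> length l"
  using inversions_word by (simp add: len_eq_inversions)

lemma reduced_word:
  assumes "w \<in> G" obtains l where "length l = len n w" "word_prod n l = w"
  using inversions_reduced_word[OF assms] len_eq_inversions[OF assms] by auto

lemma len_inv: assumes "w \<in> G" shows "len n (inv w) = len n w"
proof -
  have *: "len n (inv w) \<le> len n w" if "w \<in> G" for w
  proof -
    obtain l where "length l = len n w" "word_prod n l = w" using reduced_word[OF \<open>w \<in> G\<close>] .
    then show ?thesis using len_word[of "rev l"] by (simp add: word_prod_rev)
  qed
  show ?thesis using *[OF assms] *[OF affine_inv[OF assms]] inv_inv_eq[OF affine_bij[OF assms]] by simp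
qed

lemma inv_s_comp: "w \<in> G \<Longrightarrow> inv (w \<circ> s k) = s k \<circ> inv w" "w \<in> G \<Longrightarrow> inv (s k \<circ> w) = inv w \<circ> s k"
  using affine_bij by (simp_all add: o_inv_distrib)

lemma inv_inv_affine: "w \<in> G \<Longrightarrow> inv (inv w) = w"
  using affine_bij inv_inv_eq by blast

lemma len_left_asc: "w \<in> G \<Longrightarrow> inv w k < inv w (k + 1) \<Longrightarrow> len n (s k \<circ> w) = len n w + 1"
  using len_asc[of "inv w" k] len_inv[of "s k \<circ> w"] len_inv[of w] affine_inv by (simp add: inv_s_comp)

section \<open>Left and right actions of the simple reflections\<close>

definition right_act :: "int \<Rightarrow> (int \<Rightarrow> int) \<Rightarrow> int \<Rightarrow> int" where
  "right_act k w = (if w k < w (k + 1) then w \<circ> s k else w)"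

definition left_act :: "int \<Rightarrow> (int \<Rightarrow> int) \<Rightarrow> int \<Rightarrow> int" where
  "left_act k w = (if inv w k < inv w (k + 1) then s k \<circ> w else w)"

lemma right_act_affine [simp]: "w \<in> G \<Longrightarrow> right_act k w \<in> G"
  and left_act_affine [simp]: "w \<in> G \<Longrightarrow> left_act k w \<in> G"
  unfolding right_act_def left_act_def by auto

text \<open>This commutation carries the associativity of the Demazure product. One action can
  disturb the ascent test of the other only if \<open>s a \<circ> w = w \<circ> s b\<close>; then,
  whichever action comes first, the other one is idle, and both orders give the same
  element.\<close>

lemma left_right_act:
  assumes w: "w \<in> G"
  shows "left_act a (right_act b w) = right_act b (left_act a w)"
proof -
  note per = affine_periodic[OF w] and iper = affine_periodic[OF affine_inv[OF w]]
  have iw: "inv w (w x) = x" "w (inv w x) = x" for x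
    using affine_bij[OF w] by (simp_all add: bij_is_inj bij_is_surj surj_f_inv_f)
  \<comment> \<open>Both sides express that \<open>w\<close> maps a translate of \<open>b\<close>,
    \<open>b + 1\<close> onto \<open>a\<close>, \<open>a + 1\<close> in this order, which is the
    case \<open>s a \<circ> w = w \<circ> s b\<close>.\<close>
  have flip: "inv w (a + 1) = inv w a + 1 \<and> int n dvd inv w a - b \<longleftrightarrow> w (b + 1) = w b + 1 \<and> int n dvd w b - a"
  proof
    assume A: "inv w (a + 1) = inv w a + 1 \<and> int n dvd inv w a - b"
    define m where "m = inv w a - b"
    have m: "int n dvd m" and m': "int n dvd - m" using A dvd_minus_iff[of "int n" m] m_def by simp_all
    have "b + m = inv w a" "b + 1 + m = inv w (a + 1)" using A m_def by simp_all
    then have "w (b + m) = a" "w (b + 1 + m) = a + 1" using iw by simp_all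
    then have e: "w b + m = a" "w (b + 1) + m = a + 1" using per[OF m] by auto
    then have "w b - a = - m" by simp
    then have "int n dvd w b - a" using m' by (simp only:)
    then show "w (b + 1) = w b + 1 \<and> int n dvd w b - a" using e by linarith
  next
    assume A: "w (b + 1) = w b + 1 \<and> int n dvd w b - a"
    define m where "m = w b - a"
    have m: "int n dvd m" and m': "int n dvd - m" using A dvd_minus_iff[of "int n" m] m_def by simp_all
    have "a + m = w b" "a + 1 + m = w (b + 1)" using A m_def by simp_all
    then have "inv w (a + m) = b" "inv w (a + 1 + m) = b + 1" using iw by simp_all
    then have e: "inv w a + m = b" "inv w (a + 1) + m = b + 1" using iper[OF m] by auto
    then have "inv w a - b = - m" by simp
    then have "int n dvd inv w a - b" using m' by (simp only:)
    then show "inv w (a + 1) = inv w a + 1 \<and> int n dvd inv w a - b" using e by linarith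
  qed
  have R: "right_act b (s a \<circ> w) = (if s a (w b) < s a (w (b + 1)) then s a \<circ> w \<circ> s b else s a \<circ> w)"
    and L: "left_act a (w \<circ> s b) = (if s b (inv w a) < s b (inv w (a + 1)) then s a \<circ> w \<circ> s b else w \<circ> s b)"
    unfolding right_act_def left_act_def using w by (simp_all add: inv_s_comp comp_assoc)
  have neq: "w b \<noteq> w (b + 1)" "inv w a \<noteq> inv w (a + 1)" using iw by (metis less_add_one order_less_irrefl)+
  have sw: "s a \<circ> w = w \<circ> s b" if "w (b + 1) = w b + 1" "int n dvd w b - a"
  proof -
    have "w \<circ> s b = refl_t n (w b) (w b + 1) \<circ> w" using refl_t_conj[OF w, of b "b + 1"] that by simp
    then show ?thesis using s_shift[OF that(2), of a] by simp
  qed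
  consider "inv w a < inv w (a + 1)" "w b < w (b + 1)" | "inv w a < inv w (a + 1)" "w (b + 1) < w b"
    | "inv w (a + 1) < inv w a" "w b < w (b + 1)" | "inv w (a + 1) < inv w a" "w (b + 1) < w b"
    using neq by linarith
  then show ?thesis
  proof cases
    case 1
    then have 0: "left_act a w = s a \<circ> w" "right_act b w = w \<circ> s b" unfolding left_act_def right_act_def by auto
    show ?thesis
    proof (cases "w (b + 1) = w b + 1 \<and> int n dvd w b - a")
      case True
      have 2: "inv w (a + 1) = inv w a + 1" "int n dvd inv w a - b" using flip True by auto
      have "s a (w b) = w b + 1" using s_left[of "w b - a" a] True by (simp add: add.commute)
      moreover have "s a (w b + 1) = w b" using s_right[of "w b - a" a] True by (simp add: add.commute)
      moreover have "s b (inv w a) = inv w a + 1" using s_left[of "inv w a - b" b] 2 by (simp add: add.commute)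
      moreover have "s b (inv w a + 1) = inv w a" using s_right[of "inv w a - b" b] 2 by (simp add: add.commute)
      ultimately show ?thesis unfolding 0 R L using sw True 2 by simp
    next
      case False
      have "s a (w b) < s a (w (b + 1))" using s_less[OF 1(2), of a] False by auto
      moreover have "s b (inv w a) < s b (inv w (a + 1))" using s_less[OF 1(1), of b] False flip by auto
      ultimately show ?thesis unfolding 0 R L by simp
    qed
  next
    case 2
    then have 0: "left_act a w = s a \<circ> w" "right_act b w = w" unfolding left_act_def right_act_def by auto
    have "\<not> s a (w b) < s a (w (b + 1))"
    proof
      assume "s a (w b) < s a (w (b + 1))"
      then have A: "w b = w (b + 1) + 1" "int n dvd w (b + 1) - a" using s_less[OF 2(2), of a] by auto
      define m where "m = w (b + 1) - a"
      have m: "int n dvd m" using A m_def by simp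
      have "a + m = w (b + 1)" "a + 1 + m = w b" using A m_def by simp_all
      then have "inv w (a + m) = b + 1" "inv w (a + 1 + m) = b" using iw by simp_all
      then show False using iper[OF m] 2 by simp
    qed
    then show ?thesis unfolding 0 R using 0 by simp
  next
    case 3
    then have 0: "left_act a w = w" "right_act b w = w \<circ> s b" unfolding left_act_def right_act_def by auto
    have "\<not> s b (inv w a) < s b (inv w (a + 1))"
    proof
      assume "s b (inv w a) < s b (inv w (a + 1))"
      then have A: "inv w a = inv w (a + 1) + 1" "int n dvd inv w (a + 1) - b" using s_less[OF 3(1), of b] by auto
      define m where "m = inv w (a + 1) - b"
      have m: "int n dvd m" using A m_def by simp
      have "b + m = inv w (a + 1)" "b + 1 + m = inv w a" using A m_def by simp_all
      then have "w (b + m) = a + 1" "w (b + 1 + m) = a" using iw by simp_all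
      then show False using per[OF m] 3 by simp
    qed
    then show ?thesis unfolding 0 L using 0 by simp
  next
    case 4
    then show ?thesis unfolding left_act_def right_act_def by auto
  qed
qed

section \<open>The Demazure product\<close>

definition right_word :: "int list \<Rightarrow> (int \<Rightarrow> int) \<Rightarrow> int \<Rightarrow> int" where
  "right_word l u = foldl (\<lambda>w k. right_act k w) u l"

definition left_word :: "int list \<Rightarrow> (int \<Rightarrow> int) \<Rightarrow> int \<Rightarrow> int" where
  "left_word l u = foldr left_act l u"

lemma right_word_simps [simp]:
  "right_word [] u = u" "right_word (l @ [k]) u = right_act k (right_word l u)"
  "right_word (l @ l') u = right_word l' (right_word l u)" "right_word [k] u = right_act k u"
  unfolding right_word_def by simp_all

lemma left_word_simps [simp]:
  "left_word [] u = u" "left_word (k # l) u = left_act k (left_word l u)"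
  unfolding left_word_def by simp_all

lemma right_word_affine [simp]: "u \<in> G \<Longrightarrow> right_word l u \<in> G"
proof (induction l rule: rev_induct)
  case (snoc k l)
  then show "right_word (l @ [k]) u \<in> G" by (simp only: right_word_simps right_act_affine)
qed (simp only: right_word_simps)

lemma left_word_affine [simp]: "u \<in> G \<Longrightarrow> left_word l u \<in> G"
proof (induction l)
  case (Cons k l)
  then show "left_word (k # l) u \<in> G" by (simp only: left_word_simps left_act_affine)
qed (simp only: left_word_simps)

lemma left_act_right_word:
  assumes "u \<in> G" shows "left_act k (right_word l u) = right_word l (left_act k u)"
proof (induction l rule: rev_induct)
  case (snoc a l)
  then show "left_act k (right_word (l @ [a]) u) = right_word (l @ [a]) (left_act k u)"
    using assms by (simp only: right_word_simps left_right_act right_word_affine)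
qed (simp only: right_word_simps)

lemma left_right_word:
  assumes "u \<in> G" shows "left_word m (right_word l u) = right_word l (left_word m u)"
proof (induction m)
  case (Cons a m)
  then show "left_word (a # m) (right_word l u) = right_word l (left_word (a # m) u)"
    using assms by (simp only: left_word_simps left_act_right_word left_word_affine)
qed (simp only: left_word_simps)

definition reduced :: "int list \<Rightarrow> bool" where
  "reduced l \<longleftrightarrow> len n (word_prod n l) = length l"

lemma reduced_snoc:
  assumes "reduced (l @ [k])"
  shows "reduced l" "word_prod n l k < word_prod n l (k + 1)"
proof -
  have "length l + 1 = len n (word_prod n l \<circ> s k)" using assms unfolding reduced_def by simp
  moreover have "len n (word_prod n l \<circ> s k) \<le> len n (word_prod n l) + 1" by (rule len_comp_s_le) simp
  moreover have "len n (word_prod n l) \<le> length l" by (rule len_word)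
  ultimately have "len n (word_prod n l) = length l" "len n (word_prod n l \<circ> s k) = len n (word_prod n l) + 1" by linarith+
  then show "reduced l" "word_prod n l k < word_prod n l (k + 1)"
    unfolding reduced_def using asc_iff_len[of "word_prod n l" k] by simp_all
qed

lemma reduced_append: "reduced (l @ m) \<Longrightarrow> reduced l"
proof (induction m rule: rev_induct)
  case (snoc k m)
  then show ?case using reduced_snoc(1)[of "l @ m" k] by simp
qed simp

lemma reduced_rev: "reduced (rev l) \<longleftrightarrow> reduced l"
  unfolding reduced_def by (simp add: word_prod_rev len_inv)

lemma reduced_Cons:
  assumes "reduced (k # l)"
  shows "reduced l" "inv (word_prod n l) k < inv (word_prod n l) (k + 1)"
proof -
  have "reduced (rev l @ [k])" using assms reduced_rev[of "k # l"] by simp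
  from reduced_snoc[OF this] show "reduced l" "inv (word_prod n l) k < inv (word_prod n l) (k + 1)"
    by (simp_all add: reduced_rev word_prod_rev)
qed

lemma obtain_reduced:
  assumes "w \<in> G" obtains l where "reduced l" "length l = len n w" "word_prod n l = w"
  using reduced_word[OF assms] unfolding reduced_def by metis

lemma right_word_reduced: "reduced l \<Longrightarrow> right_word l id = word_prod n l"
proof (induction l rule: rev_induct)
  case Nil
  show "right_word [] id = word_prod n []" by simp
next
  case (snoc k l)
  then have "right_word l id = word_prod n l" "word_prod n l k < word_prod n l (k + 1)" using reduced_snoc by blast+
  then show "right_word (l @ [k]) id = word_prod n (l @ [k])" by (simp add: right_act_def)
qed

lemma left_word_reduced: "reduced l \<Longrightarrow> left_word l id = word_prod n l"
proof (induction l)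
  case Nil
  show "left_word [] id = word_prod n []" by simp
next
  case (Cons k l)
  then have "left_word l id = word_prod n l" "inv (word_prod n l) k < inv (word_prod n l) (k + 1)" using reduced_Cons by blast+
  then show "left_word (k # l) id = word_prod n (k # l)" by (simp add: left_act_def)
qed

text \<open>
  Left and right actions commute, so \<open>right_word l u\<close> depends on \<open>l\<close> only through \<open>right_word l id\<close>;
  hence the choice of \<open>l\<close> is immaterial.
\<close>

definition dprod :: "(int \<Rightarrow> int) \<Rightarrow> (int \<Rightarrow> int) \<Rightarrow> int \<Rightarrow> int" where
  "dprod = (\<lambda>u\<in>G. \<lambda>v\<in>G. right_word (SOME l. right_word l id = v) u)"

lemma dprod_left_right:
  assumes "left_word m id = u" "right_word l id = v"
  shows "right_word l u = left_word m v"
  using left_right_word[of id m l] assms by simp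

lemma dprod_right:
  assumes u: "u \<in> G" and v: "right_word l id = v"
  shows "dprod u v = right_word l u"
proof -
  have vG: "v \<in> G" using v right_word_affine[of id l] by simp
  obtain m where "left_word m id = u" using obtain_reduced[OF u] left_word_reduced by metis
  note E = dprod_left_right[OF this]
  have "right_word (SOME l. right_word l id = v) id = v" by (rule someI[of _ l]) (rule v)
  then show ?thesis unfolding dprod_def using E E[OF v] u vG by simp
qed

lemma dprod_left:
  assumes v: "v \<in> G" and u: "left_word m id = u"
  shows "dprod u v = left_word m v"
proof -
  have uG: "u \<in> G" using u left_word_affine[of id m] by simp
  obtain l where l: "right_word l id = v" using obtain_reduced[OF v] right_word_reduced by metis
  show ?thesis using dprod_right[OF uG l] dprod_left_right[OF u l] by simp
qed

lemma dprod_s_right: "u \<in> G \<Longrightarrow> dprod u (s k) = right_act k u"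
  using dprod_right[of u "[k]" "s k"] by (simp add: right_act_def)

lemma dprod_s_left: "u \<in> G \<Longrightarrow> dprod (s k) u = left_act k u"
  using dprod_left[of u "[k]" "s k"] by (simp add: left_act_def)

lemma dprod_affine: "u \<in> G \<Longrightarrow> v \<in> G \<Longrightarrow> dprod u v \<in> G"
  using dprod_right right_word_reduced obtain_reduced right_word_affine by metis

lemma dprod_assoc:
  assumes "u \<in> G" "v \<in> G" "w \<in> G"
  shows "dprod (dprod u v) w = dprod u (dprod v w)"
proof -
  obtain l m where l: "right_word l id = v" and m: "right_word m id = w"
    using right_word_reduced obtain_reduced assms by metis
  have "dprod v w = right_word (l @ m) id" using dprod_right[OF assms(2) m] l by simp
  then have "dprod u (dprod v w) = right_word (l @ m) u" using dprod_right[OF assms(1)] by metis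
  also have "\<dots> = dprod (dprod u v) w"
    using dprod_right[OF assms(1) l] dprod_right[OF _ m, of "dprod u v"] dprod_affine[OF assms(1,2)] by simp
  finally show ?thesis by (rule sym)
qed

text \<open>Each letter raises the length by at most one. Additivity for the whole word therefore
  passes to its prefixes, and every letter acts at an ascent.\<close>

lemma additive_word:
  "u \<in> G \<Longrightarrow> len n (u \<circ> word_prod n l) = len n u + length l \<Longrightarrow> right_word l u = u \<circ> word_prod n l"
proof (induction l rule: rev_induct)
  case Nil
  show "right_word [] u = u \<circ> word_prod n []" by simp
next
  case (snoc k l)
  have uG: "u \<circ> word_prod n l \<in> G" using snoc(2) by (simp add: affine_comp)
  have e: "u \<circ> word_prod n (l @ [k]) = (u \<circ> word_prod n l) \<circ> s k" by (simp add: comp_assoc)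
  have le: "len n (u \<circ> word_prod n m) \<le> len n u + length m" for m
  proof -
    obtain a where a: "word_prod n a = u" "length a = len n u" using obtain_reduced[OF snoc(2)] by metis
    then show ?thesis using len_word[of "a @ m"] by simp
  qed
  have "len n (u \<circ> word_prod n (l @ [k])) = len n u + length (l @ [k])" by (rule snoc(3))
  then have "len n ((u \<circ> word_prod n l) \<circ> s k) = len n u + length l + 1" unfolding e by simp
  then have l: "len n (u \<circ> word_prod n l) = len n u + length l" "len n ((u \<circ> word_prod n l) \<circ> s k) = len n (u \<circ> word_prod n l) + 1"
    using len_comp_s_le[OF uG, of k] le[of l] by linarith+
  have a: "(u \<circ> word_prod n l) k < (u \<circ> word_prod n l) (k + 1)" using asc_iff_len[OF uG] l(2) by blast
  have r: "right_word l u = u \<circ> word_prod n l" by (rule snoc(1)[OF snoc(2) l(1)])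
  show "right_word (l @ [k]) u = u \<circ> word_prod n (l @ [k])"
    unfolding e right_word_simps r right_act_def using a by presburger
qed

lemma dprod_additive:
  assumes "u \<in> G" "v \<in> G" "len n (u \<circ> v) = len n u + len n v"
  shows "dprod u v = u \<circ> v"
proof -
  obtain l where l: "reduced l" "length l = len n v" "word_prod n l = v" using obtain_reduced[OF assms(2)] .
  then show ?thesis using additive_word[OF assms(1), of l] dprod_right[OF assms(1) right_word_reduced[OF l(1)]] assms(3) by simp
qed

lemma is_demazure_dprod: "is_demazure_product n dprod"
  unfolding is_demazure_product_def
proof (intro conjI ballI allI impI)
  have "dprod u \<in> G \<rightarrow>\<^sub>E G" if "u \<in> G" for u
    using that dprod_affine[OF that] unfolding dprod_def by (auto simp: PiE_def extensional_def)
  then show "dprod \<in> G \<rightarrow>\<^sub>E G \<rightarrow>\<^sub>E G" unfolding dprod_def by (auto simp: PiE_def extensional_def)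
  show "dprod (s i) (s i) = s i" for i using dprod_s_right[of "s i" i] by (simp add: right_act_def)
qed (use dprod_assoc dprod_additive in auto)

text \<open>Right multiplication by \<open>s k\<close> is forced: at an ascent by additivity of
  lengths, and at a descent because \<open>w\<close> is then itself a product ending in
  \<open>s k\<close>, which idempotence absorbs. Associativity extends this along reduced words, and
  extensionality settles the arguments outside the group.\<close>

lemma demazure_unique:
  assumes p: "is_demazure_product n p" shows "p = dprod"
proof -
  have pE: "p \<in> G \<rightarrow>\<^sub>E G \<rightarrow>\<^sub>E G" and pa: "\<And>u v w. u \<in> G \<Longrightarrow> v \<in> G \<Longrightarrow> w \<in> G \<Longrightarrow> p (p u v) w = p u (p v w)"
    and ps: "\<And>i. p (s i) (s i) = s i"
    and pl: "\<And>u v. u \<in> G \<Longrightarrow> v \<in> G \<Longrightarrow> len n (u \<circ> v) = len n u + len n v \<Longrightarrow> p u v = u \<circ> v"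
    using p unfolding is_demazure_product_def by auto
  have len_s: "len n (s k) = 1" for k using len_asc[of id k] by simp
  have act: "p w (s k) = right_act k w" if w: "w \<in> G" for w k
  proof (cases "w k < w (k + 1)")
    case True
    then show ?thesis using pl[OF w, of "s k"] len_asc[OF w True] len_s unfolding right_act_def by simp
  next
    case False
    then have d: "w (k + 1) < w k" using asc_or_desc[OF w] by blast
    define v where "v = w \<circ> s k"
    have v: "v \<in> G" "v \<circ> s k = w" using w unfolding v_def by auto
    have e: "p v (s k) = w" using pl[OF v(1), of "s k"] len_desc[OF w d] len_s v unfolding v_def[symmetric] by simp
    have "p w (s k) = p (p v (s k)) (s k)" using e by simp
    also have "\<dots> = p v (s k)" using pa[OF v(1)] ps by simp
    finally show ?thesis using e False unfolding right_act_def by simp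
  qed
  have word: "reduced l \<Longrightarrow> p u (word_prod n l) = right_word l u" if u: "u \<in> G" for u l
  proof (induction l rule: rev_induct)
    case Nil
    show "p u (word_prod n []) = right_word [] u" using pl[OF u, of id] by simp
  next
    case (snoc k l)
    have "p u (word_prod n (l @ [k])) = p u (p (word_prod n l) (s k))"
      using act[of "word_prod n l" k] reduced_snoc[OF snoc(2)] by (simp add: right_act_def)
    also have "\<dots> = p (p u (word_prod n l)) (s k)" using pa[OF u] by simp
    also have "\<dots> = right_act k (right_word l u)" using snoc reduced_snoc(1) act u by simp
    finally show "p u (word_prod n (l @ [k])) = right_word (l @ [k]) u" by simp
  qed
  have eq: "p u v = dprod u v" if u: "u \<in> G" and v: "v \<in> G" for u v
  proof -
    obtain l where l: "reduced l" "word_prod n l = v" using obtain_reduced[OF v] by metis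
    then show ?thesis using word[OF u l(1)] dprod_right[OF u right_word_reduced[OF l(1)]] by simp
  qed
  have dE: "dprod \<in> G \<rightarrow>\<^sub>E G \<rightarrow>\<^sub>E G" using is_demazure_dprod unfolding is_demazure_product_def by blast
  show ?thesis
  proof (rule PiE_ext[OF pE dE])
    fix u assume u: "u \<in> G"
    have "p u \<in> G \<rightarrow>\<^sub>E G" "dprod u \<in> G \<rightarrow>\<^sub>E G" using pE dE u by (auto dest: PiE_mem)
    then show "p u = dprod u" by (rule PiE_ext) (rule eq[OF u])
  qed
qed

lemma demazure_eq: "demazure n = dprod"
  unfolding demazure_def using is_demazure_dprod demazure_unique by (rule the_equality)

section \<open>Demazure conjugation of involutions by simple reflections\<close>

definition conj_act :: "int \<Rightarrow> (int \<Rightarrow> int) \<Rightarrow> int \<Rightarrow> int" where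
  "conj_act k z = (if z k < z (k + 1) then if z k = k \<and> z (k + 1) = k + 1 then z \<circ> s k else s k \<circ> z \<circ> s k else z)"

abbreviation I :: "(int \<Rightarrow> int) set" where "I \<equiv> affine_involutions n"

lemma I_iff: "z \<in> I \<longleftrightarrow> z \<in> G \<and> (\<forall>x. z (z x) = x)"
  unfolding affine_involutions_def using affine_bij[of z n]
  by (auto simp: bij_is_surj surj_f_inv_f intro!: ext) (metis surj_f_inv_f bij_is_surj, metis bij_inv_eq_iff)

text \<open>After the right factor has been applied at an ascent, the left factor is absorbed
  exactly when \<open>s k\<close> would reverse \<open>z k\<close> and \<open>z (k + 1)\<close>. For
  an affine involution this happens only if both points are fixed.\<close>

lemma left_right_conj_act:
  assumes z: "z \<in> I" shows "left_act k (right_act k z) = conj_act k z"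
proof -
  have zG: "z \<in> G" and zz: "\<And>x. z (z x) = x" using z I_iff by auto
  have iz: "inv z = z" using zz by (intro inv_equality) auto
  note per = affine_periodic[OF zG]
  show ?thesis
  proof (cases "z k < z (k + 1)")
    case False
    then show ?thesis unfolding left_act_def right_act_def conj_act_def by (simp add: iz)
  next
    case True
    have R: "right_act k z = z \<circ> s k" unfolding right_act_def using True by simp
    have L: "left_act k (z \<circ> s k) = (if s k (z k) < s k (z (k + 1)) then s k \<circ> z \<circ> s k else z \<circ> s k)"
      unfolding left_act_def using zG iz by (simp add: inv_s_comp comp_assoc)
    have "z k = k \<and> z (k + 1) = k + 1 \<longleftrightarrow> \<not> s k (z k) < s k (z (k + 1))"
    proof
      assume "\<not> s k (z k) < s k (z (k + 1))"
      then have A: "z (k + 1) = z k + 1" "int n dvd z k - k" using s_less[OF True, of k] by auto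
      \<comment> \<open>An affine involution cannot move \<open>k\<close> to a different translate
        of itself: applying it twice would shift \<open>k\<close> by twice the difference.\<close>
      have "z (k + (z k - k)) = z k + (z k - k)" by (rule per[OF A(2)])
      then have "z k = k" using zz by simp
      then show "z k = k \<and> z (k + 1) = k + 1" using A by simp
    qed simp
    then show ?thesis unfolding R L conj_act_def using True by auto
  qed
qed

text \<open>At an ascent of \<open>\<pi>\<close> both \<open>\<pi> \<circ> s k\<close> and its
  inverse are Demazure products, so associativity brings the two letters to the outside of the
  product of \<open>inv \<pi>\<close> and \<open>\<pi>\<close>.\<close>

lemma demazure_inv_comp:
  assumes p: "\<pi> \<in> G" and z: "demazure n (inv \<pi>) \<pi> = z" and zI: "z \<in> I" and asc: "\<pi> k < \<pi> (k + 1)"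
  shows "demazure n (inv (\<pi> \<circ> s k)) (\<pi> \<circ> s k) = conj_act k z"
proof -
  have ip: "inv \<pi> \<in> G" using affine_inv[OF p] .
  have 1: "dprod \<pi> (s k) = \<pi> \<circ> s k" using dprod_s_right[OF p] asc unfolding right_act_def by simp
  have 2: "dprod (s k) (inv \<pi>) = s k \<circ> inv \<pi>" using dprod_s_left[OF ip] asc unfolding left_act_def inv_inv_affine[OF p] by simp
  have zG: "z \<in> G" using zI I_iff by auto
  have "dprod (s k \<circ> inv \<pi>) (\<pi> \<circ> s k) = dprod (dprod (s k) (inv \<pi>)) (dprod \<pi> (s k))" using 1 2 by simp
  also have "\<dots> = dprod (s k) (dprod (dprod (inv \<pi>) \<pi>) (s k))"
    using dprod_assoc[of "s k" "inv \<pi>"] dprod_assoc[of "inv \<pi>" \<pi> "s k"] ip p dprod_affine by simp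
  also have "\<dots> = left_act k (right_act k z)"
    using z dprod_s_right[OF zG] dprod_s_left[of "right_act k z" k] zG unfolding demazure_eq by simp
  finally show ?thesis using left_right_conj_act[OF zI] inv_s_comp(1)[OF p] unfolding demazure_eq by simp
qed

lemma demazure_inv_id: "demazure n (inv id) id = id"
  unfolding demazure_eq using dprod_additive[of id id] by simp

section \<open>Local characterization of atoms\<close>

text \<open>The order-theoretic core of \<open>shape_conj_s\<close> at an ascent. The points
  \<open>P\<close>, \<open>Q\<close> are the images of \<open>p\<close>, \<open>q\<close> under
  \<open>s k\<close>; their partners \<open>Z\<close>, \<open>Y\<close> in the old involution
  correspond in the same way to the partners \<open>zp\<close>, \<open>zq\<close> in the conjugated
  one, and the values stay attached to the capital letters. By \<open>L\<close>, only neighbours can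
  be reversed, and then their partners are in ascending order before and after.\<close>

lemma conj_order_asc:
  fixes P Q Z Y p q zp zq \<pi>P \<pi>Q \<pi>Z \<pi>Y :: int
  assumes ne: "P \<noteq> Q" "P \<noteq> Y" "Z \<noteq> Q" "Z \<noteq> Y"
    and neq: "p \<noteq> q" "p \<noteq> zq" "zp \<noteq> q" "zp \<noteq> zq" "p = zp \<longleftrightarrow> P = Z" "q = zq \<longleftrightarrow> Q = Y"
    and A: "P < Z \<Longrightarrow> \<pi>Z < \<pi>P" "Z < P \<Longrightarrow> \<pi>P < \<pi>Z" "Q < Y \<Longrightarrow> \<pi>Y < \<pi>Q" "Y < Q \<Longrightarrow> \<pi>Q < \<pi>Y"
    and X: "P = Z \<Longrightarrow> \<pi>P = \<pi>Z" "Q = Y \<Longrightarrow> \<pi>Q = \<pi>Y"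
    and B: "P < Q \<and> Q < Z \<longrightarrow> \<pi>Q < \<pi>Z \<or> \<pi>P < \<pi>Q" "P < Y \<and> Y < Z \<longrightarrow> \<pi>Y < \<pi>Z \<or> \<pi>P < \<pi>Y"
      "Z < Q \<and> Q < P \<longrightarrow> \<pi>Q < \<pi>P \<or> \<pi>Z < \<pi>Q" "Z < Y \<and> Y < P \<longrightarrow> \<pi>Y < \<pi>P \<or> \<pi>Z < \<pi>Y"
      "Q < P \<and> P < Y \<longrightarrow> \<pi>P < \<pi>Y \<or> \<pi>Q < \<pi>P" "Q < Z \<and> Z < Y \<longrightarrow> \<pi>Z < \<pi>Y \<or> \<pi>Q < \<pi>Z"
      "Y < P \<and> P < Q \<longrightarrow> \<pi>P < \<pi>Q \<or> \<pi>Y < \<pi>P" "Y < Z \<and> Z < Q \<longrightarrow> \<pi>Z < \<pi>Q \<or> \<pi>Y < \<pi>Z"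
    and C: "(P < Q \<and> Z < Y) \<or> (P < Y \<and> Z < Q) \<longrightarrow> \<pi>P < \<pi>Q \<and> \<pi>P < \<pi>Y \<and> \<pi>Z < \<pi>Q \<and> \<pi>Z < \<pi>Y"
      "(Q < P \<and> Y < Z) \<or> (Q < Z \<and> Y < P) \<longrightarrow> \<pi>Q < \<pi>P \<and> \<pi>Y < \<pi>P \<and> \<pi>Q < \<pi>Z \<and> \<pi>Y < \<pi>Z"
    and L: "P < Z \<longrightarrow> p < zp" "Z < P \<longrightarrow> zp < p"
      "Q < Y \<longrightarrow> q < zq" "Y < Q \<longrightarrow> zq < q"
      "P < Q \<longrightarrow> p < q \<or> Q = P + 1 \<and> p = Q \<and> q = P \<and> Z < Y \<and> zp < zq"
      "Q < P \<longrightarrow> q < p \<or> P = Q + 1 \<and> p = Q \<and> q = P \<and> Y < Z \<and> zq < zp"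
      "Z < Y \<longrightarrow> zp < zq \<or> Y = Z + 1 \<and> zp = Y \<and> zq = Z \<and> P < Q \<and> p < q"
      "Y < Z \<longrightarrow> zq < zp \<or> Z = Y + 1 \<and> zp = Y \<and> zq = Z \<and> Q < P \<and> q < p"
      "P < Y \<longrightarrow> p < zq \<or> Y = P + 1 \<and> p = Y \<and> zq = P \<and> Z < Q \<and> zp < q"
      "Y < P \<longrightarrow> zq < p \<or> P = Y + 1 \<and> p = Y \<and> zq = P \<and> Q < Z \<and> q < zp"
      "Z < Q \<longrightarrow> zp < q \<or> Q = Z + 1 \<and> zp = Q \<and> q = Z \<and> P < Y \<and> p < zq"
      "Q < Z \<longrightarrow> q < zp \<or> Z = Q + 1 \<and> zp = Q \<and> q = Z \<and> Y < P \<and> zq < p"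
  shows "p < q \<and> q < zp \<longrightarrow> \<pi>Q < \<pi>Z \<or> \<pi>P < \<pi>Q"
    "p < q \<and> zp < zq \<longrightarrow> \<pi>P < \<pi>Q"
    "p < zq \<and> zp < q \<longrightarrow> \<pi>P < \<pi>Q"
  using assms
  by - (smt (verit))+

text \<open>The counterpart for a descent: reversed neighbours have partners in the opposite order,
  and the additional information that their values decrease makes up for it.\<close>

lemma conj_order_desc:
  fixes P Q Z Y p q zp zq \<pi>P \<pi>Q \<pi>Z \<pi>Y :: int
  assumes ne: "P \<noteq> Q" "P \<noteq> Y" "Z \<noteq> Q" "Z \<noteq> Y"
    and neq: "p \<noteq> q" "p \<noteq> zq" "zp \<noteq> q" "zp \<noteq> zq" "p = zp \<longleftrightarrow> P = Z" "q = zq \<longleftrightarrow> Q = Y"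
    and A: "P < Z \<Longrightarrow> \<pi>Z < \<pi>P" "Z < P \<Longrightarrow> \<pi>P < \<pi>Z" "Q < Y \<Longrightarrow> \<pi>Y < \<pi>Q" "Y < Q \<Longrightarrow> \<pi>Q < \<pi>Y"
    and X: "P = Z \<Longrightarrow> \<pi>P = \<pi>Z" "Q = Y \<Longrightarrow> \<pi>Q = \<pi>Y"
    and B: "P < Q \<and> Q < Z \<longrightarrow> \<pi>Q < \<pi>Z \<or> \<pi>P < \<pi>Q" "P < Y \<and> Y < Z \<longrightarrow> \<pi>Y < \<pi>Z \<or> \<pi>P < \<pi>Y"
      "Z < Q \<and> Q < P \<longrightarrow> \<pi>Q < \<pi>P \<or> \<pi>Z < \<pi>Q" "Z < Y \<and> Y < P \<longrightarrow> \<pi>Y < \<pi>P \<or> \<pi>Z < \<pi>Y"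
      "Q < P \<and> P < Y \<longrightarrow> \<pi>P < \<pi>Y \<or> \<pi>Q < \<pi>P" "Q < Z \<and> Z < Y \<longrightarrow> \<pi>Z < \<pi>Y \<or> \<pi>Q < \<pi>Z"
      "Y < P \<and> P < Q \<longrightarrow> \<pi>P < \<pi>Q \<or> \<pi>Y < \<pi>P" "Y < Z \<and> Z < Q \<longrightarrow> \<pi>Z < \<pi>Q \<or> \<pi>Y < \<pi>Z"
    and C: "(P < Q \<and> Z < Y) \<or> (P < Y \<and> Z < Q) \<longrightarrow> \<pi>P < \<pi>Q \<and> \<pi>P < \<pi>Y \<and> \<pi>Z < \<pi>Q \<and> \<pi>Z < \<pi>Y"
      "(Q < P \<and> Y < Z) \<or> (Q < Z \<and> Y < P) \<longrightarrow> \<pi>Q < \<pi>P \<and> \<pi>Y < \<pi>P \<and> \<pi>Q < \<pi>Z \<and> \<pi>Y < \<pi>Z"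
    and L: "P < Z \<longrightarrow> p < zp" "Z < P \<longrightarrow> zp < p"
      "Q < Y \<longrightarrow> q < zq" "Y < Q \<longrightarrow> zq < q"
      "P < Q \<longrightarrow> p < q \<or> Q = P + 1 \<and> p = Q \<and> q = P \<and> Y < Z \<and> zq < zp \<and> \<pi>Q < \<pi>P"
      "Q < P \<longrightarrow> q < p \<or> P = Q + 1 \<and> p = Q \<and> q = P \<and> Z < Y \<and> zp < zq \<and> \<pi>P < \<pi>Q"
      "Z < Y \<longrightarrow> zp < zq \<or> Y = Z + 1 \<and> zp = Y \<and> zq = Z \<and> Q < P \<and> q < p \<and> \<pi>Y < \<pi>Z"
      "Y < Z \<longrightarrow> zq < zp \<or> Z = Y + 1 \<and> zp = Y \<and> zq = Z \<and> P < Q \<and> p < q \<and> \<pi>Z < \<pi>Y"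
      "P < Y \<longrightarrow> p < zq \<or> Y = P + 1 \<and> p = Y \<and> zq = P \<and> Q < Z \<and> q < zp \<and> \<pi>Y < \<pi>P"
      "Y < P \<longrightarrow> zq < p \<or> P = Y + 1 \<and> p = Y \<and> zq = P \<and> Z < Q \<and> zp < q \<and> \<pi>P < \<pi>Y"
      "Z < Q \<longrightarrow> zp < q \<or> Q = Z + 1 \<and> zp = Q \<and> q = Z \<and> Y < P \<and> zq < p \<and> \<pi>Q < \<pi>Z"
      "Q < Z \<longrightarrow> q < zp \<or> Z = Q + 1 \<and> zp = Q \<and> q = Z \<and> P < Y \<and> p < zq \<and> \<pi>Z < \<pi>Q"
  shows "p < q \<and> q < zp \<longrightarrow> \<pi>Q < \<pi>Z \<or> \<pi>P < \<pi>Q"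
    "p < q \<and> zp < zq \<longrightarrow> \<pi>P < \<pi>Q"
    "p < zq \<and> zp < q \<longrightarrow> \<pi>P < \<pi>Q"
  using assms
  by - (smt (verit))+
end

lemma pair_ok_sym: "pair_ok x1 x2 x3 x4 x5 x6 x7 x8 \<Longrightarrow> pair_ok x5 x6 x7 x8 x1 x2 x3 x4"
  unfolding pair_ok_def by blast

text \<open>No integer lies strictly between \<open>x\<close> and \<open>x + 1\<close>, so the ends
  of another cycle compare with the joined cycle as they did with the two separate fixed
  points.\<close>

lemma pair_ok_join:
  assumes "pair_ok x x a a p q c d" "pair_ok (x + 1) (x + 1) b b p q c d" "a < b" "cycle_ok p q c d"
    "p \<noteq> x" "p \<noteq> x + 1" "q \<noteq> x" "q \<noteq> x + 1"
  shows "pair_ok x (x + 1) b a p q c d"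
  using assms unfolding pair_ok_def cycle_ok_def by (smt (verit))

lemma pair_ok_split:
  assumes "pair_ok x (x + 1) b a p q c d" "a < b" "cycle_ok p q c d"
    "p \<noteq> x" "p \<noteq> x + 1" "q \<noteq> x" "q \<noteq> x + 1" "c \<notin> {a, b}" "d \<notin> {a, b}"
  shows "pair_ok x x a a p q c d" "pair_ok (x + 1) (x + 1) b b p q c d"
  using assms unfolding pair_ok_def cycle_ok_def
  apply -
  apply (smt (verit) insert_iff)+
  done

context affine
begin

lemma I_affine: "z \<in> I \<Longrightarrow> z \<in> G" and I_invol: "z \<in> I \<Longrightarrow> z (z x) = x"
  using I_iff by auto

text \<open>A reversal by \<open>s k\<close> would require \<open>z k\<close> to be a translate of
  \<open>k\<close>, hence equal to \<open>k\<close> since \<open>z\<close> is an affine involution,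
  and \<open>z (k + 1)\<close> to be its successor.\<close>

lemma s_conj_less:
  assumes z: "z \<in> I" and lt: "z k < z (k + 1)" and nf: "\<not> (z k = k \<and> z (k + 1) = k + 1)"
  shows "s k (z k) < s k (z (k + 1))"
proof (rule ccontr)
  assume "\<not> s k (z k) < s k (z (k + 1))"
  then have A: "z (k + 1) = z k + 1" "int n dvd z k - k" using s_less[OF lt, of k] by auto
  have "z (k + (z k - k)) = z k + (z k - k)" by (rule affine_periodic[OF I_affine[OF z] A(2)])
  then have "z k = k" using I_invol[OF z] by simp
  then show False using A nf by simp
qed

lemma s_conj_greater:
  assumes z: "z \<in> I" and lt: "z (k + 1) < z k" and nf: "z k \<noteq> k + 1"
  shows "s k (z (k + 1)) < s k (z k)"
proof (rule ccontr)
  assume "\<not> s k (z (k + 1)) < s k (z k)"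
  then have A: "z k = z (k + 1) + 1" "int n dvd z (k + 1) - k" using s_less[OF lt, of k] by auto
  have "z (k + (z (k + 1) - k)) = z k + (z (k + 1) - k)" by (rule affine_periodic[OF I_affine[OF z] A(2)])
  then have "z (k + 1) = k" using I_invol[OF z, of "k + 1"] A(1) by simp
  then show False using A nf by simp
qed

lemma class_shift:
  assumes "w \<in> G" "int n dvd x - k"
  shows "w x = w k + (x - k)" "w (x + 1) = w (k + 1) + (x - k)" "s k (w x) = s k (w k) + (x - k)" "s k (w (x + 1)) = s k (w (k + 1)) + (x - k)"
proof -
  show 1: "w x = w k + (x - k)" "w (x + 1) = w (k + 1) + (x - k)"
    using affine_periodic[OF assms, of k] affine_periodic[OF assms, of "k + 1"] by (simp_all add: algebra_simps)
  show "s k (w x) = s k (w k) + (x - k)" "s k (w (x + 1)) = s k (w (k + 1)) + (x - k)"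
    unfolding 1 by (rule refl_t_periodic[OF assms(2)])+
qed

text \<open>The two alternatives in \<open>dir\<close> serve the two directions of the induction on
  atoms: the first appends a letter at an ascent of \<open>z\<close>, the second removes a letter at
  a descent of \<open>\<pi>\<close>.\<close>

lemma shape_conj_s:
  assumes sh: "shape \<pi> z" and p: "\<pi> \<in> G" and z: "z \<in> I"
    and dir: "z k < z (k + 1) \<and> \<not> (z k = k \<and> z (k + 1) = k + 1) \<or> z (k + 1) < z k \<and> z k \<noteq> k + 1 \<and> \<pi> (k + 1) < \<pi> k"
  shows "shape (\<pi> \<circ> s k) (s k \<circ> z \<circ> s k)"
  unfolding shape_def
proof (intro allI)
  fix a b
  define P Q Z Y where "P = s k a" and "Q = s k b" and "Z = z P" and "Y = z Q"
  have zG: "z \<in> G" and zz: "z (z x) = x" for x using z I_affine I_invol by auto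
  note cz = class_shift[OF zG] and cp = class_shift(1,2)[OF p]
  have sPQ: "s k P = a" "s k Q = b" using zz unfolding P_def Q_def Z_def Y_def by simp_all
  have z4: "z P = Z" "z Q = Y" "z Z = P" "z Y = Q" using zz unfolding Z_def Y_def by simp_all
  have A: "u < z u \<Longrightarrow> \<pi> (z u) < \<pi> u" and B: "u < v \<and> v < z u \<longrightarrow> \<pi> v < \<pi> (z u) \<or> \<pi> u < \<pi> v"
    and C: "u < v \<Longrightarrow> z u < z v \<Longrightarrow> \<pi> u < \<pi> v" and D: "u < z v \<Longrightarrow> z u < v \<Longrightarrow> \<pi> u < \<pi> v" for u v
    using sh unfolding shape_def shape_at_def by blast+
  have sinj: "s k u = s k v \<longleftrightarrow> u = v" for u v by (metis refl_t_invol)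
  \<comment> \<open>A pair reversed by \<open>s k\<close> is a translate of \<open>k\<close>,
    \<open>k + 1\<close>, so periodicity transfers to it everything known about the images of
    \<open>k\<close> and \<open>k + 1\<close>.\<close>
  have flip: "u < v \<longrightarrow> s k u < s k v \<or> v = u + 1 \<and> s k u = v \<and> s k v = u \<and>
     (if z k < z (k + 1) then z u < z v \<and> s k (z u) < s k (z v) else z v < z u \<and> s k (z v) < s k (z u) \<and> \<pi> v < \<pi> u \<and> z u \<noteq> v)" for u v
  proof (intro impI)
    assume "u < v"
    show "s k u < s k v \<or> v = u + 1 \<and> s k u = v \<and> s k v = u \<and>
     (if z k < z (k + 1) then z u < z v \<and> s k (z u) < s k (z v) else z v < z u \<and> s k (z v) < s k (z u) \<and> \<pi> v < \<pi> u \<and> z u \<noteq> v)"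
    proof (cases "s k u < s k v")
      case False
      then have v: "v = u + 1" "int n dvd u - k" "s k u = v" "s k v = u" using s_less[OF \<open>u < v\<close>, of k] by auto
      show ?thesis
      proof (cases "z k < z (k + 1)")
        case True
        then show ?thesis using v cz[OF v(2)] s_conj_less[OF z True] dir by auto
      next
        case False
        then show ?thesis using v cz[OF v(2)] cp[OF v(2)] s_conj_greater[OF z, of k] dir by auto
      qed
    qed simp
  qed
  have G: "shape_at (\<pi> \<circ> s k) (s k \<circ> z \<circ> s k) a b \<longleftrightarrow>
     (a < s k Z \<longrightarrow> \<pi> Z < \<pi> P) \<and>
     (a < b \<and> b < s k Z \<longrightarrow> \<pi> Q < \<pi> Z \<or> \<pi> P < \<pi> Q) \<and>
     (a < b \<and> s k Z < s k Y \<longrightarrow> \<pi> P < \<pi> Q) \<and>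
     (a < s k Y \<and> s k Z < b \<longrightarrow> \<pi> P < \<pi> Q)"
    unfolding shape_at_def P_def Q_def Z_def Y_def by simp
  have L: "P < Z \<longrightarrow> a < s k Z" "Z < P \<longrightarrow> s k Z < a" "Q < Y \<longrightarrow> b < s k Y" "Y < Q \<longrightarrow> s k Y < b"
    using flip[of P Z] flip[of Z P] flip[of Q Y] flip[of Y Q] unfolding z4 sPQ by (auto split: if_splits)
  have C1: "a < s k Z \<longrightarrow> \<pi> Z < \<pi> P"
    using L A[of P] z4 sPQ by (metis linorder_neqE_linordered_idom order_less_asym order_less_irrefl)
  show "shape_at (\<pi> \<circ> s k) (s k \<circ> z \<circ> s k) a b"
  proof (cases "P = Q \<or> P = Y")
    case True
    then have "a = b \<and> Y = Z \<or> a = s k Y \<and> b = s k Z" using sPQ z4 by metis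
    then show ?thesis unfolding G using C1 by auto
  next
    case False
    then have ne: "P \<noteq> Q" "P \<noteq> Y" "Z \<noteq> Q" "Z \<noteq> Y" using z4 by auto
    have neq: "a \<noteq> b" "a \<noteq> s k Y" "s k Z \<noteq> b" "s k Z \<noteq> s k Y" "a = s k Z \<longleftrightarrow> P = Z" "b = s k Y \<longleftrightarrow> Q = Y"
      using ne sinj sPQ by metis+
    have A': "P < Z \<Longrightarrow> \<pi> Z < \<pi> P" "Z < P \<Longrightarrow> \<pi> P < \<pi> Z" "Q < Y \<Longrightarrow> \<pi> Y < \<pi> Q" "Y < Q \<Longrightarrow> \<pi> Q < \<pi> Y"
      using A[of P] A[of Z] A[of Q] A[of Y] z4 by auto
    have X: "P = Z \<Longrightarrow> \<pi> P = \<pi> Z" "Q = Y \<Longrightarrow> \<pi> Q = \<pi> Y" by auto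
    note B' = B[of P Q, unfolded z4] B[of P Y, unfolded z4] B[of Z Q, unfolded z4] B[of Z Y, unfolded z4]
      B[of Q P, unfolded z4] B[of Q Z, unfolded z4] B[of Y P, unfolded z4] B[of Y Z, unfolded z4]
    have X4: "(u < v \<and> z u < z v) \<or> (u < z v \<and> z u < v) \<longrightarrow> \<pi> u < \<pi> v \<and> \<pi> u < \<pi> (z v) \<and> \<pi> (z u) < \<pi> v \<and> \<pi> (z u) < \<pi> (z v)" for u v
      using C[of u v] C[of u "z v"] C[of "z u" v] C[of "z u" "z v"] D[of u v] D[of u "z v"] D[of "z u" v] D[of "z u" "z v"]
      unfolding zz by auto
    have C': "(P < Q \<and> Z < Y) \<or> (P < Y \<and> Z < Q) \<longrightarrow> \<pi> P < \<pi> Q \<and> \<pi> P < \<pi> Y \<and> \<pi> Z < \<pi> Q \<and> \<pi> Z < \<pi> Y"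
      "(Q < P \<and> Y < Z) \<or> (Q < Z \<and> Y < P) \<longrightarrow> \<pi> Q < \<pi> P \<and> \<pi> Y < \<pi> P \<and> \<pi> Q < \<pi> Z \<and> \<pi> Y < \<pi> Z"
      using X4[of P Q] X4[of Q P] unfolding z4 by auto
    note F = flip[of P Q] flip[of Q P] flip[of Z Y] flip[of Y Z] flip[of P Y] flip[of Y P] flip[of Z Q] flip[of Q Z]
    show ?thesis
    proof (cases "z k < z (k + 1)")
      case True
      note F' = F[unfolded if_P[OF True] z4 sPQ]
      have f0: "P < Q \<longrightarrow> a < b \<or> Q = P + 1 \<and> a = Q \<and> b = P \<and> Z < Y \<and> s k Z < s k Y"
        using F'(1) by auto
      have f1: "Q < P \<longrightarrow> b < a \<or> P = Q + 1 \<and> a = Q \<and> b = P \<and> Y < Z \<and> s k Y < s k Z"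
        using F'(2) by auto
      have f2: "Z < Y \<longrightarrow> s k Z < s k Y \<or> Y = Z + 1 \<and> s k Z = Y \<and> s k Y = Z \<and> P < Q \<and> a < b"
        using F'(3) by auto
      have f3: "Y < Z \<longrightarrow> s k Y < s k Z \<or> Z = Y + 1 \<and> s k Z = Y \<and> s k Y = Z \<and> Q < P \<and> b < a"
        using F'(4) by auto
      have f4: "P < Y \<longrightarrow> a < s k Y \<or> Y = P + 1 \<and> a = Y \<and> s k Y = P \<and> Z < Q \<and> s k Z < b"
        using F'(5) by auto
      have f5: "Y < P \<longrightarrow> s k Y < a \<or> P = Y + 1 \<and> a = Y \<and> s k Y = P \<and> Q < Z \<and> b < s k Z"
        using F'(6) by auto
      have f6: "Z < Q \<longrightarrow> s k Z < b \<or> Q = Z + 1 \<and> s k Z = Q \<and> b = Z \<and> P < Y \<and> a < s k Y"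
        using F'(7) by auto
      have f7: "Q < Z \<longrightarrow> b < s k Z \<or> Z = Q + 1 \<and> s k Z = Q \<and> b = Z \<and> Y < P \<and> s k Y < a"
        using F'(8) by auto
      note R = conj_order_asc[OF ne neq A' X B' C' L f0 f1 f2 f3 f4 f5 f6 f7]
      show ?thesis unfolding G by (intro conjI C1 R)
    next
      case False
      note F' = F[unfolded if_not_P[OF False] z4 sPQ]
      have f0: "P < Q \<longrightarrow> a < b \<or> Q = P + 1 \<and> a = Q \<and> b = P \<and> Y < Z \<and> s k Y < s k Z \<and> \<pi> Q < \<pi> P"
        using F'(1) by auto
      have f1: "Q < P \<longrightarrow> b < a \<or> P = Q + 1 \<and> a = Q \<and> b = P \<and> Z < Y \<and> s k Z < s k Y \<and> \<pi> P < \<pi> Q"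
        using F'(2) by auto
      have f2: "Z < Y \<longrightarrow> s k Z < s k Y \<or> Y = Z + 1 \<and> s k Z = Y \<and> s k Y = Z \<and> Q < P \<and> b < a \<and> \<pi> Y < \<pi> Z"
        using F'(3) by auto
      have f3: "Y < Z \<longrightarrow> s k Y < s k Z \<or> Z = Y + 1 \<and> s k Z = Y \<and> s k Y = Z \<and> P < Q \<and> a < b \<and> \<pi> Z < \<pi> Y"
        using F'(4) by auto
      have f4: "P < Y \<longrightarrow> a < s k Y \<or> Y = P + 1 \<and> a = Y \<and> s k Y = P \<and> Q < Z \<and> b < s k Z \<and> \<pi> Y < \<pi> P"
        using F'(5) by auto
      have f5: "Y < P \<longrightarrow> s k Y < a \<or> P = Y + 1 \<and> a = Y \<and> s k Y = P \<and> Z < Q \<and> s k Z < b \<and> \<pi> P < \<pi> Y"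
        using F'(6) by auto
      have f6: "Z < Q \<longrightarrow> s k Z < b \<or> Q = Z + 1 \<and> s k Z = Q \<and> b = Z \<and> Y < P \<and> s k Y < a \<and> \<pi> Q < \<pi> Z"
        using F'(7) by auto
      have f7: "Q < Z \<longrightarrow> b < s k Z \<or> Z = Q + 1 \<and> s k Z = Q \<and> b = Z \<and> P < Y \<and> a < s k Y \<and> \<pi> Z < \<pi> Q"
        using F'(8) by auto
      note R = conj_order_desc[OF ne neq A' X B' C' L f0 f1 f2 f3 f4 f5 f6 f7]
      show ?thesis unfolding G by (intro conjI C1 R)
    qed
  qed
qed

lemma dvd_Suc_False: "int n dvd x - k \<Longrightarrow> \<not> int n dvd x + 1 - k"
  using not_dvd_one dvd_diff[of "int n" "x + 1 - k" "x - k"] by auto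

lemma shape_join:
  assumes sh: "shape \<pi> z" and p: "\<pi> \<in> G" and z: "z \<in> I" and fx: "z k = k" "z (k + 1) = k + 1"
  shows "shape (\<pi> \<circ> s k) (z \<circ> s k)"
proof -
  have zG: "z \<in> G" and zz: "z (z x) = x" for x using z I_affine I_invol by auto
  note cz = class_shift[OF zG]
  \<comment> \<open>\<open>K x\<close> marks the lower and \<open>K (x - 1)\<close> the upper point
    of a pair exchanged by \<open>s k\<close>; every other point is fixed by
    \<open>s k\<close>.\<close>
  define K where "K x \<longleftrightarrow> int n dvd x - k" for x
  have zK: "z x = x" "z (x + 1) = x + 1" if "K x" for x using cz[of x] that fx unfolding K_def by auto
  have sK: "s k x = x + 1" "s k (x + 1) = x" if "K x" for x
    using s_left[of "x - k" k] s_right[of "x - k" k] that unfolding K_def by (simp_all add: add.commute)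
  have sO: "s k x = x" if "\<not> K x" "\<not> K (x - 1)" for x
    using that refl_t_other[of n x k "k + 1"] unfolding K_def by (simp add: algebra_simps)
  have K1: "\<not> K (x + 1)" "\<not> K (x - 1)" if "K x" for x
    using that dvd_Suc_False[of x k] dvd_Suc_False[of "x - 1" k] unfolding K_def by auto
  have pK: "\<pi> x < \<pi> (x + 1)" if "K x" for x
    using sh zK[OF that] unfolding shape_def shape_at_def by (metis less_add_one)
  have zO: "\<not> K (z x) \<and> \<not> K (z x - 1)" if "\<not> K x" "\<not> K (x - 1)" for x
    using that zK zz by (metis diff_add_cancel)
  show ?thesis
  proof (rule shape_atI)
    fix x
    show "(z \<circ> s k) ((z \<circ> s k) x) = x"
    proof (cases "K x")
      case True
      then show ?thesis using sK zK by simp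
    next
      case F: False
      show ?thesis
      proof (cases "K (x - 1)")
        case True
        then show ?thesis using sK[of "x - 1"] zK[of "x - 1"] by simp
      next
        case False
        then show ?thesis using F sO zO zz by simp
      qed
    qed
    assume le: "x \<le> (z \<circ> s k) x"
    have nK: "\<not> K (x - 1)" using le sK[of "x - 1"] zK[of "x - 1"] by auto
    show "cycle_ok x ((z \<circ> s k) x) ((\<pi> \<circ> s k) x) ((\<pi> \<circ> s k) ((z \<circ> s k) x))"
    proof (cases "K x")
      case True
      then show ?thesis using sK[of x] zK[of x] pK[of x] by (simp add: cycle_ok_def)
    next
      case False
      then show ?thesis using nK sO zO shape_cycle_ok[OF sh, of x] le by simp
    qed
    fix y assume le': "y \<le> (z \<circ> s k) y" and xy: "x \<noteq> y"
    have nK': "\<not> K (y - 1)" using le' sK[of "y - 1"] zK[of "y - 1"] by auto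
    have J: "pair_ok x (x + 1) (\<pi> (x + 1)) (\<pi> x) y (z y) (\<pi> y) (\<pi> (z y))" if "K x" "\<not> K y" "\<not> K (y - 1)" "y \<le> z y" for x y
    proof (rule pair_ok_join)
      show "pair_ok x x (\<pi> x) (\<pi> x) y (z y) (\<pi> y) (\<pi> (z y))"
        using shape_pair_ok[OF sh zz, of x y] zK[OF that(1)] that by simp
      show "pair_ok (x + 1) (x + 1) (\<pi> (x + 1)) (\<pi> (x + 1)) y (z y) (\<pi> y) (\<pi> (z y))"
        using shape_pair_ok[OF sh zz, of "x + 1" y] zK[OF that(1)] that by simp
      show "\<pi> x < \<pi> (x + 1)" using pK that by simp
      show "cycle_ok y (z y) (\<pi> y) (\<pi> (z y))" using shape_cycle_ok[OF sh that(4)] .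
      show "y \<noteq> x" "y \<noteq> x + 1" "z y \<noteq> x" "z y \<noteq> x + 1" using that zO[of y] by auto
    qed
    show "pair_ok x ((z \<circ> s k) x) ((\<pi> \<circ> s k) x) ((\<pi> \<circ> s k) ((z \<circ> s k) x)) y ((z \<circ> s k) y) ((\<pi> \<circ> s k) y) ((\<pi> \<circ> s k) ((z \<circ> s k) y))"
    proof (cases "K x")
      case Kx: True
      show ?thesis
      proof (cases "K y")
        case True
        have "y \<noteq> x + 1" "x \<noteq> y + 1" using K1 Kx True by auto
        moreover have "\<pi> u < \<pi> v" if "u < v" "z u = u" "z v = v" for u v
          using sh that unfolding shape_def shape_at_def by metis
        ultimately show ?thesis using sK[OF Kx] zK[OF Kx] sK[OF True] zK[OF True] xy
          unfolding pair_ok_def by auto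
      next
        case False
        then show ?thesis using J[OF Kx False nK'] sK[OF Kx] zK[OF Kx] sO[OF False nK'] zO[OF False nK'] le' sO by simp
      qed
    next
      case nKx: False
      show ?thesis
      proof (cases "K y")
        case True
        then show ?thesis using pair_ok_sym[OF J[OF True nKx nK]] sK[OF True] zK[OF True] sO[OF nKx nK] zO[OF nKx nK] le sO by simp
      next
        case False
        then show ?thesis using shape_pair_ok[OF sh zz, of x y] sO[OF False nK'] zO[OF False nK'] sO[OF nKx nK] zO[OF nKx nK] le le' sO by simp
      qed
    qed
  qed
qed

lemma shape_split:
  assumes sh: "shape \<pi> z" and p: "\<pi> \<in> G" and z: "z \<in> I" and fx: "z k = k + 1"
  shows "shape (\<pi> \<circ> s k) (z \<circ> s k)"
proof -
  have zG: "z \<in> G" and zz: "z (z x) = x" for x using z I_affine I_invol by auto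
  have fx': "z (k + 1) = k" using zz[of k] fx by simp
  note cz = class_shift[OF zG]
  define K where "K x \<longleftrightarrow> int n dvd x - k" for x
  have zK: "z x = x + 1" "z (x + 1) = x" if "K x" for x using cz[of x] that fx fx' unfolding K_def by auto
  have sK: "s k x = x + 1" "s k (x + 1) = x" if "K x" for x
    using s_left[of "x - k" k] s_right[of "x - k" k] that unfolding K_def by (simp_all add: add.commute)
  have sO: "s k x = x" if "\<not> K x" "\<not> K (x - 1)" for x
    using that refl_t_other[of n x k "k + 1"] unfolding K_def by (simp add: algebra_simps)
  have pK: "\<pi> (x + 1) < \<pi> x" if "K x" for x
    using sh zK[OF that] unfolding shape_def shape_at_def by (metis less_add_one)
  have zO: "\<not> K (z x) \<and> \<not> K (z x - 1)" if "\<not> K x" "\<not> K (x - 1)" for x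
  proof (intro conjI notI)
    assume k: "K (z x)"
    then have "z x = x - 1" using zK(1)[of "z x"] zz[of x] by simp
    then show False using k that by simp
  next
    assume k: "K (z x - 1)"
    then have "z x - 1 = x" using zK(2)[of "z x - 1"] zz[of x] by simp
    then show False using k that by simp
  qed
  have inj: "\<pi> u = \<pi> v \<longleftrightarrow> u = v" for u v using affine_inj[OF p] by (simp add: inj_eq)
  define w where "w = z \<circ> s k"
  define \<rho> where "\<rho> = \<pi> \<circ> s k"
  have wK: "w x = x" "w (x + 1) = x + 1" "\<rho> x = \<pi> (x + 1)" "\<rho> (x + 1) = \<pi> x" if "K x" for x
    using sK[OF that] zK[OF that] unfolding w_def \<rho>_def by auto
  have wO: "w x = z x" "\<rho> x = \<pi> x" "\<rho> (z x) = \<pi> (z x)" if "\<not> K x" "\<not> K (x - 1)" for x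
    using sO zO that unfolding w_def \<rho>_def by auto
  have J: "pair_ok x x (\<rho> x) (\<rho> x) y (z y) (\<pi> y) (\<pi> (z y))"
     "pair_ok (x + 1) (x + 1) (\<rho> (x + 1)) (\<rho> (x + 1)) y (z y) (\<pi> y) (\<pi> (z y))"
    if "K x" "y \<le> z y" "x \<noteq> y" for x y
  proof -
    have "pair_ok x (x + 1) (\<pi> x) (\<pi> (x + 1)) y (z y) (\<pi> y) (\<pi> (z y))"
      using shape_pair_ok[OF sh zz, of x y] zK[OF that(1)] that by simp
    moreover have "\<pi> (x + 1) < \<pi> x" using pK that by simp
    moreover have "cycle_ok y (z y) (\<pi> y) (\<pi> (z y))" using shape_cycle_ok[OF sh that(2)] .
    moreover have ne: "y \<noteq> x" "y \<noteq> x + 1" "z y \<noteq> x" "z y \<noteq> x + 1" using that zK[OF that(1)] zz by (auto, metis+)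
    moreover have "\<pi> y \<notin> {\<pi> (x + 1), \<pi> x}" "\<pi> (z y) \<notin> {\<pi> (x + 1), \<pi> x}" using inj ne by auto
    ultimately show "pair_ok x x (\<rho> x) (\<rho> x) y (z y) (\<pi> y) (\<pi> (z y))"
     "pair_ok (x + 1) (x + 1) (\<rho> (x + 1)) (\<rho> (x + 1)) y (z y) (\<pi> y) (\<pi> (z y))"
      unfolding wK[OF that(1)] by (rule pair_ok_split)+
  qed
  \<comment> \<open>The new fixed points have to carry increasing values. For exchanged pairs with
    lower points x < y the old values satisfy \<pi>(x + 1) < \<pi>(x) < \<pi>(y + 1) < \<pi>(y); the
    middle inequality is condition (4), and the exchange within each pair turns the outer ones
    around.\<close>
  have F: "\<rho> u < \<rho> v" if "u < v" "K u \<or> K (u - 1)" "K v \<or> K (v - 1)" for u v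
  proof -
    define x y where "x = (if K u then u else u - 1)" and "y = (if K v then v else v - 1)"
    have x: "K x" "u = x \<or> u = x + 1" and y: "K y" "v = y \<or> v = y + 1" using that unfolding x_def y_def by auto
    show ?thesis
    proof (cases "x = y")
      case True
      then show ?thesis using x y that(1) pK[OF x(1)] wK[OF x(1)] by auto
    next
      case False
      have "x < y"
      proof (rule ccontr)
        assume "\<not> x < y"
        then have "x = y + 1" "x = u" "u = y + 1" using False x(2) y(2) that(1) by auto
        then show False using dvd_Suc_False[of y k] x(1) y(1) unfolding K_def by auto
      qed
      then have "\<pi> a < \<pi> b" if "a \<in> {x, x + 1}" "b \<in> {y, y + 1}" for a b
      proof -
        have "\<pi> x < \<pi> (z y)" using sh zK[OF x(1)] zK[OF y(1)] \<open>x < y\<close>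
          unfolding shape_def shape_at_def by (metis zz add_strict_right_mono less_add_one order_less_trans)
        moreover have "\<pi> (x + 1) < \<pi> x" "\<pi> (y + 1) < \<pi> y" using pK x y by auto
        ultimately show ?thesis using that zK[OF y(1)] by auto
      qed
      then show ?thesis using x y wK[OF x(1)] wK[OF y(1)] by auto
    qed
  qed
  have "shape \<rho> w"
  proof (rule shape_atI)
    fix x
    show "w (w x) = x"
      using wK[of x] wK[of "x - 1"] wO[of x] zO[of x] wO[of "z x"] zz by (cases "K x"; cases "K (x - 1)") auto
    assume le: "x \<le> w x"
    show "cycle_ok x (w x) (\<rho> x) (\<rho> (w x))"
      using wK[of x] wK[of "x - 1"] wO[of x] shape_cycle_ok[OF sh, of x] le
      by (cases "K x"; cases "K (x - 1)") (auto simp: cycle_ok_def)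
    fix y assume le': "y \<le> w y" and xy: "x \<noteq> y"
    have one: "pair_ok u (w u) (\<rho> u) (\<rho> (w u)) v (w v) (\<rho> v) (\<rho> (w v))"
      if u: "K u \<or> K (u - 1)" and v: "\<not> K v" "\<not> K (v - 1)" "v \<le> w v" for u v
    proof -
      have vz: "v \<le> z v" using wO[OF v(1,2)] v(3) by simp
      show ?thesis
      proof (cases "K u")
        case True
        then show ?thesis using J(1)[OF True vz] wK[OF True] wO[OF v(1,2)] v by auto
      next
        case False
        then have "K (u - 1)" using u by simp
        then show ?thesis using J(2)[OF \<open>K (u - 1)\<close> vz] wK[OF \<open>K (u - 1)\<close>] wO[OF v(1,2)] v by auto
      qed
    qed
    show "pair_ok x (w x) (\<rho> x) (\<rho> (w x)) y (w y) (\<rho> y) (\<rho> (w y))"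
    proof (cases "K x \<or> K (x - 1)")
      case x: True
      show ?thesis
      proof (cases "K y \<or> K (y - 1)")
        case True
        have "w x = x" "w y = y" using wK[of x] wK[of "x - 1"] wK[of y] wK[of "y - 1"] x True by auto
        then show ?thesis using F[of x y] F[of y x] x True xy unfolding pair_ok_def by auto
      next
        case False
        then show ?thesis using one x le' by blast
      qed
    next
      case x: False
      show ?thesis
      proof (cases "K y \<or> K (y - 1)")
        case True
        then show ?thesis using pair_ok_sym one x le by blast
      next
        case False
        then show ?thesis using shape_pair_ok[OF sh zz, of x y] wO x le le' by auto
      qed
    qed
  qed
  then show ?thesis unfolding w_def \<rho>_def .
qed

end

lemma refl_t_commute: "refl_t n i j = refl_t n j i"
proof (cases "[i = j] (mod int n)")
  case True
  then show ?thesis using refl_t_nocong[OF True] refl_t_nocong[of j i n] cong_sym by metis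
next
  case False
  then have F: "\<not> [j = i] (mod int n)" using cong_sym by blast
  show ?thesis
  proof
    fix x show "refl_t n i j x = refl_t n j i x"
      by (cases x rule: refl_t_cases[OF False]) (use refl_t_left[OF F] refl_t_right[OF F] refl_t_other[of n x j i] in auto)
  qed
qed

section \<open>Height of an involution and length of its atoms\<close>

context affine
begin

text \<open>\<open>height z\<close> will turn out to be four times the length of the atoms of \<open>z\<close>.\<close>

definition moved :: "(int \<Rightarrow> int) \<Rightarrow> nat" where
  "moved z = (\<Sum>x = 1..int n. if z x = x then 0 else 1)"

definition height :: "(int \<Rightarrow> int) \<Rightarrow> nat" where
  "height z = 2 * len n z + moved z"

lemma moved_conj:
  assumes z: "z \<in> G" shows "moved (s k \<circ> z \<circ> s k) = moved z"
proof -
  have "moved (s k \<circ> z \<circ> s k) = (\<Sum>x = 1..int n. if z (s k x) = s k x then 0 else 1)"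
    unfolding moved_def by (rule sum.cong) (simp_all, metis refl_t_invol)
  also have "\<dots> = (\<Sum>x = 1..int n. if z x = x then 0 else 1)"
    by (rule periodic_sum[where f = "\<lambda>x. if z x = x then 0 else 1 :: nat"])
      (auto simp: affine_periodic[OF z] refl_t_periodic bij_is_inj)
  finally show ?thesis unfolding moved_def .
qed

lemma conj_act_I:
  assumes z: "z \<in> I" shows "conj_act k z \<in> I"
proof -
  have zz: "z (z x) = x" for x using z I_invol by auto
  have zG: "z \<in> G" using z I_affine by auto
  have "conj_act k z (conj_act k z x) = x" for x
  proof (cases "z k < z (k + 1) \<and> z k = k \<and> z (k + 1) = k + 1")
    case True
    then have e: "conj_act k z = z \<circ> s k" unfolding conj_act_def by simp
    have "z \<circ> s k = s k \<circ> z" using refl_t_conj[OF zG, of k "k + 1"] True by simp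
    then have "z (s k x) = s k (z x)" for x by (simp add: fun_eq_iff)
    then show ?thesis unfolding e using zz by simp
  next
    case False
    then show ?thesis using zz unfolding conj_act_def by auto
  qed
  moreover have "conj_act k z \<in> G" using zG unfolding conj_act_def by (auto simp: affine_comp)
  ultimately show ?thesis unfolding I_iff by blast
qed

lemma conj_act_asc:
  assumes "z k < z (k + 1)" "\<not> (z k = k \<and> z (k + 1) = k + 1)"
  shows "conj_act k z = s k \<circ> z \<circ> s k"
  unfolding conj_act_def using assms by (simp only: if_True if_False simp_thms)

lemma conj_act_fix:
  assumes "z k = k" "z (k + 1) = k + 1"
  shows "conj_act k z = z \<circ> s k"
  unfolding conj_act_def using assms by simp

lemma conj_act_desc:
  assumes z: "z \<in> I" shows "conj_act k z (k + 1) < conj_act k z k"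
proof (cases "z k < z (k + 1)")
  case False
  then show ?thesis using asc_or_desc[OF I_affine[OF z], of k] unfolding conj_act_def by auto
next
  case True
  then show ?thesis
    using s_conj_less[OF z True] conj_act_fix[of z k] conj_act_asc[of z k] by (cases "z k = k \<and> z (k + 1) = k + 1") auto
qed

lemma conj_act_idle: "\<not> z k < z (k + 1) \<Longrightarrow> conj_act k z = z"
  unfolding conj_act_def by simp

text \<open>Joining two fixed points adds 1 to the length and 2 to the number of moved residues; a
  proper conjugation adds 2 to the length and keeps the number of moved residues. Weighting the
  length by 2 makes both increments equal to 4.\<close>

lemma height_conj_act:
  assumes z: "z \<in> I" and asc: "z k < z (k + 1)"
  shows "height (conj_act k z) = height z + 4"
proof (cases "z k = k \<and> z (k + 1) = k + 1")
  case True
  note cz = class_shift(1,2)[OF I_affine[OF z]]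
  have zK: "z x = x" "z (x + 1) = x + 1" if "int n dvd x - k" for x using cz[OF that] True by auto
  have "(if (z \<circ> s k) x = x then 0 else 1 :: nat) = (if z x = x then 0 else 1)
      + ((if int n dvd x - k then 1 else 0) + (if int n dvd x - (k + 1) then 1 else 0))" for x
  proof (cases rule: s_cases[of x k])
    case (left m)
    then have "int n dvd x - k" "s k x = x + 1" by simp_all
    moreover have "\<not> int n dvd x - (k + 1)" using dvd_Suc_False[of "x - 1" k] \<open>int n dvd x - k\<close> by (auto simp: algebra_simps)
    ultimately show ?thesis using zK[of x] by simp
  next
    case (right m)
    then have d: "int n dvd x - (k + 1)" "s k x = x - 1" by simp_all
    then have d': "int n dvd (x - 1) - k" by (simp add: algebra_simps)
    moreover have "\<not> int n dvd x - k" using dvd_Suc_False[OF d'] by simp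
    ultimately show ?thesis using zK[OF d'] d by simp
  next
    case other
    then show ?thesis by simp
  qed
  then have "moved (z \<circ> s k) = moved z + ((\<Sum>x = 1..int n. (if int n dvd x - k then 1 else 0)) + (\<Sum>x = 1..int n. if int n dvd x - (k + 1) then 1 else 0))"
    unfolding moved_def by (simp only: sum.distrib)
  then have "moved (z \<circ> s k) = moved z + 2" unfolding sum_single_class by simp
  then show ?thesis using conj_act_fix[of z k] True len_asc[OF I_affine[OF z] asc] unfolding height_def by simp
next
  case False
  have zG: "z \<in> G" using I_affine[OF z] .
  have iz: "inv z = z" using I_invol[OF z] by (intro inv_equality) auto
  have c: "conj_act k z = s k \<circ> (z \<circ> s k)" using conj_act_asc[OF asc False] by (simp add: comp_assoc)
  have "inv (z \<circ> s k) = s k \<circ> z" using inv_s_comp(1)[OF zG] iz by simp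
  then have "inv (z \<circ> s k) k < inv (z \<circ> s k) (k + 1)" using s_conj_less[OF z asc False] by simp
  then have "len n (conj_act k z) = len n (z \<circ> s k) + 1" unfolding c using zG by (intro len_left_asc) simp_all
  also have "\<dots> = len n z + 2" using len_asc[OF zG asc] by simp
  finally show ?thesis using moved_conj[OF zG, of k] conj_act_asc[OF asc False] unfolding height_def by simp
qed

lemma height_conj_act_le: "z \<in> I \<Longrightarrow> height (conj_act k z) \<le> height z + 4"
  using height_conj_act[of z k] conj_act_idle[of z k] by (cases "z k < z (k + 1)") simp_all

definition hecke :: "(int \<Rightarrow> int) \<Rightarrow> int \<Rightarrow> int" where
  "hecke \<pi> = demazure n (inv \<pi>) \<pi>"

lemma affine_induct [consumes 1, case_names id asc]:
  assumes "w \<in> G" and "P id" and step: "\<And>w k. w \<in> G \<Longrightarrow> w k < w (k + 1) \<Longrightarrow> P w \<Longrightarrow> P (w \<circ> s k)"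
  shows "P w"
  using assms(1)
proof (induction "len n w" arbitrary: w)
  case 0
  then have "inversions w = 0" using len_eq_inversions by simp
  then have "w k < w (k + 1)" for k using asc_or_desc[OF 0(2), of k] inversions_desc[OF 0(2), of k] by auto
  then have "w = id" using no_descent_id 0 by blast
  then show "P w" using assms(2) by simp
next
  case (Suc q)
  then have "w \<noteq> id" by auto
  then obtain k where k: "\<not> w k < w (k + 1)" using no_descent_id[OF Suc(3)] by blast
  then have d: "w (k + 1) < w k" using asc_or_desc[OF Suc(3)] by blast
  define v where "v = w \<circ> s k"
  have v: "v \<in> G" "v \<circ> s k = w" "v k < v (k + 1)" using Suc(3) d unfolding v_def by auto
  have "q = len n v" using Suc(2) len_desc[OF Suc(3) d] unfolding v_def by simp
  then have "P v" using Suc(1) v(1) by blast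
  then have "P (v \<circ> s k)" using step v by blast
  then show "P w" using v(2) by simp
qed

text \<open>Each letter appended at an ascent either raises the height of the involution by 4 or
  leaves the involution unchanged. The resulting inequality is the lower bound on length that atoms
  attain.\<close>

lemma hecke_I_height: "\<pi> \<in> G \<Longrightarrow> hecke \<pi> \<in> I \<and> height (hecke \<pi>) \<le> 4 * len n \<pi>"
proof (induction rule: affine_induct)
  case id
  have "id \<in> I" unfolding I_iff by simp
  moreover have "height id = 0" unfolding height_def moved_def by simp
  ultimately show "hecke id \<in> I \<and> height (hecke id) \<le> 4 * len n id" unfolding hecke_def demazure_inv_id by simp
next
  case (asc w k)
  have c: "hecke (w \<circ> s k) = conj_act k (hecke w)"
    using demazure_inv_comp[OF asc(1) _ _ asc(2)] asc(3) unfolding hecke_def by blast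
  show "hecke (w \<circ> s k) \<in> I \<and> height (hecke (w \<circ> s k)) \<le> 4 * len n (w \<circ> s k)"
    unfolding c using conj_act_I asc(3) height_conj_act_le[of "hecke w" k] len_asc[OF asc(1,2)] by auto
qed

lemma hecke_asc:
  assumes "w \<in> G" "w k < w (k + 1)" shows "hecke (w \<circ> s k) = conj_act k (hecke w)"
  using demazure_inv_comp[OF assms(1) _ _ assms(2)] hecke_I_height[OF assms(1)] unfolding hecke_def by blast

lemma hecke_desc:
  assumes w: "w \<in> G" and d: "w (k + 1) < w k"
  shows "hecke w = conj_act k (hecke (w \<circ> s k))" "hecke w (k + 1) < hecke w k"
proof -
  show c: "hecke w = conj_act k (hecke (w \<circ> s k))" using hecke_asc[of "w \<circ> s k" k] w d by simp
  show "hecke w (k + 1) < hecke w k" unfolding c using conj_act_desc hecke_I_height[of "w \<circ> s k"] w by simp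
qed

text \<open>The bound is attained by leaving out the letters that do not change the
  involution.\<close>

lemma exists_strict:
  "\<pi> \<in> G \<Longrightarrow> \<exists>\<rho>\<in>G. hecke \<rho> = hecke \<pi> \<and> 4 * len n \<rho> = height (hecke \<pi>)"
proof (induction rule: affine_induct)
  case id
  have "height id = 0" unfolding height_def moved_def by simp
  then have "4 * len n id = height (hecke id)" unfolding hecke_def demazure_inv_id by simp
  then show "\<exists>\<rho>\<in>G. hecke \<rho> = hecke id \<and> 4 * len n \<rho> = height (hecke id)" using affine_id by blast
next
  case (asc w k)
  obtain \<rho> where r: "\<rho> \<in> G" "hecke \<rho> = hecke w" "4 * len n \<rho> = height (hecke w)" using asc(3) by blast
  have zI: "hecke w \<in> I" using hecke_I_height[OF asc(1)] by blast
  show "\<exists>\<rho>\<in>G. hecke \<rho> = hecke (w \<circ> s k) \<and> 4 * len n \<rho> = height (hecke (w \<circ> s k))"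
  proof (cases "hecke w k < hecke w (k + 1)")
    case False
    then show ?thesis using r hecke_asc[OF asc(1,2)] conj_act_idle[OF False] by auto
  next
    case True
    \<comment> \<open>A descent of \<open>\<rho>\<close> would also be a descent of its involution,
      by \<open>hecke_desc\<close>.\<close>
    then have "\<rho> k < \<rho> (k + 1)" using hecke_desc(2)[OF r(1), of k] asc_or_desc[OF r(1), of k] r(2) by auto
    then have "hecke (\<rho> \<circ> s k) = hecke (w \<circ> s k)" "4 * len n (\<rho> \<circ> s k) = height (hecke (w \<circ> s k))"
      using hecke_asc[OF asc(1,2)] hecke_asc[OF r(1), of k] r height_conj_act[OF zI True] len_asc[OF r(1), of k] by auto
    then show ?thesis using r(1) comp_s_affine(1) by blast
  qed
qed

text \<open>Since the height bound holds for every element and is attained, minimality of the length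
  means equality in it.\<close>

lemma atoms_iff_height: "\<pi> \<in> atoms n z \<longleftrightarrow> \<pi> \<in> G \<and> hecke \<pi> = z \<and> 4 * len n \<pi> = height z"
proof
  assume "\<pi> \<in> atoms n z"
  then have p: "\<pi> \<in> G" "hecke \<pi> = z" and m: "\<And>\<sigma>. \<sigma> \<in> G \<Longrightarrow> hecke \<sigma> = z \<Longrightarrow> len n \<pi> \<le> len n \<sigma>"
    unfolding atoms_def hecke_def by auto
  obtain \<rho> where r: "\<rho> \<in> G" "hecke \<rho> = hecke \<pi>" "4 * len n \<rho> = height (hecke \<pi>)" using exists_strict[OF p(1)] by blast
  then show "\<pi> \<in> G \<and> hecke \<pi> = z \<and> 4 * len n \<pi> = height z" using p m[of \<rho>] hecke_I_height[OF p(1)] by simp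
next
  assume p: "\<pi> \<in> G \<and> hecke \<pi> = z \<and> 4 * len n \<pi> = height z"
  have "len n \<pi> \<le> len n \<sigma>" if "\<sigma> \<in> G" "hecke \<sigma> = z" for \<sigma> using hecke_I_height[OF that(1)] that p by simp
  then show "\<pi> \<in> atoms n z" using p unfolding atoms_def hecke_def by auto
qed

text \<open>Equality in the height bound leaves no room for an idle letter. Removing the last letter
  hence lowers the height by exactly 4, and equality is preserved.\<close>

lemma atom_desc:
  assumes a: "\<pi> \<in> atoms n z" and d: "\<pi> (k + 1) < \<pi> k"
  shows "\<exists>y\<in>I. y k < y (k + 1) \<and> conj_act k y = z \<and> \<pi> \<circ> s k \<in> atoms n y"
proof -
  have p: "\<pi> \<in> G" "hecke \<pi> = z" "4 * len n \<pi> = height z" using a atoms_iff_height by auto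
  have pG: "\<pi> \<circ> s k \<in> G" using p by simp
  define y where "y = hecke (\<pi> \<circ> s k)"
  have y: "y \<in> I" "height y \<le> 4 * len n (\<pi> \<circ> s k)" using hecke_I_height[OF pG] unfolding y_def by auto
  have c: "z = conj_act k y" using hecke_desc(1)[OF p(1) d] p unfolding y_def by simp
  have l: "len n \<pi> = len n (\<pi> \<circ> s k) + 1" by (rule len_desc[OF p(1) d])
  have asc: "y k < y (k + 1)"
  proof (rule ccontr)
    assume "\<not> y k < y (k + 1)"
    then show False using conj_act_idle[of y k] c y p(3) l by simp
  qed
  have "height z = height y + 4" using height_conj_act[OF y(1) asc] c by simp
  then have "4 * len n (\<pi> \<circ> s k) = height y" using l p(3) by simp
  then show ?thesis using y(1) asc c pG unfolding atoms_iff_height y_def by blast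
qed

lemma atom_asc:
  assumes a: "\<pi> \<in> atoms n y" and y: "y k < y (k + 1)" and p: "\<pi> k < \<pi> (k + 1)"
  shows "\<pi> \<circ> s k \<in> atoms n (conj_act k y)"
proof -
  have p': "\<pi> \<in> G" "hecke \<pi> = y" "4 * len n \<pi> = height y" using a atoms_iff_height by auto
  then have yI: "y \<in> I" using hecke_I_height by blast
  show ?thesis unfolding atoms_iff_height using p' hecke_asc[OF p'(1) p] len_asc[OF p'(1) p] height_conj_act[OF yI y] by simp
qed

section \<open>Atoms are the elements that satisfy the local conditions\<close>

lemma shape_asc: "shape \<pi> z \<Longrightarrow> z k < z (k + 1) \<Longrightarrow> \<pi> k < \<pi> (k + 1)"
  unfolding shape_def shape_at_def by simp

lemma shape_up:
  assumes "shape \<pi> z" "\<pi> \<in> G" "z \<in> I" "z k < z (k + 1)"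
  shows "shape (\<pi> \<circ> s k) (conj_act k z)"
proof (cases "z k = k \<and> z (k + 1) = k + 1")
  case True
  then show ?thesis using shape_join[OF assms(1-3)] conj_act_fix[of z k] by auto
next
  case False
  then show ?thesis using shape_conj_s[OF assms(1-3)] conj_act_asc[OF assms(4) False] assms(4) by auto
qed

text \<open>Undoes \<open>shape_up\<close>. A descent of \<open>\<pi>\<close> is a descent of
  \<open>z\<close>, by condition (3) for neighbours; the letter then either splits the cycle on
  \<open>k\<close>, \<open>k + 1\<close> or conjugates \<open>z\<close> back.\<close>

lemma shape_down:
  assumes sh: "shape \<pi> z" and p: "\<pi> \<in> G" and z: "z \<in> I" and d: "\<pi> (k + 1) < \<pi> k"
  shows "\<exists>y\<in>I. y k < y (k + 1) \<and> conj_act k y = z \<and> shape (\<pi> \<circ> s k) y"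
proof -
  have zd: "z (k + 1) < z k" using shape_asc[OF sh, of k] d asc_or_desc[OF I_affine[OF z], of k] by auto
  have zz: "z (z x) = x" for x using I_invol[OF z] .
  show ?thesis
  proof (cases "z k = k + 1")
    case True
    then have k1: "z (k + 1) = k" using zz[of k] by simp
    have "z \<circ> s k = s k \<circ> z" using refl_t_conj[OF I_affine[OF z], of k "k + 1"] True k1
      refl_t_commute[of n "k + 1" k] by simp
    then have "(z \<circ> s k) ((z \<circ> s k) x) = x" for x using zz by (metis comp_apply refl_t_invol)
    then have "z \<circ> s k \<in> I" unfolding I_iff using I_affine[OF z] by simp
    moreover have "(z \<circ> s k) k < (z \<circ> s k) (k + 1)" using True k1 by simp
    moreover have "conj_act k (z \<circ> s k) = z" using conj_act_fix[of "z \<circ> s k" k] True k1 by simp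
    ultimately show ?thesis using shape_split[OF sh p z True] by blast
  next
    case False
    define y where "y = s k \<circ> z \<circ> s k"
    have "y \<in> I" unfolding I_iff y_def using zz I_affine[OF z] by (simp add: affine_comp)
    moreover have asc: "y k < y (k + 1)" unfolding y_def using s_conj_greater[OF z zd False] by simp
    moreover have nf: "\<not> (y k = k \<and> y (k + 1) = k + 1)"
    proof
      assume "y k = k \<and> y (k + 1) = k + 1"
      then have "s k (z (k + 1)) = k" "s k (z k) = k + 1" unfolding y_def by auto
      then have "z (k + 1) = s k k" "z k = s k (k + 1)" by (metis refl_t_invol)+
      then show False using zd by simp
    qed
    moreover have "conj_act k y = z" unfolding conj_act_asc[OF asc nf] unfolding y_def by (auto simp: fun_eq_iff)
    ultimately show ?thesis using shape_conj_s[OF sh p z] zd False d unfolding y_def by blast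
  qed
qed

lemma I_less_id:
  assumes "z \<in> I" "\<And>x. z x \<le> x" shows "z = id"
proof
  fix x show "z x = id x" using assms(2)[of x] assms(2)[of "z x"] I_invol[OF assms(1)] by simp
qed

lemma shape_atom: "\<pi> \<in> G \<Longrightarrow> \<forall>z\<in>I. shape \<pi> z \<longrightarrow> \<pi> \<in> atoms n z"
proof (induction rule: affine_induct)
  case id
  have "hecke id = id" unfolding hecke_def by (rule demazure_inv_id)
  moreover have "height id = 0" unfolding height_def moved_def by simp
  ultimately have "id \<in> atoms n id" unfolding atoms_iff_height by simp
  \<comment> \<open>For the identity, condition (1) fails at every \<open>p\<close> with
    \<open>p < z p\<close>.\<close>
  moreover have "z = id" if "z \<in> I" "shape id z" for z
    using that unfolding shape_def shape_at_def by (intro I_less_id) (simp_all, metis not_less order_less_asym)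
  ultimately show ?case by blast
next
  case (asc w k)
  show ?case
  proof (intro ballI impI)
    fix z assume z: "z \<in> I" "shape (w \<circ> s k) z"
    have "(w \<circ> s k) (k + 1) < (w \<circ> s k) k" using asc(2) by simp
    then obtain y where y: "y \<in> I" "y k < y (k + 1)" "conj_act k y = z" "shape (w \<circ> s k \<circ> s k) y"
      using shape_down[OF z(2) _ z(1)] asc(1) by force
    then have "w \<in> atoms n y" using asc(3) by simp
    then show "w \<circ> s k \<in> atoms n z" using atom_asc[OF _ y(2) asc(2)] y(3) by simp
  qed
qed

lemma atom_shape: "\<pi> \<in> G \<Longrightarrow> \<forall>z. \<pi> \<in> atoms n z \<longrightarrow> shape \<pi> z"
proof (induction rule: affine_induct)
  case id
  have "hecke id = id" unfolding hecke_def by (rule demazure_inv_id)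
  moreover have "shape id id" unfolding shape_def shape_at_def by auto
  ultimately show "\<forall>z. id \<in> atoms n z \<longrightarrow> shape id z" unfolding atoms_iff_height by metis
next
  case (asc w k)
  show ?case
  proof (intro allI impI)
    fix z assume a: "w \<circ> s k \<in> atoms n z"
    have "(w \<circ> s k) (k + 1) < (w \<circ> s k) k" using asc(2) by simp
    from atom_desc[OF a this] obtain y where y: "y \<in> I" "y k < y (k + 1)" "conj_act k y = z" "w \<circ> s k \<circ> s k \<in> atoms n y"
      by blast
    then have "w \<in> atoms n y" by (simp only: comp_refl_t_comp_refl_t)
    then show "shape (w \<circ> s k) z" using shape_up[of w y k] asc y by blast
  qed
qed

lemma atoms_iff_shape: "z \<in> I \<Longrightarrow> \<pi> \<in> atoms n z \<longleftrightarrow> \<pi> \<in> G \<and> shape \<pi> z"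
  using shape_atom atom_shape atoms_iff_height by blast

end

section \<open>Exchanging values periodically\<close>

text \<open>Here \<open>u\<close> and \<open>v\<close> stand for \<open>y i\<close> and
  \<open>y j\<close>. The left side lists the branches of \<open>tau\<close> with all reflections
  evaluated on the four points, the right side is \<open>swap_inv\<close> in terms of the sorted
  ends. \<open>Z\<close> stands for the branch that leaves \<open>y\<close> unchanged, which the
  hypotheses make unreachable.\<close>

lemma tau_order_cases:
  fixes i j u v x a b c d :: int
  assumes lt: "min i u < min j v" "max i u < max j v" and ne: "i \<noteq> j" "u \<noteq> v" "i \<noteq> v" "u \<noteq> j" and ij: "i < j"
    and x: "x = i \<or> x = j \<or> x = u \<or> x = v" and abcd: "a = min i u" "b = max i u" "c = min j v" "d = max j v"
  shows "(if (u < i \<and> i < j \<and> j < v) \<or> (i < j \<and> j < u \<and> u < v) \<or> (u < v \<and> v < i \<and> i < j)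
     then (if x = i then (if v = j then i else v) else if x = j then (if u = i then j else u) else if x = u then j else i)
     else if i < v \<and> v < u \<and> u < j
     then (if x = i then (if v = j then i else j) else if x = v then (if u = i then v else u) else if x = j then i else v)
     else if (i = u \<and> u < j \<and> j = v) \<or> (i = u \<and> u < v \<and> v < j)
        \<or> (i < u \<and> u < j \<and> j = v) \<or> (i < u \<and> u < v \<and> v < j)
     then (if x = i then j else if x = j then i else x)
     else if (i = u \<and> u < j \<and> j < v) \<or> (i < u \<and> u < j \<and> j < v)
     then (if x = i then v else if x = v then i else x)
     else if (u < i \<and> i < j \<and> j = v) \<or> (u < i \<and> i < v \<and> v < j)
     then (if x = u then j else if x = j then u else x)
     else Z) =
   (if c < b then (if x = c then b else if x = b then c else if x = d then a else d)
     else if i = b \<and> a < b \<and> j = c \<and> c < d then (if x = d then b else if x = b then d else if x = c then a else c)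
     else (if x = d then a else if x = a then d else x))"
  using x
  by (elim disjE; cases u i rule: linorder_cases; cases v j rule: linorder_cases; insert lt ne ij; simp add: abcd min_def max_def split: if_splits)

text \<open>Ends of a fixed point coincide, so the tests have to follow the function updates from
  the last one to the first.\<close>

lemma swap_inv_apply:
  assumes "x \<in> {a, b, c, d}"
  shows "swap_inv a b c d i j y x =
    (if c < b then (if x = c then b else if x = b then c else if x = d then a else d)
     else if i = b \<and> a < b \<and> j = c \<and> c < d then (if x = d then b else if x = b then d else if x = c then a else c)
     else (if x = d then a else if x = a then d else x))"
proof -
  consider "x = d" | "x \<noteq> d" "x = c" | "x \<noteq> d" "x \<noteq> c" "x = b" | "x \<noteq> d" "x \<noteq> c" "x \<noteq> b" "x = a" using assms by blast
  then show ?thesis by cases (simp_all add: swap_inv_def)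
qed

lemma swap_inv_on:
  "x \<in> {a, b, c, d} \<Longrightarrow> swap_inv a b c d i j y x = swap_inv a b c d i j y' x"
  by (simp only: swap_inv_apply)

lemma swap_inv_off:
  "x \<notin> {a, b, c, d} \<Longrightarrow> swap_inv a b c d i j y x = y x"
  unfolding swap_inv_def by simp

lemma swap_inv_in:
  assumes "x \<in> {a, b, c, d}" shows "swap_inv a b c d i j y x \<in> {a, b, c, d}"
proof -
  consider "x = d" | "x \<noteq> d" "x = c" | "x \<noteq> d" "x \<noteq> c" "x = b" | "x \<noteq> d" "x \<noteq> c" "x \<noteq> b" "x = a" using assms by blast
  then show ?thesis by cases (simp_all add: swap_inv_def)
qed

lemma swap_inv_shift:
  assumes "x \<in> {a, b, c, d}"
  shows "swap_inv (a + m) (b + m) (c + m) (d + m) (i + m) (j + m) y (x + m) = swap_inv a b c d i j y x + m"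
proof -
  have xm: "x + m \<in> {a + m, b + m, c + m, d + m}" using assms by auto
  show ?thesis unfolding swap_inv_apply[OF assms] swap_inv_apply[OF xm] by simp
qed

lemma tau_idle: "i < j \<Longrightarrow> \<not> cycle_less y i j \<Longrightarrow> tau n i j y = y"
  unfolding cycle_less_def tau_def min_def max_def by (auto split: if_splits)

context affine
begin

lemma min_max_shift:
  assumes "y \<in> G" "int n dvd m"
  shows "min (i + m) (y (i + m)) = min i (y i) + m" "max (i + m) (y (i + m)) = max i (y i) + m"
  using affine_periodic[OF assms, of i] by auto

text \<open>Reindexing the sum of displacements by \<open>z\<close> itself turns it into its
  negative, so the normalization is automatic for a periodic involution.\<close>

lemma periodic_invol_I:
  assumes per: "\<And>x m. int n dvd m \<Longrightarrow> z (x + m) = z x + m" and zz: "\<And>x. z (z x) = x"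
  shows "z \<in> I"
proof -
  have b: "bij z" by (rule o_bij[of z]) (auto simp: zz)
  have "(\<Sum>x = 1..int n. z (z x) - z x) = (\<Sum>x = 1..int n. z x - x)"
    by (rule periodic_sum[where f = "\<lambda>x. z x - x"]) (use b per in \<open>auto simp: bij_def\<close>)
  moreover have "(\<Sum>x = 1..int n. z (z x) - z x) = - (\<Sum>x = 1..int n. z x - x)"
    by (simp add: zz sum_subtractf)
  ultimately have "(\<Sum>x = 1..int n. z x - x) = 0" by simp
  then show ?thesis unfolding I_iff affine_iff using b per zz by auto
qed

lemma fix_on_periodic:
  assumes y: "y \<in> G" and m: "int n dvd m"
  shows "fix_on n i j y (x + m) = fix_on n i j y x + m"
proof -
  have "[x + m = a] (mod int n) \<longleftrightarrow> [x = a] (mod int n)" for a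
    using dvd_add_left_iff[OF m, of "x - a"] by (simp add: cong_iff_dvd_diff algebra_simps)
  then show ?thesis unfolding fix_on_def using affine_periodic[OF y m] by simp
qed

lemma tau_periodic:
  assumes "y \<in> G" "int n dvd m"
  shows "tau n i j y (x + m) = tau n i j y x + m"
  unfolding tau_def using affine_periodic[OF assms] refl_t_periodic[OF assms(2)] fix_on_periodic[OF assms] by simp

lemma tau_other:
  assumes y: "y \<in> I" and x: "\<And>a. a \<in> {i, j, y i, y j} \<Longrightarrow> \<not> int n dvd x - a"
  shows "tau n i j y x = y x"
proof -
  have yx: "\<not> int n dvd y x - a" if "a \<in> {i, j, y i, y j}" for a
  proof
    assume d: "int n dvd y x - a"
    have "x - y a = y x - a"
      using affine_diff_dvd[OF I_affine[OF y] d] I_invol[OF y] by simp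
    then have "int n dvd x - y a" using d by simp
    moreover have "y a \<in> {i, j, y i, y j}" using that I_invol[OF y] by auto
    ultimately show False using x by blast
  qed
  have r: "refl_t n a b x = x" "refl_t n a b (y x) = y x" if "a \<in> {i, j, y i, y j}" "b \<in> {i, j, y i, y j}" for a b
    using refl_t_other x yx that by auto
  have "\<not> (\<exists>a\<in>{i, j, y i, y j}. [x = a] (mod int n))"
  proof
    assume "\<exists>a\<in>{i, j, y i, y j}. [x = a] (mod int n)"
    then obtain a where "a \<in> {i, j, y i, y j}" "int n dvd x - a" unfolding cong_iff_dvd_diff by (rule bexE)
    then show False using x by blast
  qed
  then have f: "fix_on n i j y x = y x" unfolding fix_on_def by (rule if_not_P)
  have r4: "refl_t n i j x = x" "refl_t n i j (y x) = y x" "refl_t n i (y j) x = x" "refl_t n i (y j) (y x) = y x"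
    "refl_t n (y i) j x = x" "refl_t n (y i) j (y x) = y x"
    by (rule r; simp)+
  show ?thesis unfolding tau_def by (simp add: r4 f)
qed

text \<open>In the nondegenerate case two of the points \<open>i\<close>, \<open>j\<close>,
  \<open>y i\<close>, \<open>y j\<close> are congruent only if they are equal. On these points the
  affine reflections thus act as ordinary transpositions.\<close>

lemma tau_classes:
  assumes y: "y \<in> I" and ij: "i < j" "\<not> [i = j] (mod int n)" and nd: "\<not> [i = y j] (mod int n)"
    and lt: "cycle_less y i j"
    and abcd: "a = min i (y i)" "b = max i (y i)" "c = min j (y j)" "d = max j (y j)"
    and x: "x \<in> {a, b, c, d}"
  shows "tau n i j y x = swap_inv a b c d i j y x"
proof -
  have yG: "y \<in> G" and yy: "y (y x) = x" for x using y I_affine I_invol by auto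
  define u v where "u = y i" and "v = y j"
  have y4: "y i = u" "y j = v" "y u = i" "y v = j" unfolding u_def v_def using yy by auto
  have dy: "int n dvd p - q \<Longrightarrow> y p - y q = p - q" for p q by (rule affine_diff_dvd[OF yG])
  have D: "\<not> int n dvd i - j" using ij(2) by (simp add: cong_iff_dvd_diff)
  have N: "\<not> int n dvd i - v" using nd unfolding v_def by (simp add: cong_iff_dvd_diff)
  have N2: "\<not> int n dvd u - j"
  proof
    assume d: "int n dvd u - j"
    then have "i - v = u - j" using dy[OF d] y4 by simp
    then show False using d N by simp
  qed
  have N3: "\<not> int n dvd u - v"
  proof
    assume d: "int n dvd u - v"
    then have "i - j = u - v" using dy[OF d] y4 by simp
    then show False using d D by simp
  qed
  have IU: "i = u" if "int n dvd i - u" using dy[OF that] y4 by simp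
  have JV: "j = v" if "int n dvd j - v" using dy[OF that] y4 by simp
  have sw: "\<not> int n dvd p - q \<Longrightarrow> \<not> int n dvd q - p" for p q by (metis dvd_diff_commute)
  have R: "refl_t n p q x = (if x = p then q else if x = q then p else x)"
    if "\<not> int n dvd p - q" "int n dvd x - p \<Longrightarrow> x = p" "int n dvd x - q \<Longrightarrow> x = q" for p q x
    using that refl_t_left[of p q n 0] refl_t_right[of p q n 0] refl_t_other[of n x p q]
    by (auto simp: cong_iff_dvd_diff)
  have IU': "int n dvd u - i \<Longrightarrow> u = i" and JV': "int n dvd v - j \<Longrightarrow> v = j"
    using IU JV by (metis dvd_diff_commute)+
  have T: "refl_t n p q x = (if x = p then q else if x = q then p else x)" if "(p, q) \<in> {(i,j),(i,v),(u,j)}" "x \<in> {i,j,u,v}" for p q x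
    by (rule R) (use that D N N2 N3 sw[OF D] sw[OF N] sw[OF N2] sw[OF N3] IU JV IU' JV' in auto)
  have T1: "refl_t n i j x = (if x = i then j else if x = j then i else x)" "refl_t n i v x = (if x = i then v else if x = v then i else x)"
     "refl_t n u j x = (if x = u then j else if x = j then u else x)" if "x \<in> {i,j,u,v}" for x
    using T that by blast+
  have F: "fix_on n i j y x = x" if "x \<in> {i,j,u,v}" for x
    using that unfolding fix_on_def u_def v_def by auto
  have ne: "i \<noteq> j" "u \<noteq> v" "i \<noteq> v" "u \<noteq> j" using D N N2 N3 by auto
  have x4: "x \<in> {i,j,u,v}"
  proof -
    have "a \<in> {i,u}" "b \<in> {i,u}" "c \<in> {j,v}" "d \<in> {j,v}" unfolding abcd u_def v_def min_def max_def by simp_all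
    then show ?thesis using x by auto
  qed
  have "tau n i j y x =
    (if (u < i \<and> i < j \<and> j < v) \<or> (i < j \<and> j < u \<and> u < v) \<or> (u < v \<and> v < i \<and> i < j)
     then refl_t n i j (y (refl_t n i j x))
     else if i < v \<and> v < u \<and> u < j then refl_t n i v (y (refl_t n i v x))
     else if (i = u \<and> u < j \<and> j = v) \<or> (i = u \<and> u < v \<and> v < j)
        \<or> (i < u \<and> u < j \<and> j = v) \<or> (i < u \<and> u < v \<and> v < j)
     then refl_t n i j x
     else if (i = u \<and> u < j \<and> j < v) \<or> (i < u \<and> u < j \<and> j < v)
     then refl_t n i v x
     else if (u < i \<and> i < j \<and> j = v) \<or> (u < i \<and> i < v \<and> v < j)
     then refl_t n u j x
     else y x)"
    using nd[folded v_def] by (simp only: tau_def y4(1,2) if_distribR comp_apply F[OF x4] simp_thms if_False)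
  also have "\<dots> = swap_inv a b c d i j y x"
  proof -
    have e: "refl_t n i j i = j" "refl_t n i j j = i" "refl_t n i j u = (if u = i then j else u)" "refl_t n i j v = (if v = j then i else v)"
      "refl_t n i v i = v" "refl_t n i v v = i" "refl_t n i v u = (if u = i then v else u)" "refl_t n i v j = (if v = j then i else j)"
      "refl_t n u j j = u" "refl_t n u j u = j" "refl_t n u j i = (if u = i then j else i)" "refl_t n u j v = (if v = j then u else v)"
      using T1 ne by simp_all
    have t1: "refl_t n i j (y (refl_t n i j x)) = (if x = i then (if v = j then i else v) else if x = j then (if u = i then j else u) else if x = u then j else i)"
      using x4 by (elim insertE emptyE) (use ne in \<open>simp_all add: e y4\<close>)
    have t2: "refl_t n i v (y (refl_t n i v x)) = (if x = i then (if v = j then i else j) else if x = v then (if u = i then v else u) else if x = j then i else v)"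
      using x4 by (elim insertE emptyE) (use ne in \<open>simp_all add: e y4\<close>)
    have lt': "min i u < min j v" "max i u < max j v" using lt unfolding cycle_less_def u_def v_def by auto
    have x4': "x = i \<or> x = j \<or> x = u \<or> x = v" using x4 by auto
    have abcd': "a = min i u" "b = max i u" "c = min j v" "d = max j v" using abcd u_def v_def by simp_all
    show ?thesis
      unfolding t1 t2 unfolding T1[OF x4] swap_inv_apply[OF x]
      by (rule tau_order_cases[OF lt' ne ij(1) x4' abcd'])
  qed
  finally show ?thesis .
qed

lemma shape_swap_at:
  assumes sh: "shape \<pi> y" and yy: "\<And>v. y (y v) = v" and inj: "inj \<pi>" and cov: "cover_at \<pi> i j"
    and lt: "cycle_less y i j"
  shows "shape (\<pi>(i := \<pi> j, j := \<pi> i)) (swap_inv (min i (y i)) (max i (y i)) (min j (y j)) (max j (y j)) i j y)"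
    "\<And>v. swap_inv (min i (y i)) (max i (y i)) (min j (y j)) (max j (y j)) i j y
        (swap_inv (min i (y i)) (max i (y i)) (min j (y j)) (max j (y j)) i j y v) = v"
    "inj (\<pi>(i := \<pi> j, j := \<pi> i))"
  using shape_swap[OF sh yy inj cov refl refl refl refl] lt unfolding cycle_less_def by blast+

lemma cover_at_shift:
  assumes p: "\<pi> \<in> G" and m: "int n dvd m" and c: "cover_at \<pi> i j"
  shows "cover_at \<pi> (i + m) (j + m)"
proof -
  have "\<pi> e < \<pi> (i + m) \<or> \<pi> (j + m) < \<pi> e" if "i + m < e" "e < j + m" for e
    using c that affine_periodic[OF p m, of "e - m"] affine_periodic[OF p m] unfolding cover_at_def
    by (metis add_less_cancel_right diff_add_cancel)
  then show ?thesis using c affine_periodic[OF p m] unfolding cover_at_def by simp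
qed

text \<open>Of the two altered positions only \<open>j + m\<close> can lie between
  \<open>i + m'\<close> and \<open>j + m'\<close>, and its new value \<pi>(i + m) is smaller than
  the value at \<open>i + m'\<close>.\<close>

lemma cover_at_later:
  assumes p: "\<pi> \<in> G" and m: "int n dvd m" "int n dvd m'" "m < m'" and c: "cover_at \<pi> i j" and ij: "\<not> [i = j] (mod int n)"
  shows "cover_at (\<pi>(i + m := \<pi> (j + m), j + m := \<pi> (i + m))) (i + m') (j + m')"
proof -
  have D: "\<not> int n dvd i - j" using ij by (simp add: cong_iff_dvd_diff)
  have ne: "i + m' \<noteq> j + m" "j + m' \<noteq> i + m"
  proof -
    show "i + m' \<noteq> j + m"
    proof
      assume "i + m' = j + m"
      then have "i - j = m - m'" by simp
      then show False using D dvd_diff[OF m(1,2)] by simp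
    qed
    show "j + m' \<noteq> i + m"
    proof
      assume "j + m' = i + m"
      then have "i - j = m' - m" by simp
      then show False using D dvd_diff[OF m(2,1)] by simp
    qed
  qed
  have c': "cover_at \<pi> (i + m') (j + m')" by (rule cover_at_shift[OF p m(2) c])
  have "\<pi> (i + m) < \<pi> (i + m')" using affine_periodic[OF p m(1), of i] affine_periodic[OF p m(2), of i] m(3) by simp
  then show ?thesis using c' ne m(3) unfolding cover_at_def by auto
qed

text \<open>
  Every instance of \<open>shape\<close> involves at most two cycles. So it suffices to exchange the values at one
  or two translates of \<open>(i, j)\<close>, the lower translate first in order to keep the covering condition.
\<close>

lemma nondegenerate_shape:
  assumes p: "\<pi> \<in> G" and y: "y \<in> I" and sh: "shape \<pi> y" and cov: "cover_at \<pi> i j"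
    and ij: "\<not> [i = j] (mod int n)" and nd: "\<not> [i = y j] (mod int n)" and lt: "cycle_less y i j"
  shows "shape (\<pi> \<circ> refl_t n i j) (tau n i j y)" "tau n i j y \<in> I"
proof -
  have yG: "y \<in> G" and yy: "y (y x) = x" for x using y I_affine I_invol by auto
  have i_j: "i < j" using cov unfolding cover_at_def by simp
  define a b c d where abcd: "a = min i (y i)" "b = max i (y i)" "c = min j (y j)" "d = max j (y j)"
  define T where "T = tau n i j y"
  define \<sigma> where "\<sigma> = \<pi> \<circ> refl_t n i j"
  define E where "E m = {a + m, b + m, c + m, d + m}" for m
  define out where "out x \<longleftrightarrow> (\<forall>m. int n dvd m \<longrightarrow> x \<notin> E m)" for x
  have D: "\<not> int n dvd i - j" using ij by (simp add: cong_iff_dvd_diff)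
  have N: "\<not> int n dvd i - y j" using nd by (simp add: cong_iff_dvd_diff)
  have dy: "int n dvd p - q \<Longrightarrow> y p - y q = p - q" for p q by (rule affine_diff_dvd[OF yG])
  have N2: "\<not> int n dvd y i - j" using dy[of "y i" j] N yy by auto
  have N3: "\<not> int n dvd y i - y j" using dy[of "y i" "y j"] D yy by auto
  have N4: "int n dvd y i - i \<Longrightarrow> y i = i" using dy[of "y i" i] yy by auto
  have N5: "int n dvd y j - j \<Longrightarrow> y j = j" using dy[of "y j" j] yy by auto
  have E0: "{a,b,c,d} = {i, j, y i, y j}" unfolding abcd min_def max_def by auto
  have Eab: "E m = (\<lambda>x. x + m) ` {i, j, y i, y j}" for m unfolding E_def E0[symmetric] by auto
  \<comment> \<open>Consequently the sets \<open>E m\<close> for different multiples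
    \<open>m\<close> of \<open>n\<close> are disjoint, and an exchange in one translate does not
    affect the cycles of another.\<close>
  have dvd_eq: "p = q" if "p \<in> {i, j, y i, y j}" "q \<in> {i, j, y i, y j}" "int n dvd p - q" for p q
    using that D N N2 N3 N4 N5 dvd_diff_commute[of "int n" p q] by auto
  have disj: "m = m'" if "x \<in> E m" "x \<in> E m'" "int n dvd m" "int n dvd m'" for x m m'
  proof -
    from that(1,2)[unfolded Eab] obtain p q
      where pq: "p \<in> {i, j, y i, y j}" "q \<in> {i, j, y i, y j}" "x = p + m" "x = q + m'" by blast
    then have "p - q = m' - m" by simp
    then have "int n dvd p - q" using dvd_diff[OF that(4,3)] by simp
    then have "p = q" using dvd_eq pq by blast
    then show ?thesis using pq by simp
  qed
  have Tper: "T (x + m) = T x + m" if "int n dvd m" for x m unfolding T_def by (rule tau_periodic[OF yG that])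
  let ?sw = "\<lambda>m. swap_inv (a + m) (b + m) (c + m) (d + m) (i + m) (j + m)"
  have TE: "T x = ?sw m y' x" if "x \<in> E m" "int n dvd m" for x m y'
  proof -
    define x0 where "x0 = x - m"
    have x0: "x0 \<in> {a,b,c,d}" "x = x0 + m" using that unfolding E_def x0_def by auto
    have "T x = T x0 + m" using Tper[OF that(2)] x0 by simp
    also have "T x0 = swap_inv a b c d i j y x0" unfolding T_def by (rule tau_classes[OF y i_j ij nd lt abcd x0(1)])
    also have "\<dots> + m = ?sw m y x" using swap_inv_shift[OF x0(1)] x0(2) by simp
    also have "\<dots> = ?sw m y' x" using that(1) unfolding E_def by (rule swap_inv_on)
    finally show ?thesis .
  qed
  have Tin: "T x \<in> E m" if "x \<in> E m" "int n dvd m" for x m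
    using TE[OF that, of y] swap_inv_in[of x "a + m" "b + m" "c + m" "d + m"] that unfolding E_def by metis
  have outE: "\<not> int n dvd x - q" if "out x" "q \<in> {i, j, y i, y j}" for x q
  proof
    assume d: "int n dvd x - q"
    have "x \<in> E (x - q)" unfolding Eab using that(2) by (auto intro!: image_eqI[of _ _ q])
    then show False using d that(1) unfolding out_def by blast
  qed
  have Tout: "T x = y x" if "out x" for x unfolding T_def by (rule tau_other[OF y]) (rule outE[OF that])
  have yE: "y x \<in> E m" if "x \<in> E m" "int n dvd m" for x m
    using that yy affine_periodic[OF yG that(2)] unfolding Eab by auto
  have yout: "out (y x)" if "out x" for x
    using that yE[of "y x"] yy unfolding out_def by metis
  have sout: "\<sigma> x = \<pi> x" if "out x" for x
    unfolding \<sigma>_def using refl_t_other[of n x i j] outE[OF that] by simp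
  have sij: "\<sigma> (i + m) = \<pi> (j + m)" "\<sigma> (j + m) = \<pi> (i + m)" if "int n dvd m" for m
    unfolding \<sigma>_def using refl_t_left[OF ij that] refl_t_right[OF ij that] by simp_all
  have sE: "\<sigma> x = (\<pi>(i + m := \<pi> (j + m), j + m := \<pi> (i + m))) x" if "x \<in> E m" "int n dvd m" for x m
  proof (cases "x = i + m \<or> x = j + m")
    case True
    then show ?thesis using sij[OF that(2)] D by auto
  next
    case False
    from that(1)[unfolded Eab] obtain q where q: "q \<in> {i, j, y i, y j}" "x = q + m" by blast
    have "\<not> int n dvd x - i'" if "i' \<in> {i, j}" for i'
    proof
      assume d: "int n dvd x - i'"
      have "q - i' = (x - i') - m" using q by simp
      then have "int n dvd q - i'" using dvd_diff[OF d \<open>int n dvd m\<close>] by (simp only:)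
      then have "q = i'" using dvd_eq[OF q(1), of i'] that by blast
      then show False using False q that by auto
    qed
    then show ?thesis using False refl_t_other[of n x i j] unfolding \<sigma>_def by simp
  qed
  define P1 where "P1 m = \<pi>(i + m := \<pi> (j + m), j + m := \<pi> (i + m))" for m
  define Y1 where "Y1 m = ?sw m y" for m
  have mm: "min (i + m) (y (i + m)) = a + m" "max (i + m) (y (i + m)) = b + m"
    "min (j + m) (y (j + m)) = c + m" "max (j + m) (y (j + m)) = d + m" if "int n dvd m" for m
    unfolding abcd using min_max_shift[OF yG that] by auto
  have lt': "cycle_less y (i + m) (j + m)" if "int n dvd m" for m
    using lt unfolding cycle_less_def mm[OF that] abcd[symmetric] by simp
  have s1: "shape (P1 m) (Y1 m)" "Y1 m (Y1 m v) = v" "inj (P1 m)" if "int n dvd m" for m v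
    using shape_swap_at[OF sh yy affine_inj[OF p] cover_at_shift[OF p that cov] lt'[OF that]]
    unfolding mm[OF that] P1_def Y1_def by blast+
  have Y1off: "Y1 m x = y x" if "x \<notin> E m" for x m
    using that unfolding Y1_def E_def by (rule swap_inv_off)
  have P1off: "P1 m x = \<pi> x" if "x \<notin> E m" for x m
    using that unfolding P1_def Eab by auto
  \<comment> \<open>\<open>good S\<close> provides a comparison pair for \<open>shape_local\<close>:
    a pair, in general not periodic, that satisfies the conditions and cannot be distinguished on
    \<open>S\<close> from the affine pair under study.\<close>
  define good where "good S \<longleftrightarrow> (\<exists>\<pi>' y'. shape \<pi>' y' \<and> (\<forall>x\<in>S. \<pi>' x = \<sigma> x \<and> y' x = T x))" for S
  have g0: "good {x. out x}"
    unfolding good_def using sh Tout sout by (intro exI[of _ \<pi>] exI[of _ y]) auto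
  have g1: "good ({x. out x} \<union> E m)" if m: "int n dvd m" for m
  proof -
    have "P1 m x = \<sigma> x \<and> Y1 m x = T x" if x: "x \<in> {x. out x} \<union> E m" for x
    proof (cases "x \<in> E m")
      case True
      then show ?thesis using sE[OF True m] TE[OF True m] unfolding P1_def Y1_def by simp
    next
      case False
      then show ?thesis using x Y1off P1off Tout sout by auto
    qed
    then show ?thesis unfolding good_def using s1(1)[OF m] by blast
  qed
  have g2: "good ({x. out x} \<union> E m \<union> E m')" if m: "int n dvd m" and m': "int n dvd m'" and less: "m < m'" for m m'
  proof -
    have notE: "i + m' \<notin> E m" "j + m' \<notin> E m" "y (i + m') \<notin> E m" "y (j + m') \<notin> E m"
      using disj[OF _ _ m m'] less unfolding Eab[of m'] using affine_periodic[OF yG m'] by (metis (no_types, lifting) image_eqI insertI1 insertI2 order_less_irrefl)+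
    define P2 where "P2 = (P1 m)(i + m' := P1 m (j + m'), j + m' := P1 m (i + m'))"
    define Y2 where "Y2 = ?sw m' (Y1 m)"
    have e: "Y1 m (i + m') = y (i + m')" "Y1 m (j + m') = y (j + m')" using notE Y1off by auto
    have c: "cover_at (P1 m) (i + m') (j + m')" unfolding P1_def by (rule cover_at_later[OF p m m' less cov ij])
    have l: "cycle_less (Y1 m) (i + m') (j + m')" using lt'[OF m'] unfolding cycle_less_def e .
    have s2: "shape P2 Y2"
      using shape_swap_at(1)[OF s1(1)[OF m] s1(2)[OF m] s1(3)[OF m] c l] unfolding e mm[OF m'] P2_def Y2_def .
    have "P2 x = \<sigma> x \<and> Y2 x = T x" if x: "x \<in> {x. out x} \<union> E m \<union> E m'" for x
    proof (cases "x \<in> E m'")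
      case True
      have "Y2 x = T x" using TE[OF True m'] unfolding Y2_def by simp
      moreover have "P2 x = (\<pi>(i + m' := \<pi> (j + m'), j + m' := \<pi> (i + m'))) x"
      proof -
        have "x \<notin> E m" using disj[OF _ True m m'] less by auto
        then show ?thesis unfolding P2_def using P1off notE by simp
      qed
      ultimately show ?thesis using sE[OF True m'] by simp
    next
      case False
      have Y2: "Y2 x = Y1 m x" using False unfolding Y2_def E_def by (rule swap_inv_off)
      have P2: "P2 x = P1 m x" using False unfolding P2_def Eab by auto
      show ?thesis
      proof (cases "x \<in> E m")
        case True
        then show ?thesis unfolding Y2 P2 using sE[OF True m] TE[OF True m] unfolding P1_def Y1_def by simp
      next
        case F: False
        then show ?thesis unfolding Y2 P2 using x False Y1off P1off Tout sout by auto
      qed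
    qed
    then show ?thesis unfolding good_def using s2 by blast
  qed
  have shape_on: "shape_at \<sigma> T u v" if g: "good S" and S: "u \<in> S" "v \<in> S" "T u \<in> S" "T v \<in> S" for S u v
  proof -
    obtain \<pi>' y' where "shape \<pi>' y'" and e: "\<And>x. x \<in> S \<Longrightarrow> \<pi>' x = \<sigma> x \<and> y' x = T x" using g unfolding good_def by blast
    then show ?thesis using S by (intro shape_local[of \<pi>' y' u T v \<sigma>]) auto
  qed
  have "shape_at \<sigma> T u v" for u v
  proof -
    have cl: "T x \<in> {x. out x}" if "out x" for x using yout[OF that] Tout[OF that] by simp
    consider "out u" "out v" | m where "int n dvd m" "u \<in> E m" "out v" | m where "int n dvd m" "out u" "v \<in> E m"
      | m m' where "int n dvd m" "int n dvd m'" "u \<in> E m" "v \<in> E m'" unfolding out_def by blast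
    then show ?thesis
    proof cases
      case 1 then show ?thesis using shape_on[OF g0] cl by blast
    next
      case (2 m) then show ?thesis using shape_on[OF g1[OF 2(1)]] cl Tin by blast
    next
      case (3 m) then show ?thesis using shape_on[OF g1[OF 3(1)]] cl Tin by blast
    next
      case (4 m m')
      then have "T u \<in> E m" "T v \<in> E m'" using Tin by auto
      then show ?thesis using 4 shape_on[OF g1[OF 4(1)], of u v] shape_on[OF g2[OF 4(1,2)], of u v] shape_on[OF g2[OF 4(2,1)], of u v]
        by (cases m m' rule: linorder_cases) auto
    qed
  qed
  then show "shape (\<pi> \<circ> refl_t n i j) (tau n i j y)" unfolding shape_def \<sigma>_def T_def by blast
  have "T (T x) = x" for x
  proof (cases "out x")
    case True
    then show ?thesis using Tout yout yy by simp
  next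
    case False
    then obtain m where m: "int n dvd m" "x \<in> E m" unfolding out_def by blast
    have "T (T x) = Y1 m (Y1 m x)" using TE[OF m(2,1), of y] TE[OF Tin[OF m(2,1)] m(1), of y] unfolding Y1_def by simp
    then show ?thesis using s1(2)[OF m(1)] by simp
  qed
  then show "tau n i j y \<in> I" using periodic_invol_I[of T] Tper unfolding T_def by blast
qed

text \<open>Settles the conditions between translates of the one new cycle, whose ends carry the
  values \<open>A\<close> and \<open>B\<close>. The hypothesis on \<open>k\<close> puts all values
  on a lower translate below all values on a higher one.\<close>

lemma degenerate_own_class:
  assumes T: "\<And>m. int n dvd m \<Longrightarrow> T (i + m) = j + m" "\<And>m. int n dvd m \<Longrightarrow> T (j + m) = i + m"
    and s: "\<And>m. int n dvd m \<Longrightarrow> \<sigma> (i + m) = A + m" "\<And>m. int n dvd m \<Longrightarrow> \<sigma> (j + m) = B + m"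
    and lt: "i < j" "B < A" and k: "\<And>k. int n dvd k \<Longrightarrow> 0 < k \<Longrightarrow> A < B + k"
    and m: "int n dvd m" "int n dvd m'" and p: "p \<in> {i + m, j + m}" and q: "q \<in> {i + m', j + m'}"
  shows "shape_at \<sigma> T p q"
proof -
  have "m < m' \<Longrightarrow> A + m < B + m'" "m' < m \<Longrightarrow> A + m' < B + m"
    using k[of "m' - m"] k[of "m - m'"] m by (auto dest: dvd_diff)
  then have c: "m = m' \<or> m < m' \<and> A + m < B + m' \<or> m' < m \<and> A + m' < B + m" by linarith
  show ?thesis
    using p q unfolding insert_iff empty_iff
    apply (elim disjE; simp only: shape_at_def T[OF m(1)] T[OF m(2)] s[OF m(1)] s[OF m(2)])
    using c lt by auto
qed

text \<open>
  Now the cycles through \<open>i\<close> and \<open>j\<close> are translates of each other: \<open>y j = i + M\<close> and \<open>y i = j - M\<close> with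
  \<open>n\<close> dividing \<open>M > 0\<close>. For \<open>M < j - i\<close> the new cycle is \<open>(i, j)\<close>, otherwise it is \<open>(i, j + M)\<close>
  and emerges only after the exchanges at \<open>(i, j)\<close> and at \<open>(i + M, j + M)\<close>.
\<close>

lemma degenerate_shape:
  assumes p: "\<pi> \<in> G" and y: "y \<in> I" and sh: "shape \<pi> y" and cov: "cover_at \<pi> i j"
    and ij: "\<not> [i = j] (mod int n)" and dg: "[i = y j] (mod int n)" and lt: "cycle_less y i j"
  shows "shape (\<pi> \<circ> refl_t n i j) (tau n i j y)" "tau n i j y \<in> I"
proof -
  have yG: "y \<in> G" and yy: "y (y x) = x" for x using y I_affine I_invol by auto
  have i_j: "i < j" and pij: "\<pi> i < \<pi> j" and cv: "\<And>e. i < e \<Longrightarrow> e < j \<Longrightarrow> \<pi> e < \<pi> i \<or> \<pi> j < \<pi> e"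
    using cov unfolding cover_at_def by auto
  note per = affine_periodic[OF yG] and pper = affine_periodic[OF p]
  have D: "\<not> int n dvd i - j" using ij by (simp add: cong_iff_dvd_diff)
  have D': "\<not> int n dvd j - i" using D by (metis dvd_diff_commute)
  define M where "M = y j - i"
  have M: "int n dvd M" using dg dvd_diff_commute unfolding M_def cong_iff_dvd_diff by blast
  have yj: "y j = i + M" unfolding M_def by simp
  have yi: "y i = j - M" using yy[of j] per[OF M, of i] unfolding yj by simp
  have yim: "y (i + m) = j - M + m" and yjm: "y (j + m) = i + M + m" if "int n dvd m" for m
    using per[OF that] yi yj by auto
  have Mpos: "0 < M" using lt i_j unfolding cycle_less_def yi yj by (auto simp: min_def max_def split: if_splits)
  have Mne: "M \<noteq> j - i" using D' M by auto
  have Mne2: "j - M \<noteq> i + M"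
  proof
    assume "j - M = i + M"
    then have "j - i = M + M" by simp
    then show False using D' dvd_add[OF M M] by simp
  qed
  define T where "T = tau n i j y"
  define \<sigma> where "\<sigma> = \<pi> \<circ> refl_t n i j"
  define out where "out x \<longleftrightarrow> \<not> int n dvd x - i \<and> \<not> int n dvd x - j" for x
  have outM: "\<not> int n dvd x - (i + M)" "\<not> int n dvd x - (j - M)" if "out x" for x
  proof -
    have "x - i = (x - (i + M)) + M" "x - j = (x - (j - M)) - M" by simp_all
    then show "\<not> int n dvd x - (i + M)" "\<not> int n dvd x - (j - M)"
      using that dvd_add[OF _ M, of "x - (i + M)"] dvd_diff[OF _ M, of "x - (j - M)"] unfolding out_def by metis+
  qed
  have Tout: "T x = y x" if "out x" for x unfolding T_def
    using that outM[OF that] unfolding out_def by (intro tau_other[OF y]) (auto simp: yi yj)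
  have sout: "\<sigma> x = \<pi> x" if "out x" for x
    unfolding \<sigma>_def using refl_t_other[of n x i j] that unfolding out_def by simp
  have sij: "\<sigma> (i + m) = \<pi> j + m" "\<sigma> (j + m) = \<pi> i + m" if "int n dvd m" for m
    unfolding \<sigma>_def using refl_t_left[OF ij that] refl_t_right[OF ij that] pper[OF that] by simp_all
  have Tper: "T (x + m) = T x + m" if "int n dvd m" for x m unfolding T_def by (rule tau_periodic[OF yG that])
  have Cb: "u < y v \<Longrightarrow> y u < v \<Longrightarrow> \<pi> u < \<pi> v" and Ca: "u < y u \<Longrightarrow> \<pi> (y u) < \<pi> u" for u v
    using sh unfolding shape_def shape_at_def by blast+
  have out_ne: "x \<noteq> i + m" "x \<noteq> j + m" if "out x" "int n dvd m" for x m
    using that unfolding out_def by auto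
  have dM: "int n dvd m + M" "int n dvd m - M" if "int n dvd m" for m using that M by auto
  have yout: "out (y x)" if "out x" for x
  proof -
    have "\<not> int n dvd y x - q" if "\<not> int n dvd x - y q" for q
      using that affine_diff_dvd[OF yG, of "y x" q] yy by auto
    then show ?thesis using outM[OF that] unfolding out_def yi yj by (metis yi yj)
  qed
  \<comment> \<open>\<open>j'\<close> is the upper end of the new cycle, either \<open>j\<close> or
    \<open>j + M\<close>, and \<open>B\<close> is the value there after the exchange. One translate
    of this cycle together with all other classes is covered by the comparison pair in
    \<open>ex\<close>; two translates are compared by \<open>degenerate_own_class\<close>.\<close>
  have main: "shape \<sigma> T \<and> T \<in> I"
    if TE: "\<And>m. int n dvd m \<Longrightarrow> T (i + m) = j' + m" "\<And>m. int n dvd m \<Longrightarrow> T (j' + m) = i + m"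
    and dj: "int n dvd j' - j" and sE: "\<And>m. int n dvd m \<Longrightarrow> \<sigma> (j' + m) = B + m"
    and lt': "i < j'" "B < \<pi> j" "\<And>k. int n dvd k \<Longrightarrow> 0 < k \<Longrightarrow> \<pi> j < B + k"
    and ex: "\<And>m. int n dvd m \<Longrightarrow> \<exists>\<pi>' y'. shape \<pi>' y' \<and> (\<forall>x. out x \<or> x = i + m \<or> x = j' + m \<longrightarrow> \<pi>' x = \<sigma> x \<and> y' x = T x)"
    for j' B
  proof -
    have cl: "out (T x)" if "out x" for x using yout[OF that] Tout[OF that] by simp
    have cs: "out x \<or> (\<exists>m. int n dvd m \<and> (x = i + m \<or> x = j' + m))" for x
    proof (cases "out x")
      case False
      then consider "int n dvd x - i" | "int n dvd x - j" unfolding out_def by blast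
      then show ?thesis
      proof cases
        case 1 then show ?thesis by (intro disjI2 exI[of _ "x - i"]) simp
      next
        case 2
        have "x - j' = (x - j) - (j' - j)" by simp
        then have "int n dvd x - j'" using dvd_diff[OF 2 dj] by (simp only:)
        then show ?thesis by (intro disjI2 exI[of _ "x - j'"]) simp
      qed
    qed simp
    have one: "shape_at \<sigma> T u v" if m: "int n dvd m" and u: "out u \<or> u = i + m \<or> u = j' + m" and v: "out v \<or> v = i + m \<or> v = j' + m" for u v m
    proof -
      obtain \<pi>' y' where h: "shape \<pi>' y'" "\<And>x. out x \<or> x = i + m \<or> x = j' + m \<Longrightarrow> \<pi>' x = \<sigma> x \<and> y' x = T x" using ex[OF m] by blast
      have "out (T u) \<or> T u = i + m \<or> T u = j' + m" "out (T v) \<or> T v = i + m \<or> T v = j' + m" using u v cl TE m by auto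
      then show ?thesis using h u v by (intro shape_local[of \<pi>' y' u T v \<sigma>]) auto
    qed
    have "shape_at \<sigma> T u v" for u v
    proof -
      consider "out u" "out v" | m where "int n dvd m" "u = i + m \<or> u = j' + m" "out v" | m where "int n dvd m" "out u" "v = i + m \<or> v = j' + m"
        | m m' where "int n dvd m" "int n dvd m'" "u = i + m \<or> u = j' + m" "v = i + m' \<or> v = j' + m'" using cs by metis
      then show ?thesis
      proof cases
        case 1 then show ?thesis using one[of 0] by simp
      next
        case (2 m) then show ?thesis using one by blast
      next
        case (3 m) then show ?thesis using one by blast
      next
        case (4 m m')
        then show ?thesis by (intro degenerate_own_class[OF TE sij(1) sE lt']) auto
      qed
    qed
    then have "shape \<sigma> T" unfolding shape_def by blast
    moreover have TT: "T (T x) = x" for x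
    proof (cases "out x")
      case True
      then show ?thesis using Tout[OF True] Tout[OF yout[OF True]] yy by simp
    next
      case False
      then obtain m where m: "int n dvd m" "x = i + m \<or> x = j' + m" using cs[of x] by blast
      from m(2) show ?thesis by (rule disjE) (simp_all only: TE[OF m(1)])
    qed
    ultimately show ?thesis using periodic_invol_I[OF Tper TT] by blast
  qed
  have sw: "shape (\<pi>(i + m := \<pi> (j + m), j + m := \<pi> (i + m)))
      (swap_inv (min i (j - M) + m) (max i (j - M) + m) (min j (i + M) + m) (max j (i + M) + m) (i + m) (j + m) y)
     \<and> (\<forall>v. swap_inv (min i (j - M) + m) (max i (j - M) + m) (min j (i + M) + m) (max j (i + M) + m) (i + m) (j + m) y
      (swap_inv (min i (j - M) + m) (max i (j - M) + m) (min j (i + M) + m) (max j (i + M) + m) (i + m) (j + m) y v) = v)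
     \<and> inj (\<pi>(i + m := \<pi> (j + m), j + m := \<pi> (i + m)))"
    if m: "int n dvd m" for m
  proof -
    note cs = min_max_shift[OF yG m, of i, unfolded yi] min_max_shift[OF yG m, of j, unfolded yj]
    have l: "cycle_less y (i + m) (j + m)" using lt unfolding cycle_less_def cs yi yj by simp
    show ?thesis using shape_swap_at[OF sh yy affine_inj[OF p] cover_at_shift[OF p m cov] l] unfolding cs by blast
  qed
  have "shape \<sigma> T \<and> T \<in> I"
  proof (cases "M < j - i")
    case True
    have o: "min i (j - M) = i" "max i (j - M) = j - M" "min j (i + M) = i + M" "max j (i + M) = j" using True Mpos by auto
    have dg': "[i = i + M] (mod int n)" using dg yj by simp
    have T: "T = refl_t n i j \<circ> fix_on n i j y"
      unfolding T_def tau_def yi yj using True Mpos i_j Mne2 dg' by auto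
    have fx: "fix_on n i j y (i + m) = i + m" "fix_on n i j y (j + m) = j + m" if "int n dvd m" for m
      using that unfolding fix_on_def by (auto simp: cong_iff_dvd_diff)
    have TE: "T (i + m) = j + m" "T (j + m) = i + m" if "int n dvd m" for m
      unfolding T using fx[OF that] refl_t_left[OF ij that] refl_t_right[OF ij that] by simp_all
    show ?thesis
    proof (rule main[OF TE _ sij(2) i_j pij])
      \<comment> \<open>If \<open>i + k\<close> lies before \<open>j\<close>, its value exceeds
        \<pi>(i) and so, by the covering condition, also \<pi>(j). Otherwise \<open>k\<close>
        exceeds \<open>j - i\<close> and hence \<open>M\<close>, and condition (4) applies to
        \<open>j\<close> and \<open>i + k\<close>.\<close>
      show "\<pi> j < \<pi> i + k" if k: "int n dvd k" "0 < k" for k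
      proof (cases "k < j - i")
        case True
        then show ?thesis using cv[of "i + k"] pper[OF k(1), of i] k by auto
      next
        case False
        have "k \<noteq> j - i" using k D' by auto
        then have "j < y (i + k)" "y j < i + k" using False True yim[OF k(1)] yj by auto
        then show ?thesis using Cb[of j "i + k"] pper[OF k(1), of i] by simp
      qed
      fix m assume m: "int n dvd m"
      define Y where "Y = swap_inv (i + m) (j - M + m) (i + M + m) (j + m) (i + m) (j + m) y"
      define P where "P = \<pi>(i + m := \<pi> (j + m), j + m := \<pi> (i + m))"
      have "shape P Y" using sw[OF m] unfolding o P_def Y_def by blast
      moreover have "P x = \<sigma> x \<and> Y x = T x" if "out x \<or> x = i + m \<or> x = j + m" for x
      proof (cases "out x")
        case True
        have "x \<noteq> j - M + m" "x \<noteq> i + M + m" using out_ne[OF True dM(1)[OF m]] out_ne[OF True dM(2)[OF m]] by (simp_all add: algebra_simps)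
        then show ?thesis using out_ne[OF True m] sout[OF True] Tout[OF True] unfolding P_def Y_def by (simp add: swap_inv_off)
      next
        case False
        have "Y (i + m) = j + m" "Y (j + m) = i + m" unfolding Y_def using True Mpos Mne i_j by (auto simp: swap_inv_def)
        then show ?thesis using False that TE[OF m] sij[OF m] pper[OF m] i_j unfolding P_def by auto
      qed
      ultimately show "\<exists>\<pi>' y'. shape \<pi>' y' \<and> (\<forall>x. out x \<or> x = i + m \<or> x = j + m \<longrightarrow> \<pi>' x = \<sigma> x \<and> y' x = T x)" by blast
    qed simp_all
  next
    case False
    then have Mg: "j - i < M" using Mne by simp
    have o: "min i (j - M) = j - M" "max i (j - M) = i" "min j (i + M) = j" "max j (i + M) = i + M" using Mg by auto
    have T: "T = refl_t n i j \<circ> y \<circ> refl_t n i j"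
      unfolding T_def tau_def yi yj using Mg i_j by auto
    have TE: "T (i + m) = j + M + m" "T (j + M + m) = i + m" if m: "int n dvd m" for m
    proof -
      show "T (i + m) = j + M + m"
        unfolding T using refl_t_left[OF ij m] yjm[OF m] refl_t_left[OF ij dM(1)[OF m]] by (simp add: algebra_simps)
      show "T (j + M + m) = i + m"
        unfolding T using refl_t_right[OF ij dM(1)[OF m]] yim[OF dM(1)[OF m]] refl_t_right[OF ij m] by (simp add: algebra_simps)
    qed
    show ?thesis
    proof (rule main[OF TE])
      show "int n dvd (j + M) - j" using M by simp
      show "\<sigma> (j + M + m) = \<pi> i + M + m" if "int n dvd m" for m
        using sij(2)[OF dM(1)[OF that]] by (simp add: algebra_simps)
      show "i < j + M" using i_j Mpos by simp
      \<comment> \<open>\<open>j - M\<close> and \<open>i\<close> form a cycle of \<open>y\<close>,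
        so condition (1) compares their values; translation by \<open>M\<close> turns this into the
        claim.\<close>
      have "\<pi> i < \<pi> (j - M)" using Ca[of "j - M"] yjm[of "- M"] M Mg by simp
      then show "\<pi> i + M < \<pi> j" using pper[of "- M" j] M by simp
      show "\<pi> j < \<pi> i + M + k" if k: "int n dvd k" "0 < k" for k
      proof -
        have "\<pi> (j - M) < \<pi> (i + k)" using Cb[of "j - M" "i + k"] yjm[of "- M"] M yim[OF k(1)] k(2) by simp
        then show ?thesis using pper[of "- M" j] M pper[OF k(1), of i] by simp
      qed
      fix m assume m: "int n dvd m"
      define Y where "Y = swap_inv (j - M + m) (i + m) (j + m) (i + M + m) (i + m) (j + m) y"
      define P where "P = \<pi>(i + m := \<pi> (j + m), j + m := \<pi> (i + m))"
      have s1: "shape P Y" "\<And>v. Y (Y v) = v" "inj P" using sw[OF m] unfolding o P_def Y_def by blast+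
      have mM: "int n dvd m + M" using dM(1)[OF m] .
      have c2: "cover_at P (i + (m + M)) (j + (m + M))" unfolding P_def using cover_at_later[OF p m mM _ cov ij] Mpos by simp
      \<comment> \<open>The first exchange is one of inner ends: it links \<open>i + m\<close> with
        its own translate \<open>i + m + M\<close>. The second exchange, again of inner ends,
        replaces this upper end by \<open>j + m + M\<close> and so produces the cycle required by
        \<open>tau\<close>.\<close>
      have Yi: "Y (i + (m + M)) = i + m" unfolding Y_def using Mg i_j by (auto simp: swap_inv_def)
      have "Y (j + (m + M)) = y (j + (m + M))" unfolding Y_def using Mg i_j Mpos Mne D' M by (intro swap_inv_off) auto
      then have Yj: "Y (j + (m + M)) = i + M + (m + M)" using yjm[OF mM] by simp
      have l2: "cycle_less Y (i + (m + M)) (j + (m + M))" unfolding cycle_less_def Yi Yj using Mg i_j Mpos by auto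
      have o2: "min (i + (m + M)) (i + m) = i + m" "max (i + (m + M)) (i + m) = i + (m + M)"
        "min (j + (m + M)) (i + M + (m + M)) = j + (m + M)" "max (j + (m + M)) (i + M + (m + M)) = i + M + (m + M)"
        using Mg Mpos by auto
      define Y2 where "Y2 = swap_inv (i + m) (i + (m + M)) (j + (m + M)) (i + M + (m + M)) (i + (m + M)) (j + (m + M)) Y"
      define P2 where "P2 = P(i + (m + M) := P (j + (m + M)), j + (m + M) := P (i + (m + M)))"
      have "shape P2 Y2" using shape_swap_at(1)[OF s1 c2 l2] unfolding Yi Yj o2 P2_def Y2_def .
      moreover have "P2 x = \<sigma> x \<and> Y2 x = T x" if "out x \<or> x = i + m \<or> x = j + M + m" for x
      proof (cases "out x")
        case True
        have ne: "x \<noteq> j - M + m" "x \<noteq> i + M + m" "x \<noteq> i + (m + M)" "x \<noteq> j + (m + M)" "x \<noteq> i + M + (m + M)" "x \<noteq> i + m" "x \<noteq> j + m"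
          using out_ne[OF True m] out_ne[OF True mM] out_ne(1)[OF True dM(1)[OF mM]] out_ne(2)[OF True dM(2)[OF m]] by (simp_all add: algebra_simps)
        then show ?thesis using sout[OF True] Tout[OF True] unfolding P2_def Y2_def P_def Y_def by (simp add: swap_inv_off)
      next
        case False
        have e: "Y2 (i + m) = j + (m + M)" "Y2 (j + (m + M)) = i + m" unfolding Y2_def using Mg Mpos i_j by (auto simp: swap_inv_def)
        have "P2 (i + m) = \<pi> (j + m)" "P2 (j + (m + M)) = \<pi> (i + (m + M))"
          using Mpos Mg i_j Mne unfolding P2_def P_def by auto
        then have "P2 (i + m) = \<sigma> (i + m)" "P2 (j + (m + M)) = \<sigma> (j + (m + M))" using sij[OF m] sij[OF mM] pper[OF m] pper[OF mM] by auto
        then show ?thesis using False that e TE[OF m] by (auto simp: algebra_simps)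
      qed
      ultimately show "\<exists>\<pi>' y'. shape \<pi>' y' \<and> (\<forall>x. out x \<or> x = i + m \<or> x = j + M + m \<longrightarrow> \<pi>' x = \<sigma> x \<and> y' x = T x)" by blast
    qed
  qed
  then show "shape (\<pi> \<circ> refl_t n i j) (tau n i j y)" "tau n i j y \<in> I" unfolding \<sigma>_def T_def by blast+
qed

lemma swap_shape:
  assumes "\<pi> \<in> G" "y \<in> I" "shape \<pi> y" "cover_at \<pi> i j" "\<not> [i = j] (mod int n)" "cycle_less y i j"
  shows "\<pi> \<circ> refl_t n i j \<in> atoms n (tau n i j y)" "tau n i j y \<in> I"
proof -
  have "shape (\<pi> \<circ> refl_t n i j) (tau n i j y) \<and> tau n i j y \<in> I"
    using nondegenerate_shape[OF assms(1-5) _ assms(6)] degenerate_shape[OF assms(1-5) _ assms(6)]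
    by (cases "[i = y j] (mod int n)") blast+
  then show "\<pi> \<circ> refl_t n i j \<in> atoms n (tau n i j y)" "tau n i j y \<in> I"
    using atoms_iff_shape[of "tau n i j y"] affine_comp[OF assms(1) refl_t_affine] by blast+
qed

section \<open>Deleting a letter of a reduced word\<close>

lemma tau_desc:
  assumes y: "y \<in> I" and ij: "i < j" "\<not> [i = j] (mod int n)" and nd: "\<not> [i = y j] (mod int n)" and lt: "cycle_less y i j"
  shows "tau n i j y (min j (y j)) < tau n i j y (min i (y i))" "tau n i j y (max j (y j)) < tau n i j y (max i (y i))"
proof -
  define a b c d where abcd: "a = min i (y i)" "b = max i (y i)" "c = min j (y j)" "d = max j (y j)"
  have o: "a < c" "b < d" "a \<le> b" "c \<le> d" using lt unfolding cycle_less_def abcd by auto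
  note T = tau_classes[OF y ij nd lt abcd]
  have t: "tau n i j y x = swap_inv a b c d i j y x" if "x \<in> {a,b,c,d}" for x using T that .
  have "b \<noteq> c" using nd ij I_invol[OF y, of i] I_invol[OF y, of j] lt unfolding abcd cycle_less_def
    by (auto simp: min_def max_def split: if_splits)
  then show "tau n i j y (min j (y j)) < tau n i j y (min i (y i))" "tau n i j y (max j (y j)) < tau n i j y (max i (y i))"
    unfolding abcd[symmetric] using o by (auto simp: t swap_inv_apply)
qed

text \<open>If \<open>y\<close> fixes \<open>k\<close> and \<open>k + 1\<close>, a fixed point in
  one of their translates is replaced by the cycle on both neighbours, and comparisons survive
  because the ends of other cycles avoid these two positions. Otherwise all ends are relabelled by
  \<open>s k\<close>, and only an exchange of neighbouring ends could do harm.\<close>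

lemma cycle_less_conj_act:
  assumes y: "y \<in> I" and asc: "y k < y (k + 1)" and T: "tau n i j y \<in> I" "tau n i j y k < tau n i j y (k + 1)"
    and ij: "i < j" "\<not> [i = j] (mod int n)" and lt: "cycle_less y i j" and sij: "s k i < s k j"
  shows "cycle_less (conj_act k y) (s k i) (s k j)"
proof -
  have yG: "y \<in> G" and yy: "y (y x) = x" for x using y I_affine I_invol by auto
  note cy = class_shift(1,2)[OF yG] and cT = class_shift(1,2)[OF I_affine[OF T(1)]]
  show ?thesis
  proof (cases "y k = k \<and> y (k + 1) = k + 1")
    case True
    have e: "conj_act k y = y \<circ> s k" using conj_act_fix[of y k] True by simp
    define K where "K x \<longleftrightarrow> int n dvd x - k" for x
    have zK: "y x = x" "y (x + 1) = x + 1" if "K x" for x using cy[of x] that True unfolding K_def by auto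
    have sK: "s k x = x + 1" "s k (x + 1) = x" if "K x" for x
      using s_left[of "x - k" k] s_right[of "x - k" k] that unfolding K_def by (simp_all add: add.commute)
    have sO: "s k x = x" if "\<not> K x" "\<not> K (x - 1)" for x
      using that refl_t_other[of n x k "k + 1"] unfolding K_def by (simp add: algebra_simps)
    have K1: "K x \<Longrightarrow> \<not> K (x + 1)" for x using dvd_Suc_False[of x k] unfolding K_def by simp
    have cs: "(\<exists>x. K x \<and> (v = x \<or> v = x + 1) \<and> min (s k v) (y v) = x \<and> max (s k v) (y v) = x + 1 \<and> y v = v) \<or>
       (\<not> K v \<and> \<not> K (v - 1) \<and> \<not> K (y v) \<and> \<not> K (y v - 1) \<and> s k v = v)" for v
    proof (cases "K v \<or> K (v - 1)")
      case True
      then show ?thesis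
      proof
        assume "K v"
        then show ?thesis using sK[OF \<open>K v\<close>] zK[OF \<open>K v\<close>] by (intro disjI1 exI[of _ v]) simp
      next
        assume "K (v - 1)"
        then show ?thesis using sK[OF \<open>K (v - 1)\<close>] zK[OF \<open>K (v - 1)\<close>] by (intro disjI1 exI[of _ "v - 1"]) simp
      qed
    next
      case False
      then have "\<not> K (y v)" "\<not> K (y v - 1)" using zK(1)[of "y v"] zK(2)[of "y v - 1"] yy[of v] by auto
      then show ?thesis using False sO by simp
    qed
    have ne: "p \<noteq> x" "p \<noteq> x + 1" if "K x" "\<not> K p" "\<not> K (p - 1)" for p x using that by auto
    have "min (s k i) (y i) < min (s k j) (y j) \<and> max (s k i) (y i) < max (s k j) (y j)"
      using cs[of i]
    proof
      assume "\<exists>x. K x \<and> (i = x \<or> i = x + 1) \<and> min (s k i) (y i) = x \<and> max (s k i) (y i) = x + 1 \<and> y i = i"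
      then obtain x where x: "K x" "i = x \<or> i = x + 1" "min (s k i) (y i) = x" "max (s k i) (y i) = x + 1" "y i = i" by blast
      show ?thesis using cs[of j]
      proof
        assume "\<exists>x. K x \<and> (j = x \<or> j = x + 1) \<and> min (s k j) (y j) = x \<and> max (s k j) (y j) = x + 1 \<and> y j = j"
        then obtain x' where x': "K x'" "j = x' \<or> j = x' + 1" "min (s k j) (y j) = x'" "max (s k j) (y j) = x' + 1" by blast
        \<comment> \<open>If both points came from the same translate, then \<open>i = x\<close> and
          \<open>j = x + 1\<close>, and \<open>s k\<close> would reverse them, contrary to
          \<open>sij\<close>.\<close>
        have "x \<noteq> x'" using x(2) x'(2) ij(1) sij sK[OF x(1)] by auto
        moreover have "x' \<noteq> x - 1" using K1[of x'] x'(1) x(1) by auto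
        moreover have "x' + 1 \<noteq> x" using calculation by auto
        ultimately have "x < x'" using x(2) x'(2) ij(1) by auto
        then show ?thesis unfolding x(3,4) x'(3,4) by simp
      next
        assume c: "\<not> K j \<and> \<not> K (j - 1) \<and> \<not> K (y j) \<and> \<not> K (y j - 1) \<and> s k j = j"
        have "i < min j (y j)" "i < max j (y j)" using lt x(5) unfolding cycle_less_def by auto
        moreover have "j \<noteq> x" "j \<noteq> x + 1" "y j \<noteq> x" "y j \<noteq> x + 1" using ne[OF x(1)] c by blast+
        ultimately have "x + 1 < j" "x + 1 < y j" using x(2) by auto
        then show ?thesis using c unfolding x(3,4) by simp
      qed
    next
      assume c: "\<not> K i \<and> \<not> K (i - 1) \<and> \<not> K (y i) \<and> \<not> K (y i - 1) \<and> s k i = i"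
      show ?thesis using cs[of j]
      proof
        assume "\<exists>x. K x \<and> (j = x \<or> j = x + 1) \<and> min (s k j) (y j) = x \<and> max (s k j) (y j) = x + 1 \<and> y j = j"
        then obtain x where x: "K x" "j = x \<or> j = x + 1" "min (s k j) (y j) = x" "max (s k j) (y j) = x + 1" "y j = j" by blast
        have "min i (y i) < j" "max i (y i) < j" using lt x(5) unfolding cycle_less_def by auto
        moreover have "i \<noteq> x" "i \<noteq> x + 1" "y i \<noteq> x" "y i \<noteq> x + 1" using ne[OF x(1)] c by blast+
        ultimately have "i < x" "y i < x" using x(2) by auto
        then show ?thesis using c unfolding x(3,4) by simp
      next
        assume "\<not> K j \<and> \<not> K (j - 1) \<and> \<not> K (y j) \<and> \<not> K (y j - 1) \<and> s k j = j"
        then show ?thesis using c lt unfolding cycle_less_def by simp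
      qed
    qed
    then show ?thesis unfolding cycle_less_def e by simp
  next
    case False
    have e: "conj_act k y = s k \<circ> y \<circ> s k" by (rule conj_act_asc[OF asc False])
    define a b c d where abcd: "a = min i (y i)" "b = max i (y i)" "c = min j (y j)" "d = max j (y j)"
    have o: "a < c" "b < d" "a \<le> b" "c \<le> d" using lt unfolding cycle_less_def abcd by auto
    have yabcd: "y a = b" "y c = d" using yy unfolding abcd by (auto simp: min_def max_def)
    have mono: "s k u < s k v" if "u < v" "y u = v" for u v
    proof (rule ccontr)
      assume "\<not> s k u < s k v"
      then have "v = u + 1" "int n dvd u - k" using s_less[OF that(1), of k] by auto
      then have "y u < y (u + 1)" using cy[of u] asc by simp
      then show False using that yy[of u] \<open>v = u + 1\<close> by simp
    qed
    have mab: "s k a \<le> s k b" "s k c \<le> s k d" using mono[of a b] mono[of c d] yabcd o by (cases "a = b"; cases "c = d"; auto)+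
    have no: "s k u < s k v" if uv: "u < v" and h: "(u = a \<and> v = c) \<or> (u = b \<and> v = d)" for u v
    proof (rule ccontr)
      assume "\<not> s k u < s k v"
      then have f: "v = u + 1" "int n dvd u - k" using s_less[OF uv, of k] by auto
      then have Tl: "tau n i j y u < tau n i j y v" using cT[of u] T(2) by simp
      show False
      proof (cases "[i = y j] (mod int n)")
        case False
        then show False using tau_desc[OF y ij False lt] h Tl unfolding abcd by auto
      next
        case True
        define M where "M = y j - i"
        have M: "int n dvd M" using True dvd_diff_commute unfolding M_def cong_iff_dvd_diff by blast
        have yj: "y j = i + M" unfolding M_def by simp
        have yi: "y i = j - M" using yy[of j] affine_periodic[OF yG M, of i] unfolding yj by simp
        \<comment> \<open>In the degenerate case the lower ends and the upper ends both differ by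
          \<open>M\<close>. A multiple of \<open>n\<close> is never 1, so these ends are not
          neighbours.\<close>
        have "v - u = M" using h lt ij(1) unfolding abcd cycle_less_def yi yj by (auto simp: min_def max_def split: if_splits)
        then show False using f(1) M not_dvd_one by simp
      qed
    qed
    have m: "min (s k v) (s k (y v)) = s k (min v (y v))" "max (s k v) (s k (y v)) = s k (max v (y v))"
      if "s k (min v (y v)) \<le> s k (max v (y v))" for v using that by (auto simp: min_def max_def split: if_splits)
    have "s k a < s k c" "s k b < s k d" using no o by auto
    then show ?thesis unfolding cycle_less_def e using m[of i] m[of j] mab unfolding abcd by simp
  qed
qed

text \<open>A letter prepended to \<open>?w\<close> could destroy the inversion only by exchanging
  the two neighbouring values involved. Their positions would then be in the order of a left
  descent, and the longer word would not be reduced.\<close>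

lemma inversion_persists:
  "reduced (l @ m) \<Longrightarrow> x < y \<Longrightarrow> word_prod n m y < word_prod n m x \<Longrightarrow> word_prod n (l @ m) y < word_prod n (l @ m) x"
proof (induction l)
  case Nil
  then show ?case by simp
next
  case (Cons r l)
  let ?w = "word_prod n (l @ m)"
  have r: "reduced (l @ m)" "inv ?w r < inv ?w (r + 1)" using reduced_Cons[of r "l @ m"] Cons(2) by simp_all
  have wxy: "?w y < ?w x" by (rule Cons(1)[OF r(1) Cons(3,4)])
  have wG: "?w \<in> G" by (rule word_prod_affine)
  have "s r (?w y) < s r (?w x)"
  proof (rule ccontr)
    assume "\<not> s r (?w y) < s r (?w x)"
    then have f: "?w x = ?w y + 1" "int n dvd ?w y - r" using s_less[OF wxy, of r] by auto
    have "inv ?w (?w y) = y" "inv ?w (?w y + 1) = x" using f(1) affine_bij[OF wG] by (metis bij_is_inj inv_f_f)+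
    then have "x - y = inv ?w (r + 1) - inv ?w r" using class_shift(1,2)[OF affine_inv[OF wG] f(2)] by simp
    then show False using r(2) Cons(3) by simp
  qed
  then show "word_prod n ((r # l) @ m) y < word_prod n ((r # l) @ m) x" by simp
qed

lemma reduced_suffix: "reduced (l @ m) \<Longrightarrow> reduced m"
  using reduced_append[of "rev m" "rev l"] reduced_rev[of "l @ m"] reduced_rev[of m] by simp

lemma word_conj:
  assumes "word_prod n m i = a" "word_prod n m j = a + 1"
  shows "word_prod n (l @ a # m) = word_prod n (l @ m) \<circ> refl_t n i j"
proof -
  have "word_prod n m \<circ> refl_t n i j = s a \<circ> word_prod n m" using refl_t_conj[OF word_prod_affine, of m i j] assms by simp
  then show ?thesis by (simp add: comp_assoc)
qed

text \<open>The suffix \<open>m\<close> sends \<open>i\<close> and \<open>j\<close> to neighbouring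
  values, so every position between them forms an inversion of the suffix with \<open>i\<close> or
  with \<open>j\<close>. The prefix preserves this inversion, which is the covering
  condition.\<close>

lemma cover_word:
  assumes red: "reduced (l @ m)" "reduced (l @ a # m)" and i: "word_prod n m i = a" and j: "word_prod n m j = a + 1"
  shows "cover_at (word_prod n (l @ m)) i j"
proof -
  let ?w = "word_prod n m"
  have inj: "?w u = ?w v \<longleftrightarrow> u = v" for u v using affine_inj[OF word_prod_affine] by (simp add: inj_eq)
  have "inv ?w a = i" "inv ?w (a + 1) = j" using i j affine_inj[OF word_prod_affine, of m] by (metis inv_f_f)+
  then have ij: "i < j" using reduced_Cons(2)[OF reduced_suffix[OF red(2)]] by simp
  have "word_prod n (l @ a # m) j < word_prod n (l @ a # m) i"
    by (rule inversion_persists[OF red(2) ij]) (use i j in simp)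
  then have lt: "word_prod n (l @ m) i < word_prod n (l @ m) j" unfolding word_prod_append word_prod_Cons using i j
    by simp
  have "word_prod n (l @ m) e < word_prod n (l @ m) i \<or> word_prod n (l @ m) j < word_prod n (l @ m) e" if e: "i < e" "e < j" for e
  proof -
    have "?w e \<noteq> a" "?w e \<noteq> a + 1" using e inj i j by (metis order_less_irrefl)+
    then consider "?w e < ?w i" | "?w j < ?w e" using i j by linarith
    then show ?thesis using inversion_persists[OF red(1)] e by cases blast+
  qed
  then show ?thesis unfolding cover_at_def using ij lt by blast
qed

text \<open>The strong exchange property: with the letters read from the right, the letter sought is
  the one by which the values at \<open>i\<close> and \<open>j\<close> become inverted for the first
  time.\<close>

lemma exchange:
  "i < j \<Longrightarrow> word_prod n L j < word_prod n L i \<Longrightarrow>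
    \<exists>l a m. length (l @ a # m) = length L \<and> word_prod n (l @ a # m) = word_prod n L \<and> word_prod n m i = a \<and> word_prod n m j = a + 1"
proof (induction L)
  case Nil
  then show ?case by simp
next
  case (Cons r L)
  let ?w = "word_prod n L"
  show "\<exists>l a m. length (l @ a # m) = length (r # L) \<and> word_prod n (l @ a # m) = word_prod n (r # L) \<and> word_prod n m i = a \<and> word_prod n m j = a + 1"
  proof (cases "?w j < ?w i")
    case True
    then obtain l a m where "length (l @ a # m) = length L" "word_prod n (l @ a # m) = ?w" "word_prod n m i = a" "word_prod n m j = a + 1"
      using Cons by blast
    then show ?thesis by (intro exI[of _ "r # l"] exI[of _ a] exI[of _ m]) simp
  next
    case False
    have "?w i \<noteq> ?w j" using Cons(2) affine_inj[OF word_prod_affine, of L] by (metis inj_eq order_less_irrefl)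
    then have lt: "?w i < ?w j" using False by simp
    have "s r (?w j) < s r (?w i)" using Cons(3) by simp
    then have f: "?w j = ?w i + 1" "int n dvd ?w i - r" using s_less[OF lt, of r] by auto
    \<comment> \<open>The letter \<open>r\<close> is replaced by the congruent letter
      \<open>?w i\<close>, so that the suffix takes the values \<open>a\<close> and
      \<open>a + 1\<close> literally and not just up to translation.\<close>
    have "s (?w i) = s r" using s_shift[OF f(2), of r] by simp
    then show ?thesis using f by (intro exI[of _ "[]"] exI[of _ "?w i"] exI[of _ L]) simp
  qed
qed

lemma hecke_atom:
  assumes "\<pi> \<in> atoms n z"
  shows "hecke \<pi> = z" "z \<in> I" "shape \<pi> z" "\<pi> \<in> G"
proof -
  show p: "hecke \<pi> = z" "\<pi> \<in> G" using assms unfolding atoms_iff_height by simp_all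
  show "z \<in> I" using hecke_I_height[OF p(2)] unfolding p(1) by simp
  show "shape \<pi> z" using atom_shape[OF p(2)] assms by simp
qed

text \<open>The induction removes the same last letter from both words. Both shorter products are
  atoms again, but of other involutions, which is why \<open>y\<close> and \<open>z\<close> are
  generalized. If the deleted letter itself is last, it is an ascent of \<open>y\<close> at
  neighbours and the claim is immediate.\<close>

lemma atoms_cycle_less:
  "reduced (l @ m) \<Longrightarrow> reduced (l @ a # m) \<Longrightarrow> word_prod n m i = a \<Longrightarrow> word_prod n m j = a + 1 \<Longrightarrow>
    word_prod n (l @ m) \<in> atoms n y \<Longrightarrow> word_prod n (l @ a # m) \<in> atoms n z \<Longrightarrow> cycle_less y i j"
proof (induction m arbitrary: i j y z rule: rev_induct)
  case Nil
  have ij: "i = a" "j = a + 1" using Nil(3,4) by simp_all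
  have "reduced (l @ [a])" using Nil(2) by simp
  then have asc: "word_prod n l a < word_prod n l (a + 1)" by (rule reduced_snoc(2))
  have p: "word_prod n (l @ []) \<in> atoms n y" by (rule Nil(5))
  have "word_prod n (l @ [a]) \<in> atoms n z" by (rule Nil(6))
  moreover have "word_prod n (l @ [a]) (a + 1) < word_prod n (l @ [a]) a" using asc by simp
  ultimately obtain y0 where y0: "y0 a < y0 (a + 1)" "word_prod n (l @ [a]) \<circ> s a \<in> atoms n y0" using atom_desc by blast
  have e: "word_prod n (l @ [a]) \<circ> s a = word_prod n (l @ [])" by (simp add: comp_assoc)
  have "y0 = y" using hecke_atom(1)[OF y0(2)] hecke_atom(1)[OF p] unfolding e by simp
  then show ?case using y0(1) unfolding ij cycle_less_def by auto
next
  case (snoc k m)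
  have red: "reduced ((l @ m) @ [k])" "reduced ((l @ a # m) @ [k])" using snoc(2,3) by simp_all
  note r1 = reduced_snoc[OF red(1)] and r2 = reduced_snoc[OF red(2)]
  have w1: "word_prod n (l @ m @ [k]) = word_prod n (l @ m) \<circ> s k" and w2: "word_prod n (l @ a # m @ [k]) = word_prod n (l @ a # m) \<circ> s k"
    by (simp_all add: comp_assoc)
  have 1: "word_prod n (l @ m) \<circ> s k \<in> atoms n y" unfolding w1[symmetric] by (rule snoc(6))
  have 2: "word_prod n (l @ a # m) \<circ> s k \<in> atoms n z" unfolding w2[symmetric] by (rule snoc(7))
  have d1: "(word_prod n (l @ m) \<circ> s k) (k + 1) < (word_prod n (l @ m) \<circ> s k) k" using r1(2) by simp
  have d2: "(word_prod n (l @ a # m) \<circ> s k) (k + 1) < (word_prod n (l @ a # m) \<circ> s k) k" using r2(2) by simp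
  obtain y1 where y1: "y1 \<in> I" "y1 k < y1 (k + 1)" "conj_act k y1 = y" "word_prod n (l @ m) \<circ> s k \<circ> s k \<in> atoms n y1"
    using atom_desc[OF 1 d1] by blast
  obtain z1 where z1: "z1 \<in> I" "z1 k < z1 (k + 1)" "conj_act k z1 = z" "word_prod n (l @ a # m) \<circ> s k \<circ> s k \<in> atoms n z1"
    using atom_desc[OF 2 d2] by blast
  have a1: "word_prod n (l @ m) \<in> atoms n y1" and a2: "word_prod n (l @ a # m) \<in> atoms n z1"
    using y1(4) z1(4) by (simp_all only: comp_refl_t_comp_refl_t)
  define i' j' where "i' = s k i" and "j' = s k j"
  have ij': "word_prod n m i' = a" "word_prod n m j' = a + 1" using snoc(4,5) unfolding i'_def j'_def by simp_all
  have cl: "cycle_less y1 i' j'" by (rule snoc(1)[OF r1(1) r2(1) ij' a1 a2])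
  have cov: "cover_at (word_prod n (l @ m)) i' j'" by (rule cover_word[OF r1(1) r2(1) ij'])
  have i_j': "i' < j'" using cov unfolding cover_at_def by simp
  have cong: "\<not> [i' = j'] (mod int n)"
  proof
    assume "[i' = j'] (mod int n)"
    then have "word_prod n m i' - word_prod n m j' = i' - j'" by (intro affine_diff_dvd[OF word_prod_affine]) (simp add: cong_iff_dvd_diff)
    then have "i' - j' = - 1" using ij' by simp
    then show False using \<open>[i' = j'] (mod int n)\<close> not_dvd_one unfolding cong_iff_dvd_diff by simp
  qed
  note sw = swap_shape[OF word_prod_affine y1(1) hecke_atom(3)[OF a1] cov cong cl]
  \<comment> \<open>An atom determines its involution. Since \<open>z1\<close> arose by removing the
    letter \<open>k\<close>, this shows that \<open>k\<close> is an ascent of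
    \<open>tau n i' j' y1\<close>.\<close>
  have "tau n i' j' y1 = z1" using hecke_atom(1)[OF sw(1)] hecke_atom(1)[OF a2] word_conj[OF ij', of l] by simp
  then have T: "tau n i' j' y1 k < tau n i' j' y1 (k + 1)" using z1(2) by simp
  have "cover_at (word_prod n (l @ m @ [k])) i j" using cover_word[of l "m @ [k]" a i j] snoc(2-5) by simp
  then have "s k i' < s k j'" unfolding cover_at_def i'_def j'_def by simp
  then have "cycle_less (conj_act k y1) (s k i') (s k j')"
    by (rule cycle_less_conj_act[OF y1(1,2) sw(2) T i_j' cong cl])
  then show ?case unfolding y1(3) i'_def j'_def by simp
qed

text \<open>The strong exchange property is applied to the longer element. Deleting the letter
  leaves a word for \<open>\<pi>\<close> with one letter less, which is just the length of
  \<open>\<pi>\<close>, so both words are reduced.\<close>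

lemma cover_words:
  assumes p: "\<pi> \<in> G" and len: "len n (\<pi> \<circ> refl_t n i j) = len n \<pi> + 1" and ij: "i < j" "\<not> [i = j] (mod int n)"
  obtains l a m where "reduced (l @ m)" "reduced (l @ a # m)" "word_prod n m i = a" "word_prod n m j = a + 1"
    "word_prod n (l @ m) = \<pi>" "word_prod n (l @ a # m) = \<pi> \<circ> refl_t n i j"
proof -
  define \<sigma> where "\<sigma> = \<pi> \<circ> refl_t n i j"
  have sG: "\<sigma> \<in> G" using p affine_comp refl_t_affine unfolding \<sigma>_def by blast
  have t: "refl_t n i j i = j" "refl_t n i j j = i" using refl_t_left[OF ij(2), of 0] refl_t_right[OF ij(2), of 0] by simp_all
  have drop: "\<exists>l a m. length (l @ a # m) = len n w \<and> word_prod n (l @ a # m) = w \<and> word_prod n m i = a \<and> word_prod n m j = a + 1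
      \<and> word_prod n (l @ m) = w \<circ> refl_t n i j"
    if w: "w \<in> G" "w j < w i" for w
  proof -
    obtain L where L: "length L = len n w" "word_prod n L = w" using reduced_word[OF w(1)] .
    obtain l a m where m: "length (l @ a # m) = length L" "word_prod n (l @ a # m) = word_prod n L" "word_prod n m i = a" "word_prod n m j = a + 1"
      using exchange[OF ij(1), of L] w(2) L by blast
    have "word_prod n (l @ a # m) \<circ> refl_t n i j = word_prod n (l @ m)"
      unfolding word_conj[OF m(3,4)] by (rule comp_refl_t_comp_refl_t)
    then show ?thesis using m L by metis
  qed
  have st: "\<sigma> \<circ> refl_t n i j = \<pi>" unfolding \<sigma>_def by simp
  \<comment> \<open>Otherwise the exchange property applied to \<open>\<pi>\<close> would give
    \<open>\<sigma>\<close> a word shorter than the length of \<open>\<pi>\<close>.\<close>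
  have "\<sigma> j < \<sigma> i"
  proof (rule ccontr)
    assume "\<not> \<sigma> j < \<sigma> i"
    moreover have "\<sigma> j \<noteq> \<sigma> i" using affine_inj[OF sG] ij(1) by (simp add: inj_eq)
    ultimately have "\<pi> j < \<pi> i" unfolding \<sigma>_def using t by simp
    from drop[OF p this] obtain l a m where "length (l @ a # m) = len n \<pi>" "word_prod n (l @ m) = \<sigma>" unfolding \<sigma>_def by blast
    then show False using len_word[of "l @ m"] len unfolding \<sigma>_def[symmetric] by simp
  qed
  from drop[OF sG this] obtain l a m where m: "length (l @ a # m) = len n \<sigma>" "word_prod n (l @ a # m) = \<sigma>" "word_prod n m i = a" "word_prod n m j = a + 1"
    "word_prod n (l @ m) = \<pi>" unfolding st by blast
  have "reduced (l @ a # m)" unfolding reduced_def m(2) using m(1) by simp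
  moreover have "reduced (l @ m)" unfolding reduced_def m(5) using m(1) len unfolding \<sigma>_def[symmetric] by simp
  ultimately show ?thesis using that m unfolding \<sigma>_def by blast
qed

lemma covering_property:
  assumes y: "y \<in> I" and p: "\<pi> \<in> atoms n y" and ij: "i < j" "\<not> [i = j] (mod int n)"
    and c: "bruhat_covered n \<pi> (\<pi> \<circ> refl_t n i j)"
  shows "\<pi> \<circ> refl_t n i j \<in> atoms n z \<longleftrightarrow> z = tau n i j y \<and> tau n i j y \<noteq> y"
proof -
  have pG: "\<pi> \<in> G" and len: "len n (\<pi> \<circ> refl_t n i j) = len n \<pi> + 1" using c unfolding bruhat_covered_def by auto
  obtain l a m where m: "reduced (l @ m)" "reduced (l @ a # m)" "word_prod n m i = a" "word_prod n m j = a + 1"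
    "word_prod n (l @ m) = \<pi>" "word_prod n (l @ a # m) = \<pi> \<circ> refl_t n i j" using cover_words[OF pG len ij] .
  have cov: "cover_at \<pi> i j" using cover_word[OF m(1-4)] m(5) by simp
  have sw: "\<pi> \<circ> refl_t n i j \<in> atoms n (tau n i j y)" if "cycle_less y i j"
    by (rule swap_shape(1)[OF pG y hecke_atom(3)[OF p] cov ij(2) that])
  show ?thesis
  proof
    assume z: "\<pi> \<circ> refl_t n i j \<in> atoms n z"
    have "cycle_less y i j" using atoms_cycle_less[OF m(1-4)] p z unfolding m(5,6) by blast
    then have "tau n i j y = z" using hecke_atom(1)[OF sw] hecke_atom(1)[OF z] by simp
    \<comment> \<open>Atoms of one involution all have the same length, whereas the reflection has
      raised the length by one.\<close>
    moreover have "z \<noteq> y" using z p len unfolding atoms_iff_height by auto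
    ultimately show "z = tau n i j y \<and> tau n i j y \<noteq> y" by simp
  next
    assume z: "z = tau n i j y \<and> tau n i j y \<noteq> y"
    then have "cycle_less y i j" using tau_idle[OF ij(1)] by blast
    then show "\<pi> \<circ> refl_t n i j \<in> atoms n z" using sw z by simp
  qed
qed

end

theorem theorem4p8:
  fixes n :: nat and y z \<pi> :: "int \<Rightarrow> int" and i j :: int
  assumes "n > 0"
    and "y \<in> affine_involutions n" and "z \<in> affine_involutions n"
    and "\<pi> \<in> atoms n y"
    and "i < j" and "\<not> [i = j] (mod int n)"
    and "bruhat_covered n \<pi> (\<pi> \<circ> refl_t n i j)"
  shows "\<pi> \<circ> refl_t n i j \<in> atoms n z \<longleftrightarrow> z = tau n i j y \<and> tau n i j y \<noteq> y"
proof -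
  have "n \<noteq> 1" using assms(6) by (auto simp: cong_iff_dvd_diff)
  then interpret affine n using assms(1) by unfold_locales simp
  show ?thesis by (rule covering_property[OF assms(2,4-7)])
qed

end
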